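(* Let $\Omega$ be a Polish space with Borel $\sigma$-algebra $\Sigma$, let $m:\Sigma\to Y$ be a countably additive vector measure with values in a real Banach space $Y$, and let $\mu$ be a Borel measure on $\Omega$ which is a Rybakov control measure for $m$. Let $\Phi_0,\Phi_1$ be Young functions with $\Phi_0,\Phi_1\in\Delta_2$, let $0<\theta<1$, and let $\Phi$ be such that $\Phi^{-1}=(\Phi_0^{-1})^{1-\theta}(\Phi_1^{-1})^{\theta}$. Then $$[L^{\Phi_0}(\|m\|),L^{\Phi_1}(\|m\|)]_{\theta}=L^{\Phi}(\|m\|),$$ where the spaces are taken to be complex (spaces of $\mathbb{C}$-valued functions).
   Context: For $y^*\in Y^*$, $\langle m,y^*\rangle(A):=\langle m(A),y^*\rangle$, with variation $|\langle m,y^*\rangle|$; $B_{Y^*}$ is the closed unit ball of $Y^*$. The semivariation is $\|m\|(A):=\sup\{|\langle m,y^*\rangle|(A):y^*\in B_{Y^*}\}$. A Rybakov control measure for $m$ is a measure $\mu=|\langle m,y_0^*\rangle|$, $y_0^*\in B_{Y^*}$, with $\|m\|(A)\to0$ iff $\mu(A)\to0$. $L^0(\mu)$ is the space of ($\mu$-a.e. classes of) measurable functions $f:\Omega\to\mathbb{C}$. $L^1(\|m\|)$ is the space of $f\in L^0(\mu)$ with $\|f\|_{L^1(\|m\|)}:=\int_0^\infty\|m\|(\{w:|f(w)|>t\})\,dt<\infty$; this is a quasi-norm making $L^1(\|m\|)$ a quasi-Banach space. A Young function is a function $\Phi:[0,\infty)\to[0,\infty)$ that is strictly increasing, continuous,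 convex, with $\Phi(0)=0$ and $\lim_{t\to\infty}\Phi(t)=\infty$; $\Phi\in\Delta_2$ means there is $C>1$ with $\Phi(2t)\le C\Phi(t)$ for all $t\ge0$. The function $\Phi$ with $\Phi^{-1}=(\Phi_0^{-1})^{1-\theta}(\Phi_1^{-1})^{\theta}$ (pointwise on $[0,\infty)$) is again a Young function. $L^{\Phi}(\|m\|):=\{f\in L^0(\mu):\exists\,c>0,\ \Phi(|f|/c)\in L^1(\|m\|)\}$ with quasi-norm $\|f\|_{L^{\Phi}(\|m\|)}:=\inf\{k>0:\Phi(|f|/k)\in L^1(\|m\|),\ \|\Phi(|f|/k)\|_{L^1(\|m\|)}\le1\}$. Complex method (Kalton–Mitrea). For quasi-Banach spaces $X_0,X_1$ continuously included in a common Hausdorff topological vector space (here $L^0(\mu)$ with convergence in measure), let $U=\{z\in\mathbb{C}:0<\operatorname{Re}z<1\}$. A function with values in a quasi-Banach space is analytic if locally it is the sum of a convergent power series. Let $\mathcal{F}$ be the space of bounded analytic functions $F:U\to X_0+X_1$ which extend continuously to $\overline{U}$ and whose traces $t\mapsto F(j+it)$ are bounded continuous functions from $\mathbb{R}$ into $X_j$, $j=0,1$, with $\|F\|_{\mathcal{F}}:=\max_{j=0,1}\sup_{t\in\mathbb{R}}\|F(j+it)\|_{X_j}$. Then $[X_0,X_1]_\theta:=\{F(\theta):F\in\mathcal{F}\}$ with $\|x\|_\theta:=\inf\{\|F\|_{\mathcal{F}}:F\in\mathcal{F},\,F(\theta)=x\}$. The equality of spaces is understood as equality of sets of functions with equivalent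 quasi-norms. *)

theory Defs
  imports "HOL-Analysis.Analysis"
begin

section \<open>Vector measures and semivariation\<close>

text \<open>The case of the constantly empty sequence gives \<open>m {} = 0\<close>. Values of \<open>m\<close> outside
  \<open>sets M\<close> are irrelevant.\<close>

definition vector_measure :: "'a measure \<Rightarrow> ('a set \<Rightarrow> 'y::real_normed_vector) \<Rightarrow> bool" where
  "vector_measure M m \<longleftrightarrow>
     (\<forall>A::nat \<Rightarrow> 'a set. range A \<subseteq> sets M \<longrightarrow> disjoint_family A \<longrightarrow> (\<lambda>n. m (A n)) sums m (\<Union>n. A n))"

definition variation :: "'a measure \<Rightarrow> ('a set \<Rightarrow> real) \<Rightarrow> 'a set \<Rightarrow> ennreal" where
  "variation M \<nu> A =
     (SUP P \<in> {P. finite P \<and> P \<subseteq> sets M \<and> partition_on A P}. \<Sum>B\<in>P. ennreal \<bar>\<nu> B\<bar>)"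

definition scalar_measure :: "('a set \<Rightarrow> 'y::real_normed_vector) \<Rightarrow> ('y \<Rightarrow>\<^sub>L real) \<Rightarrow> 'a set \<Rightarrow> real" where
  "scalar_measure m y' A = blinfun_apply y' (m A)"

definition semivariation :: "'a measure \<Rightarrow> ('a set \<Rightarrow> 'y::real_normed_vector) \<Rightarrow> 'a set \<Rightarrow> ennreal" where
  "semivariation M m A = (SUP y' \<in> cball 0 1. variation M (scalar_measure m y') A)"

text \<open>Only the measurable space underlying \<open>\<mu>\<close> enters \<open>variation \<mu>\<close> and \<open>semivariation \<mu>\<close>.\<close>

definition rybakov_control_measure :: "'a measure \<Rightarrow> ('a set \<Rightarrow> 'y::real_normed_vector) \<Rightarrow> bool" where
  "rybakov_control_measure \<mu> m \<longleftrightarrow>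
     (\<exists>y0 \<in> cball 0 1. \<forall>A \<in> sets \<mu>. emeasure \<mu> A = variation \<mu> (scalar_measure m y0) A) \<and>
     (\<forall>A::nat \<Rightarrow> 'a set. range A \<subseteq> sets \<mu> \<longrightarrow>
        (((\<lambda>n. semivariation \<mu> m (A n)) \<longlonglongrightarrow> 0) \<longleftrightarrow> ((\<lambda>n. emeasure \<mu> (A n)) \<longlonglongrightarrow> 0)))"


section \<open>Quasi-normed spaces of measurable functions\<close>

text \<open>
  A subspace of \<open>L\<^sup>0(\<mu>)\<close> is represented by the set of all its representatives, a set of complex
  measurable functions that is closed under \<open>\<mu>\<close>-a.e. equality, together with a quasi-norm which does
  not depend on the representative. The value of the quasi-norm is only meaningful on the carrier.
\<close>

type_synonym 'a qnspace = "('a \<Rightarrow> complex) set \<times> (('a \<Rightarrow> complex) \<Rightarrow> real)"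

abbreviation carrier_of :: "'a qnspace \<Rightarrow> ('a \<Rightarrow> complex) set" where
  "carrier_of X \<equiv> fst X"

abbreviation qnorm_of :: "'a qnspace \<Rightarrow> ('a \<Rightarrow> complex) \<Rightarrow> real" where
  "qnorm_of X \<equiv> snd X"

definition same_qnspace :: "'a qnspace \<Rightarrow> 'a qnspace \<Rightarrow> bool" where
  "same_qnspace X Y \<longleftrightarrow>
     carrier_of X = carrier_of Y \<and>
     (\<exists>c>0. \<exists>C>0. \<forall>f \<in> carrier_of X. c * qnorm_of Y f \<le> qnorm_of X f \<and> qnorm_of X f \<le> C * qnorm_of Y f)"


section \<open>The spaces \<open>L\<^sup>1(\<parallel>m\<parallel>)\<close> and \<open>L\<^sup>\<Phi>(\<parallel>m\<parallel>)\<close>\<close>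

definition L1_qnorm :: "'a measure \<Rightarrow> ('a set \<Rightarrow> 'y::real_normed_vector) \<Rightarrow> ('a \<Rightarrow> complex) \<Rightarrow> ennreal" where
  "L1_qnorm \<mu> m f = (\<integral>\<^sup>+t\<in>{0..}. semivariation \<mu> m {w \<in> space \<mu>. norm (f w) > t} \<partial>lborel)"

definition L1_semivar :: "'a measure \<Rightarrow> ('a set \<Rightarrow> 'y::real_normed_vector) \<Rightarrow> ('a \<Rightarrow> complex) set" where
  "L1_semivar \<mu> m = {f \<in> borel_measurable \<mu>. L1_qnorm \<mu> m f < \<infinity>}"

text \<open>Functions on \<open>[0,\<infinity>)\<close> are functions on \<open>real\<close> whose values at negative arguments are ignored.
  Nonnegativity on \<open>[0,\<infinity>)\<close> follows from monotonicity and \<open>\<Phi> 0 = 0\<close>.\<close>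

definition young_function :: "(real \<Rightarrow> real) \<Rightarrow> bool" where
  "young_function \<Phi> \<longleftrightarrow>
     strict_mono_on {0..} \<Phi> \<and> continuous_on {0..} \<Phi> \<and> convex_on {0..} \<Phi> \<and>
     \<Phi> 0 = 0 \<and> filterlim \<Phi> at_top at_top"

definition Delta2 :: "(real \<Rightarrow> real) \<Rightarrow> bool" where
  "Delta2 \<Phi> \<longleftrightarrow> (\<exists>C>1. \<forall>t\<ge>0. \<Phi> (2 * t) \<le> C * \<Phi> t)"

definition orlicz_modular :: "(real \<Rightarrow> real) \<Rightarrow> ('a \<Rightarrow> complex) \<Rightarrow> real \<Rightarrow> 'a \<Rightarrow> complex" where
  "orlicz_modular \<Phi> f c = (\<lambda>w. complex_of_real (\<Phi> (norm (f w) / c)))"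

definition orlicz_space ::
    "'a measure \<Rightarrow> ('a set \<Rightarrow> 'y::real_normed_vector) \<Rightarrow> (real \<Rightarrow> real) \<Rightarrow> 'a qnspace" where
  "orlicz_space \<mu> m \<Phi> =
     ({f \<in> borel_measurable \<mu>. \<exists>c>0. orlicz_modular \<Phi> f c \<in> L1_semivar \<mu> m},
      \<lambda>f. Inf {k. k > 0 \<and> orlicz_modular \<Phi> f k \<in> L1_semivar \<mu> m \<and>
                  L1_qnorm \<mu> m (orlicz_modular \<Phi> f k) \<le> 1})"


section \<open>The complex method for quasi-Banach function spaces\<close>

definition sum_space :: "'a measure \<Rightarrow> 'a qnspace \<Rightarrow> 'a qnspace \<Rightarrow> 'a qnspace" where
  "sum_space \<mu> X0 X1 =
     ({f \<in> borel_measurable \<mu>.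
         \<exists>g \<in> carrier_of X0. \<exists>h \<in> carrier_of X1. AE w in \<mu>. f w = g w + h w},
      \<lambda>f. Inf {qnorm_of X0 g + qnorm_of X1 h | g h.
                g \<in> carrier_of X0 \<and> h \<in> carrier_of X1 \<and> (AE w in \<mu>. f w = g w + h w)})"

text \<open>The quasi-norm balls around 0 form a neighbourhood base at 0, so that convergence of \<open>F z\<close>
  to \<open>x\<close> means that the quasi-norm of \<open>F z - x\<close> tends to 0.\<close>

definition qn_bounded_on :: "'a qnspace \<Rightarrow> 'z set \<Rightarrow> ('z \<Rightarrow> 'a \<Rightarrow> complex) \<Rightarrow> bool" where
  "qn_bounded_on X S F \<longleftrightarrow> (\<forall>z\<in>S. F z \<in> carrier_of X) \<and> (\<exists>B. \<forall>z\<in>S. qnorm_of X (F z) \<le> B)"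

definition qn_continuous_on ::
    "'a qnspace \<Rightarrow> 'z::topological_space set \<Rightarrow> ('z \<Rightarrow> 'a \<Rightarrow> complex) \<Rightarrow> bool" where
  "qn_continuous_on X S F \<longleftrightarrow>
     (\<forall>z\<in>S. F z \<in> carrier_of X) \<and>
     (\<forall>z\<in>S. ((\<lambda>z'. qnorm_of X (\<lambda>w. F z' w - F z w)) \<longlongrightarrow> 0) (at z within S))"

definition qn_analytic_on :: "'a qnspace \<Rightarrow> complex set \<Rightarrow> (complex \<Rightarrow> 'a \<Rightarrow> complex) \<Rightarrow> bool" where
  "qn_analytic_on X S F \<longleftrightarrow>
     (\<forall>z\<in>S. F z \<in> carrier_of X) \<and>
     (\<forall>z0\<in>S. \<exists>r>0. \<exists>a::nat \<Rightarrow> 'a \<Rightarrow> complex.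
        ball z0 r \<subseteq> S \<and> (\<forall>n. a n \<in> carrier_of X) \<and>
        (\<forall>z \<in> ball z0 r.
           (\<lambda>n. qnorm_of X (\<lambda>w. F z w - (\<Sum>k<n. (z - z0) ^ k * a k w))) \<longlonglongrightarrow> 0))"

definition unit_strip :: "complex set" where
  "unit_strip = {z. 0 < Re z \<and> Re z < 1}"

text \<open>\<open>F\<close> is taken to be already extended to the closed strip; \<open>Complex j t\<close> is \<open>j + it\<close>.\<close>

definition interp_functions ::
    "'a measure \<Rightarrow> 'a qnspace \<Rightarrow> 'a qnspace \<Rightarrow> (complex \<Rightarrow> 'a \<Rightarrow> complex) set" where
  "interp_functions \<mu> X0 X1 =
     {F. qn_bounded_on (sum_space \<mu> X0 X1) unit_strip F \<and>
         qn_analytic_on (sum_space \<mu> X0 X1) unit_strip F \<and>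
         qn_continuous_on (sum_space \<mu> X0 X1) (closure unit_strip) F \<and>
         qn_bounded_on X0 UNIV (\<lambda>t. F (Complex 0 t)) \<and>
         qn_continuous_on X0 UNIV (\<lambda>t. F (Complex 0 t)) \<and>
         qn_bounded_on X1 UNIV (\<lambda>t. F (Complex 1 t)) \<and>
         qn_continuous_on X1 UNIV (\<lambda>t. F (Complex 1 t))}"

definition interp_functions_norm ::
    "'a qnspace \<Rightarrow> 'a qnspace \<Rightarrow> (complex \<Rightarrow> 'a \<Rightarrow> complex) \<Rightarrow> real" where
  "interp_functions_norm X0 X1 F =
     max (SUP t. qnorm_of X0 (F (Complex 0 t))) (SUP t. qnorm_of X1 (F (Complex 1 t)))"

definition complex_interp :: "'a measure \<Rightarrow> 'a qnspace \<Rightarrow> 'a qnspace \<Rightarrow> real \<Rightarrow> 'a qnspace" where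
  "complex_interp \<mu> X0 X1 \<theta> =
     ({f \<in> borel_measurable \<mu>.
         \<exists>F \<in> interp_functions \<mu> X0 X1. AE w in \<mu>. F (complex_of_real \<theta>) w = f w},
      \<lambda>f. Inf {interp_functions_norm X0 X1 F | F.
                F \<in> interp_functions \<mu> X0 X1 \<and> (AE w in \<mu>. F (complex_of_real \<theta>) w = f w)})"

end

(*
  Interpolating upwards is Calderon's formula: with W = Phi(|f| / k), a = Phi0^-1(W), b = Phi1^-1(W), the
  function F(z) = k sgn(f) a^(1-z) b^z has F(theta) = f, and all continuity and analyticity requirements
  follow from dominated convergence, which holds because mu controls the semivariation.

  For the converse, sigma = ||m|| is the supremum of the measures |<m,y'>|, and L^1(||m||) is not locally convex,
  so averages of F over the boundary of the strip must be taken with exponent 1/2.  All spaces embed into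
  L^1(mu); hence F has a version that is, for almost every w, a scalar holomorphic function of z.  Transplanted
  to the disc, |F|^(1/2) is subharmonic, and comparing with sampled boundary values
  gives, for every real c,
    |f|^(1/2) <= (1 - theta) e^(-theta c / 2) A0 + theta e^((1 - theta) c / 2) A1 + error,
  where Aj is a finite average of |F|^(1/2) over the line Re z = j.  Optimising in c yields
  |f| <= A0^(2(1 - theta)) A1^(2 theta) in the limit, and Aj^2 is controlled in L^Phij(||m||) by lattice
  1/2-convexity, which follows from a dyadic estimate of distribution functions.
*)

theory Submission
  imports Defs "HOL-Complex_Analysis.Complex_Analysis"
    "HOL-Computational_Algebra.Fundamental_Theorem_Algebra"
begin

section \<open>The variation of a signed measure\<close>

text \<open>Why the exponent 1/2: for v > t, sqrt (v / t) is at most the sum over i of 2^(i+1) times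
  the indicator of {v > 4^i t}, and integrating the i-th level set over t gains 4^(-i), so the
  series sums to 4. With exponent 1 the weights 4^(i+1) would eat up this gain and the series would
  diverge. The pointwise inequality is integrated against each measure of the family separately,
  where integration is additive; the supremum is taken only afterwards. The relation between the
  inverse functions enters level by level. If Aj^2 <= 4 M Phij^-1(t) holds on both lines, where M
  bounds the norm of F, the optimised inequality gives |f| <= 4 M Phi^-1(t). So Phi(|f| / (4 M)) is
  dominated in the limit by the maximum of two functions with Choquet integral at most 4 each;
  maxima, unlike sums, are harmless for the Choquet integral. Convexity is replaced throughout by
  Phi(c x) <= c Phi(x) for 0 <= c <= 1, because this property carries over from the two given
  inverses to their geometric mean in one line.\<close>

lemma vector_measureD:
  "vector_measure M \<nu> \<Longrightarrow> range A \<subseteq> sets M \<Longrightarrow> disjoint_family A \<Longrightarrow> (\<lambda>n. \<nu> (A n)) sums \<nu> (\<Union>n. A n)"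
  for A :: "nat \<Rightarrow> 'a set"
  by (auto simp: vector_measure_def)

lemma vector_measure_empty:
  assumes "vector_measure M \<nu>" shows "\<nu> {} = 0"
proof -
  have "(\<lambda>n::nat. \<nu> {}) sums \<nu> (\<Union>n::nat. {})"
    by (rule vector_measureD[OF assms]) (auto simp: disjoint_family_on_def)
  then have "summable (\<lambda>n::nat. \<nu> {})" by (rule sums_summable)
  then show ?thesis by (simp only: summable_const_iff)
qed

lemma vector_measure_Un:
  assumes "vector_measure M \<nu>" "A \<in> sets M" "B \<in> sets M" "A \<inter> B = {}"
  shows "\<nu> (A \<union> B) = \<nu> A + \<nu> B"
proof -
  have "(\<lambda>n. \<nu> (binaryset A B n)) sums \<nu> (\<Union>n. binaryset A B n)"
    using assms by (intro vector_measureD) (auto simp: range_binaryset_eq disjoint_family_on_def binaryset_def)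
  moreover have "(\<lambda>n. \<nu> (binaryset A B n)) sums (\<nu> A + \<nu> B)"
    by (rule binaryset_sums) (rule vector_measure_empty[OF assms(1)])
  ultimately show ?thesis by (simp add: UN_binaryset_eq sums_unique2)
qed

lemma vector_measure_Union:
  assumes "vector_measure M \<nu>" "finite P" "P \<subseteq> sets M" "disjoint P"
  shows "\<nu> (\<Union>P) = (\<Sum>B\<in>P. \<nu> B)"
  using assms(2,3,4)
proof (induction P)
  case empty
  then show ?case by (simp add: vector_measure_empty[OF assms(1)])
next
  case (insert B P)
  have "B \<inter> \<Union>P = {}" using insert by (auto simp: pairwise_insert disjnt_def)
  moreover have "\<Union>P \<in> sets M" using insert by auto
  ultimately have "\<nu> (B \<union> \<Union>P) = \<nu> B + \<nu> (\<Union>P)"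
    using insert by (intro vector_measure_Un[OF assms(1)]) auto
  then show ?case using insert by (simp add: pairwise_insert)
qed

abbreviation partitions :: "'a measure \<Rightarrow> 'a set \<Rightarrow> 'a set set set" where
  "partitions M A \<equiv> {P. finite P \<and> P \<subseteq> sets M \<and> partition_on A P}"

lemma partitions_nonempty: "A \<in> sets M \<Longrightarrow> partitions M A \<noteq> {}"
proof -
  assume "A \<in> sets M"
  \<comment> \<open>\<open>partition_on\<close> admits no empty part, so the trivial partition of
    the empty set is the empty family.\<close>
  then have "(if A = {} then {} else {A}) \<in> partitions M A"
    by (auto simp: partition_on_def)
  then show ?thesis by blast
qed

lemma sum_le_variation:
  "P \<in> partitions M A \<Longrightarrow> (\<Sum>B\<in>P. ennreal \<bar>\<nu> B\<bar>) \<le> variation M \<nu> A"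
  unfolding variation_def by (rule SUP_upper)

text \<open>A partition of \<open>A\<close> and one of \<open>B\<close> together form a partition of
  the union; the two suprema are then taken one after the other.\<close>

lemma variation_superadditive:
  assumes "A \<in> sets M" "B \<in> sets M" "A \<inter> B = {}"
  shows "variation M \<nu> A + variation M \<nu> B \<le> variation M \<nu> (A \<union> B)"
proof -
  have "(\<Sum>C\<in>P. ennreal \<bar>\<nu> C\<bar>) + (\<Sum>C\<in>Q. ennreal \<bar>\<nu> C\<bar>) \<le> variation M \<nu> (A \<union> B)"
    if P: "P \<in> partitions M A" and Q: "Q \<in> partitions M B" for P Q
  proof -
    have "P \<inter> Q = {}"
    proof (rule ccontr)
      assume "P \<inter> Q \<noteq> {}"
      then obtain C where C: "C \<in> P" "C \<in> Q" by blast
      then have "C \<subseteq> A \<inter> B" "C \<noteq> {}" using P Q by (auto simp: partition_on_def)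
      then show False using assms(3) by auto
    qed
    then have "(\<Sum>C\<in>P. ennreal \<bar>\<nu> C\<bar>) + (\<Sum>C\<in>Q. ennreal \<bar>\<nu> C\<bar>) = (\<Sum>C\<in>P\<union>Q. ennreal \<bar>\<nu> C\<bar>)"
      using P Q by (intro sum.union_disjoint[symmetric]) auto
    also have "\<dots> \<le> variation M \<nu> (A \<union> B)"
    proof (rule sum_le_variation)
      have "partition_on (A \<union> B) (P \<union> Q)"
      proof (rule partition_onI)
        show "\<Union> (P \<union> Q) = A \<union> B" using P Q by (auto simp: partition_on_def)
        have PA: "C \<subseteq> A" if "C \<in> P" for C using P that by (auto simp: partition_on_def)
        have QB: "C \<subseteq> B" if "C \<in> Q" for C using Q that by (auto simp: partition_on_def)
        have dP: "disjnt C D" if "C \<in> P" "D \<in> P" "C \<noteq> D" for C D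
          using P that by (auto simp: partition_on_def pairwise_def)
        have dQ: "disjnt C D" if "C \<in> Q" "D \<in> Q" "C \<noteq> D" for C D
          using Q that by (auto simp: partition_on_def pairwise_def)
        have dPQ: "disjnt C D" if "C \<in> P" "D \<in> Q" for C D
          using PA[OF that(1)] QB[OF that(2)] assms(3) unfolding disjnt_def by blast
        show "disjnt C D" if "C \<in> P \<union> Q" "D \<in> P \<union> Q" "C \<noteq> D" for C D
          using that by (metis Un_iff dP dQ dPQ disjnt_sym)
      qed (use P Q in \<open>auto simp: partition_on_def\<close>)
      then show "P \<union> Q \<in> partitions M (A \<union> B)" using P Q by auto
    qed
    finally show ?thesis .
  qed
  then have "(\<Sum>C\<in>P. ennreal \<bar>\<nu> C\<bar>) + variation M \<nu> B \<le> variation M \<nu> (A \<union> B)"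
    if P: "P \<in> partitions M A" for P
    unfolding variation_def[of M \<nu> B]
    using P partitions_nonempty[OF assms(2)]
    by (subst ennreal_SUP_add_right) (auto intro!: SUP_least)
  then show ?thesis
    unfolding variation_def[of M \<nu> A]
    using partitions_nonempty[OF assms(1)]
    by (subst ennreal_SUP_add_left[symmetric]) (auto intro!: SUP_least)
qed

lemma variation_mono:
  assumes "A \<in> sets M" "B \<in> sets M" "A \<subseteq> B"
  shows "variation M \<nu> A \<le> variation M \<nu> B"
proof -
  have "variation M \<nu> A \<le> variation M \<nu> A + variation M \<nu> (B - A)" by simp
  also have "\<dots> \<le> variation M \<nu> (A \<union> (B - A))"
    using assms by (intro variation_superadditive) auto
  also have "A \<union> (B - A) = B" using assms by auto
  finally show ?thesis .
qed

text \<open>The traces of the parts on \<open>A\<close>, with the empty ones dropped, form a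
  partition of \<open>A\<close>. Distinct parts keep distinct traces by disjointness, and the
  dropped ones contribute 0.\<close>

lemma sum_Int_le_variation:
  assumes "vector_measure M \<nu>" "finite P" "P \<subseteq> sets M" "disjoint P" "A \<subseteq> \<Union>P" "A \<in> sets M"
  shows "(\<Sum>B\<in>P. ennreal \<bar>\<nu> (B \<inter> A)\<bar>) \<le> variation M \<nu> A"
proof -
  define P' where "P' = {B\<in>P. B \<inter> A \<noteq> {}}"
  have inj: "inj_on (\<lambda>B. B \<inter> A) P'"
  proof (rule inj_onI)
    fix B C assume BC: "B \<in> P'" "C \<in> P'" "B \<inter> A = C \<inter> A"
    then have "B \<inter> C \<noteq> {}" "B \<in> P" "C \<in> P" by (auto simp: P'_def)
    then show "B = C" using disjointD[OF assms(4)] by blast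
  qed
  have "(\<Sum>B\<in>P. ennreal \<bar>\<nu> (B \<inter> A)\<bar>) = (\<Sum>B\<in>P'. ennreal \<bar>\<nu> (B \<inter> A)\<bar>)"
    using assms(2) vector_measure_empty[OF assms(1)]
    by (intro sum.mono_neutral_right) (auto simp: P'_def)
  also have "\<dots> = (\<Sum>B\<in>(\<lambda>B. B \<inter> A) ` P'. ennreal \<bar>\<nu> B\<bar>)"
    by (simp add: sum.reindex[OF inj])
  also have "\<dots> \<le> variation M \<nu> A"
  proof (rule sum_le_variation, intro CollectI conjI)
    show "partition_on A ((\<lambda>B. B \<inter> A) ` P')"
    proof (rule partition_onI)
      show "\<Union> ((\<lambda>B. B \<inter> A) ` P') = A" using assms(5) by (auto simp: P'_def)
      fix p q assume "p \<in> (\<lambda>B. B \<inter> A) ` P'" "q \<in> (\<lambda>B. B \<inter> A) ` P'" "p \<noteq> q"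
      then obtain B C where BC: "B \<in> P" "C \<in> P" "p = B \<inter> A" "q = C \<inter> A" by (auto simp: P'_def)
      then have "B \<noteq> C" using \<open>p \<noteq> q\<close> by auto
      then have "B \<inter> C = {}" using BC disjointD[OF assms(4)] by blast
      then show "disjnt p q" unfolding BC disjnt_def by blast
    qed (auto simp: P'_def)
  qed (use assms in \<open>auto simp: P'_def\<close>)
  finally show ?thesis .
qed

lemma abs_vector_measure_le_suminf:
  assumes "vector_measure M \<nu>" "range A \<subseteq> sets M" "disjoint_family A"
  shows "ennreal \<bar>\<nu> (\<Union>n::nat. A n)\<bar> \<le> (\<Sum>n. ennreal \<bar>\<nu> (A n)\<bar>)"
proof (rule LIMSEQ_le_const2)
  have "(\<lambda>n. \<Sum>i<n. \<nu> (A i)) \<longlonglongrightarrow> \<nu> (\<Union>n. A n)"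
    using vector_measureD[OF assms] by (simp add: sums_def)
  then show "(\<lambda>n. ennreal \<bar>\<Sum>i<n. \<nu> (A i)\<bar>) \<longlonglongrightarrow> ennreal \<bar>\<nu> (\<Union>n. A n)\<bar>"
    by (intro tendsto_ennrealI tendsto_intros)
  have "ennreal \<bar>\<Sum>i<n. \<nu> (A i)\<bar> \<le> (\<Sum>n. ennreal \<bar>\<nu> (A n)\<bar>)" for n
  proof -
    have "ennreal \<bar>\<Sum>i<n. \<nu> (A i)\<bar> \<le> ennreal (\<Sum>i<n. \<bar>\<nu> (A i)\<bar>)"
      by (intro ennreal_leI sum_abs)
    also have "\<dots> = (\<Sum>i<n. ennreal \<bar>\<nu> (A i)\<bar>)" by (simp add: sum_ennreal)
    also have "\<dots> \<le> (\<Sum>n. ennreal \<bar>\<nu> (A n)\<bar>)" by (intro sum_le_suminf) auto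
    finally show ?thesis .
  qed
  then show "\<exists>N. \<forall>n\<ge>N. ennreal \<bar>\<Sum>i<n. \<nu> (A i)\<bar> \<le> (\<Sum>n. ennreal \<bar>\<nu> (A n)\<bar>)" by blast
qed

text \<open>One inequality is superadditivity on finite unions. For the other, every part
  \<open>B\<close> of a partition of the union is cut along the \<open>A i\<close>, and the finite
  sum over the parts is exchanged with the series.\<close>

lemma countably_additive_variation:
  assumes "vector_measure M \<nu>"
  shows "countably_additive (sets M) (variation M \<nu>)"
proof (rule countably_additiveI)
  fix A :: "nat \<Rightarrow> 'a set" assume A: "range A \<subseteq> sets M" "disjoint_family A" "(\<Union>i. A i) \<in> sets M"
  show "(\<Sum>i. variation M \<nu> (A i)) = variation M \<nu> (\<Union>i. A i)"
  proof (rule antisym)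
    have *: "(\<Sum>i<n. variation M \<nu> (A i)) \<le> variation M \<nu> (\<Union>i<n. A i)" for n
    proof (induction n)
      case (Suc n)
      have "(\<Sum>i<Suc n. variation M \<nu> (A i)) \<le> variation M \<nu> (\<Union>i<n. A i) + variation M \<nu> (A n)"
        using Suc by (simp add: add_right_mono)
      also have "\<dots> \<le> variation M \<nu> ((\<Union>i<n. A i) \<union> A n)"
      proof (intro variation_superadditive)
        have "A i \<inter> A n = {}" if "i < n" for i
          using A(2) that by (auto simp: disjoint_family_on_def)
        then show "(\<Union>i<n. A i) \<inter> A n = {}" by blast
      qed (use A in auto)
      also have "(\<Union>i<n. A i) \<union> A n = (\<Union>i<Suc n. A i)" by (auto simp: lessThan_Suc)
      finally show ?case .
    qed auto
    show "(\<Sum>i. variation M \<nu> (A i)) \<le> variation M \<nu> (\<Union>i. A i)"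
      unfolding suminf_eq_SUP
    proof (rule SUP_least)
      fix n
      have "variation M \<nu> (\<Union>i<n. A i) \<le> variation M \<nu> (\<Union>i. A i)"
        using A by (intro variation_mono) auto
      with * show "(\<Sum>i<n. variation M \<nu> (A i)) \<le> variation M \<nu> (\<Union>i. A i)"
        by (rule order_trans)
    qed
    show "variation M \<nu> (\<Union>i. A i) \<le> (\<Sum>i. variation M \<nu> (A i))"
      unfolding variation_def[of M \<nu> "\<Union>i. A i"]
    proof (rule SUP_least)
      fix P assume P: "P \<in> partitions M (\<Union>i. A i)"
      then have PP: "finite P" "P \<subseteq> sets M" "disjoint P" "\<Union>P = (\<Union>i. A i)"
        by (auto simp: partition_on_def)
      have "(\<Sum>B\<in>P. ennreal \<bar>\<nu> B\<bar>) \<le> (\<Sum>B\<in>P. \<Sum>i. ennreal \<bar>\<nu> (B \<inter> A i)\<bar>)"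
      proof (rule sum_mono)
        fix B assume B: "B \<in> P"
        then have *: "(\<Union>i. B \<inter> A i) = B" using PP by auto
        have "B \<in> sets M" using B PP by auto
        then have r: "range (\<lambda>i. B \<inter> A i) \<subseteq> sets M" using A by auto
        have d: "disjoint_family (\<lambda>i. B \<inter> A i)"
          by (rule disjoint_family_subset[OF A(2)]) simp
        show "ennreal \<bar>\<nu> B\<bar> \<le> (\<Sum>i. ennreal \<bar>\<nu> (B \<inter> A i)\<bar>)"
          using abs_vector_measure_le_suminf[OF assms r d] by (simp only: *)
      qed
      also have "\<dots> = (\<Sum>i. \<Sum>B\<in>P. ennreal \<bar>\<nu> (B \<inter> A i)\<bar>)"
        by (rule suminf_sum[symmetric]) simp
      also have "\<dots> \<le> (\<Sum>i. variation M \<nu> (A i))"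
        by (intro suminf_le sum_Int_le_variation[OF assms]) (use PP A in auto)
      finally show "(\<Sum>B\<in>P. ennreal \<bar>\<nu> B\<bar>) \<le> (\<Sum>i. variation M \<nu> (A i))" .
    qed
  qed
qed

definition variation_measure :: "'a measure \<Rightarrow> ('a set \<Rightarrow> real) \<Rightarrow> 'a measure" where
  "variation_measure M \<nu> = measure_of (space M) (sets M) (variation M \<nu>)"

lemma sets_variation_measure [simp]: "sets (variation_measure M \<nu>) = sets M"
  by (simp add: variation_measure_def)

lemma emeasure_variation_measure:
  assumes "vector_measure M \<nu>" "A \<in> sets M"
  shows "emeasure (variation_measure M \<nu>) A = variation M \<nu> A"
proof (rule emeasure_measure_of[OF variation_measure_def])
  show "positive (sets (variation_measure M \<nu>)) (variation M \<nu>)"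
    by (auto simp: positive_def variation_def partition_on_def intro!: antisym SUP_least sum_nonpos)
  show "countably_additive (sets (variation_measure M \<nu>)) (variation M \<nu>)"
    using countably_additive_variation[OF assms(1)] by simp
qed (use assms sets.space_closed in auto)

lemma variation_Un:
  assumes "vector_measure M \<nu>" "A \<in> sets M" "B \<in> sets M" "A \<inter> B = {}"
  shows "variation M \<nu> (A \<union> B) = variation M \<nu> A + variation M \<nu> B"
  using plus_emeasure[of A "variation_measure M \<nu>" B] assms
  by (simp add: emeasure_variation_measure)

text \<open>A partition with a large sum has a large positive or a large negative part; the part and its
  complement are then both large, and one of them has infinite variation again.\<close>

lemma infinite_variation_split:
  assumes "vector_measure M \<nu>" "E \<in> sets M" "variation M \<nu> E = \<infinity>"
  shows "\<exists>F\<in>sets M. F \<subseteq> E \<and> 1 < \<bar>\<nu> (E - F)\<bar> \<and> variation M \<nu> F = \<infinity>"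
proof -
  \<comment> \<open>With p and q the measures of the positive and the negative part, p + q =
    \<open>\<nu> E\<close> and p - q > \<open>t\<close> force p > 1 and q < -1.\<close>
  define t where "t = 2 * (1 + \<bar>\<nu> E\<bar>)"
  have "ennreal t < variation M \<nu> E" using assms by simp
  then obtain P where P: "P \<in> partitions M E" and "ennreal t < (\<Sum>B\<in>P. ennreal \<bar>\<nu> B\<bar>)"
    unfolding variation_def less_SUP_iff by blast
  then have t: "t < (\<Sum>B\<in>P. \<bar>\<nu> B\<bar>)"
    by (subst (asm) sum_ennreal) (auto simp: ennreal_less_iff t_def simp del: ennreal_plus)
  have PP: "finite P" "P \<subseteq> sets M" "disjoint P" "\<Union>P = E"
    using P by (auto simp: partition_on_def)
  define Q where "Q = {B\<in>P. \<nu> B \<ge> 0}"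
  have "(\<Sum>B\<in>P. \<bar>\<nu> B\<bar>) = (\<Sum>B\<in>Q. \<bar>\<nu> B\<bar>) + (\<Sum>B\<in>P - Q. \<bar>\<nu> B\<bar>)"
    using PP by (subst sum.subset_diff[of Q P]) (auto simp: Q_def)
  also have "(\<Sum>B\<in>Q. \<bar>\<nu> B\<bar>) = (\<Sum>B\<in>Q. \<nu> B)" by (rule sum.cong) (auto simp: Q_def)
  also have "\<dots> = \<nu> (\<Union>Q)"
    by (rule vector_measure_Union[OF assms(1), symmetric]) (use PP in \<open>auto simp: Q_def pairwise_def\<close>)
  also have "(\<Sum>B\<in>P - Q. \<bar>\<nu> B\<bar>) = - (\<Sum>B\<in>P - Q. \<nu> B)"
    unfolding sum_negf[symmetric] by (rule sum.cong) (auto simp: Q_def)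
  also have "(\<Sum>B\<in>P - Q. \<nu> B) = \<nu> (\<Union>(P - Q))"
    by (rule vector_measure_Union[OF assms(1), symmetric]) (use PP in \<open>auto simp: Q_def pairwise_def\<close>)
  finally have s: "t < \<nu> (\<Union>Q) - \<nu> (\<Union>(P - Q))" using t by simp
  have m: "\<Union>Q \<in> sets M" "\<Union>(P - Q) \<in> sets M" using PP by (auto simp: Q_def)
  have d: "\<Union>Q \<inter> \<Union>(P - Q) = {}"
  proof -
    have "B \<inter> C = {}" if "B \<in> Q" "C \<in> P - Q" for B C
    proof -
      have "B \<in> P" "C \<in> P" "B \<noteq> C" using that by (auto simp: Q_def)
      then show ?thesis by (rule disjointD[OF PP(3)])
    qed
    then show ?thesis by blast
  qed
  have "Q \<subseteq> P" by (auto simp: Q_def)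
  then have u: "\<Union>Q \<union> \<Union>(P - Q) = E" using PP(4) by blast
  have "\<nu> E = \<nu> (\<Union>Q) + \<nu> (\<Union>(P - Q))"
    using vector_measure_Un[OF assms(1) m d] u by simp
  then have "1 < \<nu> (\<Union>Q)" "\<nu> (\<Union>(P - Q)) < - 1"
    using s abs_ge_self[of "\<nu> E"] abs_ge_minus_self[of "\<nu> E"] unfolding t_def by argo+
  then have large: "1 < \<bar>\<nu> (\<Union>Q)\<bar>" "1 < \<bar>\<nu> (\<Union>(P - Q))\<bar>" by linarith+
  have e: "E - \<Union>Q = \<Union>(P - Q)" "E - \<Union>(P - Q) = \<Union>Q" "\<Union>Q \<subseteq> E" "\<Union>(P - Q) \<subseteq> E"
  proof -
    have "E - X = Y \<and> E - Y = X \<and> X \<subseteq> E \<and> Y \<subseteq> E" if "X \<inter> Y = {}" "X \<union> Y = E" for X Y :: "'a set"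
      using that by blast
    from this[OF d u] show "E - \<Union>Q = \<Union>(P - Q)" "E - \<Union>(P - Q) = \<Union>Q" "\<Union>Q \<subseteq> E" "\<Union>(P - Q) \<subseteq> E"
      by simp_all
  qed
  have "variation M \<nu> (\<Union>Q) = \<infinity> \<or> variation M \<nu> (\<Union>(P - Q)) = \<infinity>"
    using variation_Un[OF assms(1) m d] assms(3) unfolding u by (metis ennreal_add_eq_top infinity_ennreal_def)
  then show ?thesis
  proof
    assume "variation M \<nu> (\<Union>Q) = \<infinity>"
    then show ?thesis using m(1) large(2) e(1,3) by (intro bexI[of _ "\<Union>Q"]) simp_all
  next
    assume "variation M \<nu> (\<Union>(P - Q)) = \<infinity>"
    then show ?thesis using m(2) large(1) e(2,4) by (intro bexI[of _ "\<Union>(P - Q)"]) simp_all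
  qed
qed

text \<open>Were the variation infinite, repeated splitting would yield decreasing sets whose
  successive differences are disjoint and have measure above 1 in modulus, contradicting the
  convergence of the series. This is what makes a Rybakov control measure finite.\<close>

lemma variation_finite:
  assumes "vector_measure M \<nu>" "E \<in> sets M"
  shows "variation M \<nu> E < \<infinity>"
proof (rule ccontr)
  assume "\<not> variation M \<nu> E < \<infinity>"
  then have E: "variation M \<nu> E = \<infinity>" by (metis less_top infinity_ennreal_def)
  have "\<exists>f. \<forall>n::nat. (f n \<in> sets M \<and> variation M \<nu> (f n) = \<infinity>) \<and>
      (f (Suc n) \<subseteq> f n \<and> 1 < \<bar>\<nu> (f n - f (Suc n))\<bar>)"
  proof (rule dependent_nat_choice)
    show "\<exists>x. x \<in> sets M \<and> variation M \<nu> x = \<infinity>" using E assms by blast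
    show "\<exists>y. (y \<in> sets M \<and> variation M \<nu> y = \<infinity>) \<and> y \<subseteq> x \<and> 1 < \<bar>\<nu> (x - y)\<bar>"
      if "x \<in> sets M \<and> variation M \<nu> x = \<infinity>" for x and n :: nat
      using infinite_variation_split[OF assms(1), of x] that by blast
  qed
  then obtain f :: "nat \<Rightarrow> 'a set" where f: "\<And>n. f n \<in> sets M" "\<And>n. f (Suc n) \<subseteq> f n"
     "\<And>n. 1 < \<bar>\<nu> (f n - f (Suc n))\<bar>" by blast
  have dec: "f j \<subseteq> f i" if "i \<le> j" for i j
    using lift_Suc_antimono_le[of f] f(2) that by blast
  have dis: "(f i - f (Suc i)) \<inter> (f j - f (Suc j)) = {}" if "i < j" for i j
    using dec[of "Suc i" j] that by auto
  have "(\<lambda>n. \<nu> (f n - f (Suc n))) sums \<nu> (\<Union>n. f n - f (Suc n))"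
  proof (intro vector_measureD[OF assms(1)])
    show "disjoint_family (\<lambda>n. f n - f (Suc n))"
      unfolding disjoint_family_on_def
    proof (intro ballI impI)
      fix i j :: nat assume "i \<noteq> j"
      then show "(f i - f (Suc i)) \<inter> (f j - f (Suc j)) = {}"
        using dis[of i j] dis[of j i] by (cases "i < j") (auto simp: Int_commute)
    qed
    show "range (\<lambda>n. f n - f (Suc n)) \<subseteq> sets M" using f(1) by auto
  qed
  then have "(\<lambda>n. \<nu> (f n - f (Suc n))) \<longlonglongrightarrow> 0"
    using summable_LIMSEQ_zero sums_summable by blast
  then have "\<forall>\<^sub>F n in sequentially. \<bar>\<nu> (f n - f (Suc n))\<bar> < 1"
    unfolding tendsto_iff dist_real_def by simp
  then obtain n where "\<bar>\<nu> (f n - f (Suc n))\<bar> < 1"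
    using eventually_happens'[OF sequentially_bot] by blast
  then show False using f(3)[of n] by linarith
qed

section \<open>The Choquet functional of the semivariation\<close>

text \<open>The superlevel sets are closed downwards, hence empty, half-lines or the whole line. It
  is applied to t \<mapsto> \<sigma> {u > t}, which Fubini arguments cannot reach because \<sigma>
  is not a measure in general.\<close>

lemma borel_measurable_antimono_ennreal:
  fixes g :: "real \<Rightarrow> ennreal"
  assumes "antimono g"
  shows "g \<in> borel_measurable borel"
proof (rule borel_measurableI_greater)
  fix c
  let ?S = "{t. c < g t}"
  have down: "s \<in> ?S" if "t \<in> ?S" "s \<le> t" for s t
    using that antimonoD[OF assms, of s t] by auto
  have "?S \<in> sets borel"
  proof (cases "bdd_above ?S \<and> ?S \<noteq> {}")
    case True
    then have "{..<Sup ?S} \<subseteq> ?S" using less_cSup_iff[of ?S] down by (auto intro: less_imp_le)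
    moreover have "?S \<subseteq> {..Sup ?S}" using True by (auto intro: cSup_upper)
    moreover have "T = {..<a} \<or> T = {..a}" if "{..<a} \<subseteq> T" "T \<subseteq> {..a}" for T and a :: real
    proof (cases "a \<in> T")
      case True
      then have "{..a} \<subseteq> T" using that(1) by (auto simp: le_less)
      then show ?thesis using that(2) by blast
    next
      case False
      then have "T \<subseteq> {..<a}" using that(2) by (auto simp: less_le)
      then show ?thesis using that(1) by blast
    qed
    ultimately have "?S = {..<Sup ?S} \<or> ?S = {..Sup ?S}" by metis
    moreover have "{..<Sup ?S} \<in> sets borel" "{..Sup ?S} \<in> sets borel" by auto
    ultimately show ?thesis by metis
  next
    case False
    have "?S = UNIV" if "\<not> bdd_above ?S"
    proof -
      have "s \<in> ?S" for s
      proof -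
        obtain t where "t \<in> ?S" "s \<le> t" using \<open>\<not> bdd_above ?S\<close> unfolding bdd_above_def by (metis linear)
        then show ?thesis by (rule down)
      qed
      then show ?thesis by blast
    qed
    then have "?S = {} \<or> ?S = UNIV" using False by metis
    then show ?thesis by (metis sets.empty_sets sets.top space_borel)
  qed
  then show "{t \<in> space borel. c < g t} \<in> sets borel" by simp
qed

text \<open>Take the least \<open>k\<close> with \<open>x \<le> 4 ^ k * t\<close>. Since
  \<open>t < x\<close>, \<open>k\<close> is a successor \<open>Suc j\<close>, and the single term
  \<open>j\<close> of the series already dominates:
  \<open>sqrt x \<le> sqrt t * 2 ^ Suc j\<close>.\<close>

lemma sqrt_le_dyadic_sum:
  fixes t x :: real
  assumes "0 < t" "t < x"
  shows "ennreal (sqrt x) \<le> ennreal (sqrt t) * (\<Sum>i. ennreal (2 ^ Suc i) * indicator {i. 4 ^ i * t < x} i)"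
proof -
  have "\<exists>i. x \<le> 4 ^ i * t"
  proof -
    obtain i :: nat where "x / t < 4 ^ i" using real_arch_pow[of 4 "x / t"] by auto
    then show ?thesis using assms by (intro exI[of _ i]) (simp add: field_simps)
  qed
  define k where "k = (LEAST i. x \<le> 4 ^ i * t)"
  have k: "x \<le> 4 ^ k * t" unfolding k_def by (rule LeastI_ex) fact
  have "k \<noteq> 0" using k assms by (intro notI) simp
  then obtain j where j: "k = Suc j" by (cases k) auto
  have "\<not> x \<le> 4 ^ j * t" using not_less_Least[of j "\<lambda>i. x \<le> 4 ^ i * t"] j unfolding k_def[symmetric] by simp
  then have jt: "4 ^ j * t < x" by simp
  have s4: "sqrt (4 ^ k) = 2 ^ k"
    using real_sqrt_power[of 4 k] by simp
  have "sqrt x \<le> sqrt (4 ^ k * t)" using k by simp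
  also have "\<dots> = sqrt t * 2 ^ k" by (simp add: real_sqrt_mult s4)
  finally have "sqrt x \<le> sqrt t * 2 ^ Suc j" unfolding j .
  then have "ennreal (sqrt x) \<le> ennreal (sqrt t * 2 ^ Suc j)" by (rule ennreal_leI)
  also have "\<dots> = ennreal (sqrt t) * (ennreal (2 ^ Suc j) * indicator {i. 4 ^ i * t < x} j)"
    using jt assms by (simp add: ennreal_mult)
  also have "\<dots> \<le> ennreal (sqrt t) * (\<Sum>i. ennreal (2 ^ Suc i) * indicator {i. 4 ^ i * t < x} i)"
  proof (intro mult_left_mono)
    have "f j \<le> (\<Sum>i. f i)" for f :: "nat \<Rightarrow> ennreal"
      using sum_le_suminf[of f "{j}"] by simp
    then show "ennreal (2 ^ Suc j) * indicator {i. 4 ^ i * t < x} j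
      \<le> (\<Sum>i. ennreal (2 ^ Suc i) * indicator {i. 4 ^ i * t < x} i)" .
  qed auto
  finally show ?thesis .
qed

text \<open>The weights come from \<open>sqrt_le_dyadic_sum\<close>, the factors
  \<open>1 / 4 ^ i\<close> from the dilation of the level sets; the value is the constant of
  \<open>choquet_average\<close>.\<close>

lemma suminf_dyadic: "(\<Sum>i. ennreal (2 ^ Suc i) * ennreal (1 / 4 ^ i)) = 4"
proof -
  have "(\<lambda>i. 2 * (1/2) ^ i :: real) sums (2 * (1 / (1 - 1/2)))"
    by (intro sums_mult geometric_sums) auto
  moreover have "2 * (1/2) ^ i = 2 ^ Suc i * (1 / 4 ^ i :: real)" for i
  proof -
    have "(4::real) ^ i = 2 ^ i * 2 ^ i" by (simp flip: power_mult_distrib)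
    then show ?thesis by (simp add: field_simps)
  qed
  ultimately have "(\<lambda>i. 2 ^ Suc i * (1 / 4 ^ i) :: real) sums 4" by simp
  then have "(\<Sum>i. ennreal (2 ^ Suc i * (1 / 4 ^ i))) = ennreal 4"
    by (intro suminf_ennreal_eq) auto
  moreover have "ennreal (2 ^ Suc i * (1 / 4 ^ i)) = ennreal (2 ^ Suc i) * ennreal (1 / 4 ^ i)" for i
    by (rule ennreal_mult) auto
  ultimately show ?thesis by simp
qed

text \<open>\<open>V\<close> is an abstract family of measures whose supremum on measurable sets is
  the semivariation; in the application it consists of the variations of the scalar measures.
  Arguments that are linear in a measure are run on each member of \<open>V\<close>. Membership of
  \<open>\<mu>\<close> gives the embedding into the integrable functions, and the last assumption
  transfers null sets and convergence in measure from \<open>\<mu>\<close> to the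
  semivariation.\<close>

locale semivariation_space = finite_measure \<mu>
  for \<mu> :: "'w measure" +
  fixes m :: "'w set \<Rightarrow> 'y::real_normed_vector" and V :: "'w measure set"
  assumes sets_V: "\<And>\<nu>. \<nu> \<in> V \<Longrightarrow> sets \<nu> = sets \<mu>"
    and mu_in_V: "\<mu> \<in> V"
    and semivariation_eq: "\<And>A. A \<in> sets \<mu> \<Longrightarrow> semivariation \<mu> m A = (SUP \<nu>\<in>V. emeasure \<nu> A)"
    and semivariation_tendsto_0: "\<And>A :: nat \<Rightarrow> 'w set. range A \<subseteq> sets \<mu> \<Longrightarrow>
      (\<lambda>n. emeasure \<mu> (A n)) \<longlonglongrightarrow> 0 \<Longrightarrow> (\<lambda>n. semivariation \<mu> m (A n)) \<longlonglongrightarrow> 0"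
begin

abbreviation "\<sigma> \<equiv> semivariation \<mu> m"

lemma space_V: "\<nu> \<in> V \<Longrightarrow> space \<nu> = space \<mu>"
  using sets_V sets_eq_imp_space_eq by blast

lemma emeasure_le_semivariation: "\<nu> \<in> V \<Longrightarrow> A \<in> sets \<mu> \<Longrightarrow> emeasure \<nu> A \<le> \<sigma> A"
  using SUP_upper[of \<nu> V "\<lambda>\<nu>. emeasure \<nu> A"] by (simp add: semivariation_eq)

lemma semivariation_leI:
  "A \<in> sets \<mu> \<Longrightarrow> (\<And>\<nu>. \<nu> \<in> V \<Longrightarrow> emeasure \<nu> A \<le> c) \<Longrightarrow> \<sigma> A \<le> c"
  by (simp add: semivariation_eq SUP_least)

lemma AE_V:
  assumes "AE x in \<mu>. P x" "\<nu> \<in> V"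
  shows "AE x in \<nu>. P x"
proof -
  obtain N where N: "{x\<in>space \<mu>. \<not> P x} \<subseteq> N" "N \<in> sets \<mu>" "emeasure \<mu> N = 0"
    using assms(1) by (auto elim: AE_E)
  \<comment> \<open>A constant sequence turns the sequential control into the fact that
    \<open>\<mu>\<close>-null sets have semivariation 0.\<close>
  have "(\<lambda>n::nat. \<sigma> N) \<longlonglongrightarrow> 0"
    using N by (intro semivariation_tendsto_0[of "\<lambda>_. N"]) auto
  then have "\<sigma> N = 0" by (simp add: LIMSEQ_const_iff)
  then have "emeasure \<nu> N = 0" using emeasure_le_semivariation[OF assms(2) N(2)] by simp
  then show ?thesis
    using N assms(2) sets_V space_V by (intro AE_I[of _ _ N]) auto
qed

lemma semivariation_mono_AE:
  assumes "AE x in \<mu>. x \<in> A \<longrightarrow> x \<in> B" "A \<in> sets \<mu>" "B \<in> sets \<mu>"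
  shows "\<sigma> A \<le> \<sigma> B"
proof (rule semivariation_leI[OF assms(2)])
  fix \<nu> assume \<nu>: "\<nu> \<in> V"
  have "emeasure \<nu> A \<le> emeasure \<nu> B"
    using AE_V[OF assms(1) \<nu>] assms(3) sets_V[OF \<nu>] by (intro emeasure_mono_AE) auto
  also have "\<dots> \<le> \<sigma> B" by (rule emeasure_le_semivariation[OF \<nu> assms(3)])
  finally show "emeasure \<nu> A \<le> \<sigma> B" .
qed

lemma semivariation_Un:
  assumes "A \<in> sets \<mu>" "B \<in> sets \<mu>"
  shows "\<sigma> (A \<union> B) \<le> \<sigma> A + \<sigma> B"
proof (rule semivariation_leI)
  fix \<nu> assume \<nu>: "\<nu> \<in> V"
  have "emeasure \<nu> (A \<union> B) \<le> emeasure \<nu> A + emeasure \<nu> B"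
    using assms sets_V[OF \<nu>] by (intro emeasure_subadditive) auto
  also have "\<dots> \<le> \<sigma> A + \<sigma> B"
    using emeasure_le_semivariation[OF \<nu>] assms by (intro add_mono) auto
  finally show "emeasure \<nu> (A \<union> B) \<le> \<sigma> A + \<sigma> B" .
qed (use assms in auto)

text \<open>Fatou's lemma for the indicator functions under each measure of \<open>V\<close>. It
  survives the supremum, although additivity does not.\<close>

lemma semivariation_le_liminf:
  assumes "AE x in \<mu>. x \<in> A \<longrightarrow> (\<forall>\<^sub>F n in sequentially. x \<in> B n)" "A \<in> sets \<mu>" "\<And>n. B n \<in> sets \<mu>"
  shows "\<sigma> A \<le> liminf (\<lambda>n. \<sigma> (B n))"
proof (rule semivariation_leI[OF assms(2)])
  fix \<nu> assume \<nu>: "\<nu> \<in> V"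
  have s: "A \<in> sets \<nu>" "\<And>n. B n \<in> sets \<nu>" using assms sets_V[OF \<nu>] by auto
  have "emeasure \<nu> A = (\<integral>\<^sup>+x. indicator A x \<partial>\<nu>)" using s by simp
  also have "\<dots> \<le> (\<integral>\<^sup>+x. liminf (\<lambda>n. indicator (B n) x) \<partial>\<nu>)"
  proof (rule nn_integral_mono_AE)
    show "AE x in \<nu>. indicator A x \<le> liminf (\<lambda>n. indicator (B n) x :: ennreal)"
      using AE_V[OF assms(1) \<nu>]
    proof eventually_elim
      case (elim x)
      show ?case
      proof (cases "x \<in> A")
        case True
        with elim have "\<forall>\<^sub>F n in sequentially. (1::ennreal) \<le> indicator (B n) x"
          by (auto elim!: eventually_mono)
        then show ?thesis using True by (auto intro: Liminf_bounded)
      qed auto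
    qed
  qed
  also have "\<dots> \<le> liminf (\<lambda>n. \<integral>\<^sup>+x. indicator (B n) x \<partial>\<nu>)"
    using s by (intro nn_integral_liminf) auto
  also have "\<dots> \<le> liminf (\<lambda>n. \<sigma> (B n))"
    using s emeasure_le_semivariation[OF \<nu>] assms(3)
    by (intro Liminf_mono always_eventually) auto
  finally show "emeasure \<nu> A \<le> liminf (\<lambda>n. \<sigma> (B n))" .
qed

text \<open>The layer-cake integral of the positive part of \<open>u\<close> against the set
  function \<sigma>. It is monotone and positively homogeneous, but in general not subadditive,
  since \<sigma> is only a supremum of measures.\<close>

definition choquet :: "('w \<Rightarrow> real) \<Rightarrow> ennreal" where
  "choquet u = (\<integral>\<^sup>+t\<in>{0..}. \<sigma> {w \<in> space \<mu>. u w > t} \<partial>lborel)"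

lemma antimono_level:
  fixes u :: "'w \<Rightarrow> real"
  assumes [measurable]: "u \<in> borel_measurable \<mu>"
  shows "antimono (\<lambda>t. \<sigma> {w \<in> space \<mu>. u w > t})"
  by (intro antimonoI semivariation_mono_AE) auto

lemma measurable_level [measurable]:
  fixes u :: "'w \<Rightarrow> real"
  assumes "u \<in> borel_measurable \<mu>"
  shows "(\<lambda>t. \<sigma> {w \<in> space \<mu>. u w > t}) \<in> borel_measurable borel"
  by (rule borel_measurable_antimono_ennreal[OF antimono_level[OF assms]])

lemma choquet_mono_AE:
  assumes "AE w in \<mu>. u w \<le> v w" and [measurable]: "u \<in> borel_measurable \<mu>" "v \<in> borel_measurable \<mu>"
  shows "choquet u \<le> choquet v"
  unfolding choquet_def
proof (intro nn_integral_mono mult_right_mono)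
  fix t
  show "\<sigma> {w \<in> space \<mu>. u w > t} \<le> \<sigma> {w \<in> space \<mu>. v w > t}"
  proof (rule semivariation_mono_AE)
    show "AE w in \<mu>. w \<in> {w \<in> space \<mu>. u w > t} \<longrightarrow> w \<in> {w \<in> space \<mu>. v w > t}"
      using assms(1) by eventually_elim auto
  qed auto
qed auto

lemma choquet_cmult:
  assumes [measurable]: "u \<in> borel_measurable \<mu>" and c: "0 < c"
  shows "choquet (\<lambda>w. c * u w) = ennreal c * choquet u"
proof -
  have "choquet (\<lambda>w. c * u w) = (\<integral>\<^sup>+t. \<sigma> {w \<in> space \<mu>. c * u w > t} * indicator {0..} t \<partial>lborel)"
    by (simp add: choquet_def)
  also have "\<dots> = ennreal \<bar>c\<bar> * (\<integral>\<^sup>+t. \<sigma> {w \<in> space \<mu>. c * u w > 0 + c * t} * indicator {0..} (0 + c * t) \<partial>lborel)"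
    using c by (intro nn_integral_real_affine) auto
  also have "(\<integral>\<^sup>+t. \<sigma> {w \<in> space \<mu>. c * u w > 0 + c * t} * indicator {0..} (0 + c * t) \<partial>lborel) = choquet u"
    unfolding choquet_def using c
    by (intro nn_integral_cong) (auto simp: indicator_def zero_le_mult_iff)
  finally show ?thesis using c by simp
qed

text \<open>Level sets of a maximum are unions of level sets, so subadditivity of \<sigma> suffices.
  This substitutes for the triangle inequality.\<close>

lemma choquet_max:
  assumes [measurable]: "u \<in> borel_measurable \<mu>" "v \<in> borel_measurable \<mu>"
  shows "choquet (\<lambda>w. max (u w) (v w)) \<le> choquet u + choquet v"
proof -
  have "choquet (\<lambda>w. max (u w) (v w)) \<le>
    (\<integral>\<^sup>+t. \<sigma> {w \<in> space \<mu>. u w > t} * indicator {0..} t + \<sigma> {w \<in> space \<mu>. v w > t} * indicator {0..} t \<partial>lborel)"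
    unfolding choquet_def distrib_right[symmetric]
  proof (intro nn_integral_mono mult_right_mono)
    fix t
    have "{w \<in> space \<mu>. max (u w) (v w) > t} = {w \<in> space \<mu>. u w > t} \<union> {w \<in> space \<mu>. v w > t}"
      by auto
    then show "\<sigma> {w \<in> space \<mu>. max (u w) (v w) > t} \<le> \<sigma> {w \<in> space \<mu>. u w > t} + \<sigma> {w \<in> space \<mu>. v w > t}"
      using semivariation_Un[of "{w \<in> space \<mu>. u w > t}" "{w \<in> space \<mu>. v w > t}"] by simp
  qed auto
  also have "\<dots> = choquet u + choquet v"
    unfolding choquet_def by (intro nn_integral_add) auto
  finally show ?thesis .
qed

text \<open>The hypothesis expresses that \<open>u w\<close> is at most the limit inferior of
  \<open>v n w\<close>, in a form that needs no limit inferior of a possibly unbounded real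
  sequence: if \<open>u w > t\<close>, then eventually \<open>v n w > t\<close>.\<close>

lemma choquet_le_liminf:
  assumes "AE w in \<mu>. \<forall>t. (\<exists>\<^sub>F n in sequentially. v n w \<le> t) \<longrightarrow> u w \<le> t"
    and [measurable]: "u \<in> borel_measurable \<mu>" "\<And>n. v n \<in> borel_measurable \<mu>"
  shows "choquet u \<le> liminf (\<lambda>n. choquet (v n))"
proof -
  have "choquet u \<le> (\<integral>\<^sup>+t. liminf (\<lambda>n. \<sigma> {w \<in> space \<mu>. v n w > t} * indicator {0..} t) \<partial>lborel)"
    unfolding choquet_def
  proof (intro nn_integral_mono)
    fix t
    have "\<sigma> {w \<in> space \<mu>. u w > t} \<le> liminf (\<lambda>n. \<sigma> {w \<in> space \<mu>. v n w > t})"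
    proof (rule semivariation_le_liminf)
      show "AE w in \<mu>. w \<in> {w \<in> space \<mu>. u w > t} \<longrightarrow>
          (\<forall>\<^sub>F n in sequentially. w \<in> {w \<in> space \<mu>. v n w > t})"
        using assms(1)
      proof eventually_elim
        case (elim w)
        then show ?case by (auto simp: frequently_def not_le dest: spec[of _ t])
      qed
    qed auto
    then show "\<sigma> {w \<in> space \<mu>. u w > t} * indicator {0..} t
       \<le> liminf (\<lambda>n. \<sigma> {w \<in> space \<mu>. v n w > t} * indicator {0..} t)"
      by (cases "t \<ge> 0") auto
  qed
  also have "\<dots> \<le> liminf (\<lambda>n. choquet (v n))"
    unfolding choquet_def by (intro nn_integral_liminf) auto
  finally show ?thesis .
qed

text \<open>Two dominated convergences. At each level t > 0 the first gives convergence to 0 in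
  \<open>\<mu>\<close>-measure, which the control assumption upgrades to the semivariation; the
  second is in t, with the level function of \<open>u\<close> as majorant.\<close>

lemma choquet_dominated:
  assumes [measurable]: "\<And>n. v n \<in> borel_measurable \<mu>" "u \<in> borel_measurable \<mu>"
    and "\<And>n. AE w in \<mu>. v n w \<le> u w" and fin: "choquet u < \<infinity>"
    and lim: "AE w in \<mu>. (\<lambda>n. v n w) \<longlonglongrightarrow> 0"
  shows "(\<lambda>n. choquet (v n)) \<longlonglongrightarrow> 0"
proof -
  have L: "(\<lambda>n. \<sigma> {w \<in> space \<mu>. v n w > t}) \<longlonglongrightarrow> 0" if t: "0 < t" for t
  proof (rule semivariation_tendsto_0)
    have "(\<lambda>n. \<integral>\<^sup>+w. indicator {w \<in> space \<mu>. v n w > t} w \<partial>\<mu>) \<longlonglongrightarrow> (\<integral>\<^sup>+w. 0 \<partial>\<mu>)"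
    proof (rule nn_integral_dominated_convergence[where w = "\<lambda>_. 1"])
      show "AE w in \<mu>. (\<lambda>n. indicator {w \<in> space \<mu>. v n w > t} w) \<longlonglongrightarrow> (0::ennreal)"
        using lim
      proof eventually_elim
        case (elim w)
        then have "\<forall>\<^sub>F n in sequentially. v n w < t" using t by (simp add: order_tendsto_iff)
        then have "\<forall>\<^sub>F n in sequentially. indicator {w \<in> space \<mu>. v n w > t} w = (0::ennreal)"
          by eventually_elim auto
        then show ?case by (rule tendsto_eventually)
      qed
    qed (auto simp: indicator_def emeasure_finite less_top[symmetric])
    then show "(\<lambda>n. emeasure \<mu> {w \<in> space \<mu>. v n w > t}) \<longlonglongrightarrow> 0" by simp
  qed auto
  have "(\<lambda>n. choquet (v n)) \<longlonglongrightarrow> (\<integral>\<^sup>+t. 0 \<partial>(lborel :: real measure))"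
    unfolding choquet_def
  proof (rule nn_integral_dominated_convergence[where w = "\<lambda>t. \<sigma> {w \<in> space \<mu>. u w > t} * indicator {0..} t"])
    show "AE t in lborel. \<sigma> {w \<in> space \<mu>. v n w > t} * indicator {0..} t
        \<le> \<sigma> {w \<in> space \<mu>. u w > t} * indicator {0..} t" for n
    proof (rule AE_I2)
      fix t
      have "AE w in \<mu>. w \<in> {w \<in> space \<mu>. v n w > t} \<longrightarrow> w \<in> {w \<in> space \<mu>. u w > t}"
        using assms(3)[of n] by eventually_elim auto
      then show "\<sigma> {w \<in> space \<mu>. v n w > t} * indicator {0..} t
        \<le> \<sigma> {w \<in> space \<mu>. u w > t} * indicator {0..} t"
        by (intro mult_right_mono semivariation_mono_AE) auto
    qed
    show "AE t in lborel. (\<lambda>n. \<sigma> {w \<in> space \<mu>. v n w > t} * indicator {0..} t) \<longlonglongrightarrow> 0"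
      using AE_lborel_singleton[of 0]
    proof eventually_elim
      case (elim t)
      show ?case
      proof (cases "t > 0")
        case True
        then show ?thesis using L[OF True] by simp
      qed (use elim in auto)
    qed
  qed (use fin in \<open>auto simp: choquet_def\<close>)
  then show ?thesis by simp
qed

text \<open>The layer-cake formula for \<open>\<mu>\<close>, followed by
  \<open>\<mu> \<in> V\<close>. It places every Orlicz space below inside the integrable
  functions.\<close>

lemma nn_integral_le_choquet:
  assumes [measurable]: "u \<in> borel_measurable \<mu>"
  shows "(\<integral>\<^sup>+w. ennreal (u w) \<partial>\<mu>) \<le> choquet u"
proof -
  interpret P: pair_sigma_finite \<mu> "lborel :: real measure" ..
  have "ennreal (u w) \<le> (\<integral>\<^sup>+t. indicator {t. 0 \<le> t \<and> t < u w} t \<partial>lborel)" for w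
  proof (cases "0 \<le> u w")
    case True
    have "{t. 0 \<le> t \<and> t < u w} = {0..<u w}" by auto
    then show ?thesis using True by simp
  qed (auto simp: ennreal_neg)
  then have "(\<integral>\<^sup>+w. ennreal (u w) \<partial>\<mu>) \<le> (\<integral>\<^sup>+w. (\<integral>\<^sup>+t. indicator {t. 0 \<le> t \<and> t < u w} t \<partial>lborel) \<partial>\<mu>)"
    by (intro nn_integral_mono)
  also have "\<dots> = (\<integral>\<^sup>+t. (\<integral>\<^sup>+w. indicator {t. 0 \<le> t \<and> t < u w} t \<partial>\<mu>) \<partial>lborel)"
    by (intro P.Fubini'[symmetric]) (simp add: indicator_def, measurable)
  also have "\<dots> \<le> choquet u"
    unfolding choquet_def
  proof (rule nn_integral_mono)
    fix t
    have "(\<integral>\<^sup>+w. indicator {t. 0 \<le> t \<and> t < u w} t \<partial>\<mu>)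
       = (\<integral>\<^sup>+w. indicator {0..} t * indicator {w\<in>space \<mu>. u w > t} w \<partial>\<mu>)"
      by (intro nn_integral_cong) (auto simp: indicator_def)
    also have "\<dots> = indicator {0..} t * emeasure \<mu> {w\<in>space \<mu>. u w > t}"
      by (subst nn_integral_cmult_indicator) auto
    also have "\<dots> \<le> \<sigma> {w \<in> space \<mu>. u w > t} * indicator {0..} t"
      using emeasure_le_semivariation[OF mu_in_V, of "{w\<in>space \<mu>. u w > t}"]
      by (simp add: mult.commute mult_left_mono)
    finally show "(\<integral>\<^sup>+w. indicator {t. 0 \<le> t \<and> t < u w} t \<partial>\<mu>) \<le> \<dots>" .
  qed
  finally show ?thesis .
qed

text \<open>Lattice convexity with exponent \<open>1/2\<close>.  The hypothesis holds for \<open>u\<close> a (suitably normalised) square of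
  the average of the square roots of the \<open>v k\<close>; the dyadic decomposition of the right-hand
  side turns it into a distributional estimate that is linear in each measure of the family \<open>V\<close>.\<close>

lemma choquet_average:
  assumes n: "0 < n" and [measurable]: "u \<in> borel_measurable \<mu>" "\<And>k. v k \<in> borel_measurable \<mu>"
    and avg: "\<And>w t. 0 < t \<Longrightarrow> t < u w \<Longrightarrow>
      sqrt t \<le> (\<Sum>k<n. if t < v k w then sqrt (v k w) else 0) / real n"
    and one: "\<And>k. k < n \<Longrightarrow> choquet (v k) \<le> 1"
  shows "choquet u \<le> 4"
proof -
  let ?L = "\<lambda>k t. {w \<in> space \<mu>. v k w > t}"
  have level: "\<sigma> {w \<in> space \<mu>. u w > t} \<le>
      ennreal (1 / n) * (\<Sum>k<n. \<Sum>i. ennreal (2 ^ Suc i) * \<sigma> (?L k (4 ^ i * t)))" if t: "0 < t" for t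
  proof (rule semivariation_leI)
    fix \<nu> assume \<nu>: "\<nu> \<in> V"
    note [measurable_cong] = sets_V[OF \<nu>]
    \<comment> \<open>Where \<open>u > t\<close>, the averaged square roots divided by
      \<open>sqrt t\<close> are at least 1, so their dyadic majorant dominates the indicator of the
      level set.\<close>
    have pw: "indicator {w \<in> space \<mu>. u w > t} w \<le>
        ennreal (1 / n) * (\<Sum>k<n. \<Sum>i. ennreal (2 ^ Suc i) * indicator (?L k (4 ^ i * t)) w)" if w: "w \<in> space \<mu>" for w
    proof (cases "u w > t")
      case True
      have "ennreal (sqrt t) \<le> ennreal ((\<Sum>k<n. if t < v k w then sqrt (v k w) else 0) / real n)"
        by (rule ennreal_leI[OF avg[OF t True]])
      also have "\<dots> = ennreal (1 / n) * (\<Sum>k<n. ennreal (if t < v k w then sqrt (v k w) else 0))"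
        using t by (subst sum_ennreal) (auto simp: ennreal_mult[symmetric] sum_nonneg)
      also have "\<dots> \<le> ennreal (1 / n) * (\<Sum>k<n. ennreal (sqrt t) *
          (\<Sum>i. ennreal (2 ^ Suc i) * indicator (?L k (4 ^ i * t)) w))"
      proof (intro mult_left_mono sum_mono)
        fix k
        have "indicator {i. 4 ^ i * t < v k w} i = (indicator (?L k (4 ^ i * t)) w :: ennreal)" for i :: nat
          using w by (simp add: indicator_def)
        then show "ennreal (if t < v k w then sqrt (v k w) else 0)
          \<le> ennreal (sqrt t) * (\<Sum>i. ennreal (2 ^ Suc i) * indicator (?L k (4 ^ i * t)) w)"
          using sqrt_le_dyadic_sum[OF t, of "v k w"] by simp
      qed auto
      also have "\<dots> = ennreal (sqrt t) * (ennreal (1 / n) * (\<Sum>k<n.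
          (\<Sum>i. ennreal (2 ^ Suc i) * indicator (?L k (4 ^ i * t)) w)))"
        by (simp add: sum_distrib_left mult.left_commute)
      finally have "ennreal (sqrt t) * 1 \<le> ennreal (sqrt t) * (ennreal (1 / n) * (\<Sum>k<n.
          (\<Sum>i. ennreal (2 ^ Suc i) * indicator (?L k (4 ^ i * t)) w)))" by simp
      then have "1 \<le> ennreal (1 / n) * (\<Sum>k<n. (\<Sum>i. ennreal (2 ^ Suc i) * indicator (?L k (4 ^ i * t)) w))"
        using t by (subst (asm) ennreal_mult_le_mult_iff) (auto simp: ennreal_eq_0_iff)
      then show ?thesis using True w by simp
    qed auto
    have "emeasure \<nu> {w \<in> space \<mu>. u w > t} = (\<integral>\<^sup>+w. indicator {w \<in> space \<mu>. u w > t} w \<partial>\<nu>)"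
      by simp
    also have "\<dots> \<le> (\<integral>\<^sup>+w. ennreal (1 / n) * (\<Sum>k<n. \<Sum>i. ennreal (2 ^ Suc i) * indicator (?L k (4 ^ i * t)) w) \<partial>\<nu>)"
      using pw space_V[OF \<nu>] by (intro nn_integral_mono) auto
    also have "\<dots> = ennreal (1 / n) * (\<Sum>k<n. \<Sum>i. ennreal (2 ^ Suc i) * emeasure \<nu> (?L k (4 ^ i * t)))"
      by (subst nn_integral_cmult, measurable)
         (simp add: nn_integral_sum nn_integral_suminf nn_integral_cmult)
    also have "\<dots> \<le> ennreal (1 / n) * (\<Sum>k<n. \<Sum>i. ennreal (2 ^ Suc i) * \<sigma> (?L k (4 ^ i * t)))"
      by (intro mult_left_mono sum_mono suminf_le emeasure_le_semivariation[OF \<nu>]) auto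
    finally show "emeasure \<nu> {w \<in> space \<mu>. u w > t} \<le> \<dots>" .
  qed auto
  \<comment> \<open>The level set of \<open>v k\<close> at \<open>4 ^ i * t\<close> is that of
    \<open>v k / 4 ^ i\<close> at \<open>t\<close>, whence the gain
    \<open>1 / 4 ^ i\<close>.\<close>
  have scaled: "(\<integral>\<^sup>+t. \<sigma> (?L k (4 ^ i * t)) * indicator {0..} t \<partial>lborel) \<le> ennreal (1 / 4 ^ i)"
    if "k < n" for k and i :: nat
  proof -
    have "(\<integral>\<^sup>+t. \<sigma> (?L k (4 ^ i * t)) * indicator {0..} t \<partial>lborel) = choquet (\<lambda>w. (1 / 4 ^ i) * v k w)"
      unfolding choquet_def by (simp add: field_simps)
    also have "\<dots> = ennreal (1 / 4 ^ i) * choquet (v k)" by (rule choquet_cmult) auto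
    also have "\<dots> \<le> ennreal (1 / 4 ^ i) * 1" by (intro mult_left_mono one that) auto
    finally show ?thesis by simp
  qed
  have "choquet u \<le> (\<integral>\<^sup>+t. ennreal (1 / n) * (\<Sum>k<n. \<Sum>i. ennreal (2 ^ Suc i) *
      (\<sigma> (?L k (4 ^ i * t)) * indicator {0..} t)) \<partial>lborel)"
    unfolding choquet_def
  proof (rule nn_integral_mono_AE)
    show "AE t in lborel. \<sigma> {w \<in> space \<mu>. u w > t} * indicator {0..} t \<le>
      ennreal (1 / n) * (\<Sum>k<n. \<Sum>i. ennreal (2 ^ Suc i) * (\<sigma> (?L k (4 ^ i * t)) * indicator {0..} t))"
      using AE_lborel_singleton[of 0]
    proof eventually_elim
      case (elim t)
      show ?case using level[of t] elim by (cases "0 < t") auto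
    qed
  qed
  also have "\<dots> = ennreal (1 / n) * (\<Sum>k<n. \<Sum>i. ennreal (2 ^ Suc i) *
      (\<integral>\<^sup>+t. \<sigma> (?L k (4 ^ i * t)) * indicator {0..} t \<partial>lborel))"
    by (subst nn_integral_cmult, measurable)
       (simp add: nn_integral_sum nn_integral_suminf nn_integral_cmult)
  also have "\<dots> \<le> ennreal (1 / n) * (\<Sum>k<n. \<Sum>i. ennreal (2 ^ Suc i) * ennreal (1 / 4 ^ i))"
    using scaled by (intro mult_left_mono sum_mono suminf_le) auto
  also have "\<dots> = ennreal (1 / n) * (of_nat n * 4)"
    unfolding suminf_dyadic by simp
  also have "\<dots> = 4"
    using n by (simp add: ennreal_of_nat_eq_real_of_nat mult.assoc[symmetric] ennreal_mult[symmetric])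
  finally show ?thesis .
qed

end

section \<open>Orlicz functions and Orlicz spaces\<close>

text \<open>The last condition says that \<phi> x / x is nondecreasing; it takes the place of
  convexity because it can be read off the inverse function. Strict monotonicity and the bijection
  together encode \<open>\<phi> 0 = 0\<close>, continuity and unboundedness on the
  half-line.\<close>

definition orlicz_function :: "(real \<Rightarrow> real) \<Rightarrow> bool" where
  "orlicz_function \<phi> \<longleftrightarrow> bij_betw \<phi> {0..} {0..} \<and> strict_mono_on {0..} \<phi> \<and>
     (\<forall>c x. 0 \<le> c \<longrightarrow> c \<le> 1 \<longrightarrow> 0 \<le> x \<longrightarrow> \<phi> (c * x) \<le> c * \<phi> x)"

context
  fixes \<phi> assumes \<phi>: "orlicz_function \<phi>"
begin

lemma orlicz_nonneg: "0 \<le> x \<Longrightarrow> 0 \<le> \<phi> x"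
  using \<phi> bij_betwE[of \<phi> "{0..}" "{0..}"] by (auto simp: orlicz_function_def)

lemma orlicz_star: "0 \<le> c \<Longrightarrow> c \<le> 1 \<Longrightarrow> 0 \<le> x \<Longrightarrow> \<phi> (c * x) \<le> c * \<phi> x"
  using \<phi> by (auto simp: orlicz_function_def)

lemma orlicz_0: "\<phi> 0 = 0"
  using orlicz_star[of 0 0] orlicz_nonneg[of 0] by simp

lemma orlicz_less: "0 \<le> x \<Longrightarrow> x < y \<Longrightarrow> \<phi> x < \<phi> y"
  using \<phi> strict_mono_onD[of "{0..}" \<phi> x y] by (auto simp: orlicz_function_def)

lemma orlicz_mono: "0 \<le> x \<Longrightarrow> x \<le> y \<Longrightarrow> \<phi> x \<le> \<phi> y"
  using orlicz_less[of x y] by (cases "x = y") auto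

lemma orlicz_le_iff: "0 \<le> x \<Longrightarrow> 0 \<le> y \<Longrightarrow> \<phi> x \<le> \<phi> y \<longleftrightarrow> x \<le> y"
  using orlicz_mono orlicz_less by (metis not_le)

lemma orlicz_pos: "0 < x \<Longrightarrow> 0 < \<phi> x"
  using orlicz_less[of 0 x] orlicz_0 by simp

lemma inv_orlicz_nonneg: "0 \<le> s \<Longrightarrow> 0 \<le> inv_into {0..} \<phi> s"
  using \<phi> inv_into_into[of s \<phi> "{0..}"] by (auto simp: orlicz_function_def bij_betw_def)

lemma orlicz_inv: "0 \<le> s \<Longrightarrow> \<phi> (inv_into {0..} \<phi> s) = s"
  using \<phi> f_inv_into_f[of s \<phi> "{0..}"] by (auto simp: orlicz_function_def bij_betw_def)

lemma inv_orlicz: "0 \<le> x \<Longrightarrow> inv_into {0..} \<phi> (\<phi> x) = x"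
  using \<phi> inv_into_f_f[of \<phi> "{0..}" x] by (auto simp: orlicz_function_def bij_betw_def)

lemma inv_orlicz_less: "0 \<le> s \<Longrightarrow> s < t \<Longrightarrow> inv_into {0..} \<phi> s < inv_into {0..} \<phi> t"
  using orlicz_mono[of "inv_into {0..} \<phi> t" "inv_into {0..} \<phi> s"] orlicz_inv[of s] orlicz_inv[of t]
    inv_orlicz_nonneg[of t] by force

lemma inv_orlicz_mono: "0 \<le> s \<Longrightarrow> s \<le> t \<Longrightarrow> inv_into {0..} \<phi> s \<le> inv_into {0..} \<phi> t"
  using inv_orlicz_less[of s t] by (cases "s = t") auto

lemma inv_orlicz_star:
  assumes "0 \<le> c" "c \<le> 1" "0 \<le> s"
  shows "c * inv_into {0..} \<phi> s \<le> inv_into {0..} \<phi> (c * s)"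
proof -
  have "\<phi> (c * inv_into {0..} \<phi> s) \<le> c * s"
    using orlicz_star[of c "inv_into {0..} \<phi> s"] assms by (simp add: orlicz_inv inv_orlicz_nonneg)
  also have "\<dots> = \<phi> (inv_into {0..} \<phi> (c * s))" using assms by (simp add: orlicz_inv)
  finally show ?thesis
    using assms by (subst (asm) orlicz_le_iff) (auto intro: inv_orlicz_nonneg mult_nonneg_nonneg)
qed

lemma measurable_orlicz:
  assumes [measurable]: "u \<in> borel_measurable M" and "\<And>w. 0 \<le> u w"
  shows "(\<lambda>w. \<phi> (u w)) \<in> borel_measurable M"
proof -
  \<comment> \<open>Nothing is known about \<phi> at negative arguments; precomposing with
    \<open>max 0\<close> makes it monotone on the whole line.\<close>
  have [measurable]: "(\<lambda>x. \<phi> (max 0 x)) \<in> borel_measurable borel"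
    by (intro borel_measurable_mono monoI orlicz_mono) auto
  have "(\<lambda>w. \<phi> (max 0 (u w))) \<in> borel_measurable M" by measurable
  then show ?thesis using assms(2) by (simp add: max_def)
qed

lemma measurable_inv_orlicz:
  assumes [measurable]: "u \<in> borel_measurable M" and "\<And>w. 0 \<le> u w"
  shows "(\<lambda>w. inv_into {0..} \<phi> (u w)) \<in> borel_measurable M"
proof -
  have [measurable]: "(\<lambda>x. inv_into {0..} \<phi> (max 0 x)) \<in> borel_measurable borel"
    by (intro borel_measurable_mono monoI inv_orlicz_mono) auto
  have "(\<lambda>w. inv_into {0..} \<phi> (max 0 (u w))) \<in> borel_measurable M" by measurable
  then show ?thesis using assms(2) by (simp add: max_def)
qed

lemma orlicz_tendsto_0:
  assumes "f \<longlonglongrightarrow> 0" "\<And>n. 0 \<le> f n"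
  shows "(\<lambda>n. \<phi> (f n)) \<longlonglongrightarrow> 0"
proof (rule tendsto_sandwich[where f = "\<lambda>_. 0" and h = "\<lambda>n. f n * \<phi> 1"])
  have "\<forall>\<^sub>F n in sequentially. f n < 1" using assms(1) by (simp add: order_tendsto_iff)
  then show "\<forall>\<^sub>F n in sequentially. \<phi> (f n) \<le> f n * \<phi> 1"
    using orlicz_star[of _ 1] assms(2) by (auto elim!: eventually_mono)
  show "(\<lambda>n. f n * \<phi> 1) \<longlonglongrightarrow> 0" using assms(1) tendsto_mult_left_zero by blast
qed (use assms orlicz_nonneg in auto)

text \<open>Beyond 1 the function grows at least linearly,
  \<open>x * \<phi> 1 \<le> \<phi> x\<close>, by star-shapedness. This is behind the embedding into
  the integrable functions.\<close>

lemma le_one_plus_orlicz: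
  assumes "0 \<le> x"
  shows "x \<le> 1 + \<phi> x / \<phi> 1"
proof (cases "x \<le> 1")
  case True
  then show ?thesis using orlicz_nonneg[OF assms] orlicz_nonneg[of 1] by (simp add: add_increasing2)
next
  case False
  then have "\<phi> 1 \<le> \<phi> x / x" using orlicz_star[of "1 / x" x] by simp
  then have "x \<le> \<phi> x / \<phi> 1" using orlicz_pos[of 1] False by (simp add: field_simps)
  then show ?thesis by simp
qed

text \<open>Doubling is iterated until the power of two exceeds \<open>b\<close>. It makes a modular
  that is finite at one scale finite at every scale.\<close>

lemma Delta2_scale:
  assumes "Delta2 \<phi>" and b: "0 \<le> b"
  obtains C where "0 < C" "\<And>x. 0 \<le> x \<Longrightarrow> \<phi> (b * x) \<le> C * \<phi> x"
proof -
  obtain D where D: "D > 1" "\<And>t. 0 \<le> t \<Longrightarrow> \<phi> (2 * t) \<le> D * \<phi> t"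
    using assms by (auto simp: Delta2_def)
  have pow: "\<phi> (2 ^ j * x) \<le> D ^ j * \<phi> x" if "0 \<le> x" for j :: nat and x
  proof (induction j)
    case (Suc j)
    have "\<phi> (2 ^ Suc j * x) \<le> D * \<phi> (2 ^ j * x)"
      using D(2)[of "2 ^ j * x"] that by (simp add: mult.assoc)
    also have "\<dots> \<le> D * (D ^ j * \<phi> x)" using Suc D by (intro mult_left_mono) auto
    finally show ?case by (simp add: mult.assoc)
  qed auto
  obtain j :: nat where j: "b < 2 ^ j" using real_arch_pow[of 2 b] by auto
  have "\<phi> (b * x) \<le> D ^ j * \<phi> x" if x: "0 \<le> x" for x
  proof -
    have "\<phi> (b * x) \<le> \<phi> (2 ^ j * x)"
      using j b x by (intro orlicz_mono mult_right_mono) auto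
    then show ?thesis using pow[OF x, of j] by simp
  qed
  then show thesis using that[of "D ^ j"] D(1) by auto
qed

end

lemma young_imp_orlicz:
  assumes "young_function \<phi>"
  shows "orlicz_function \<phi>"
proof -
  have Y: "strict_mono_on {0..} \<phi>" "continuous_on {0..} \<phi>" "convex_on {0..} \<phi>" "\<phi> 0 = 0"
    "filterlim \<phi> at_top at_top"
    using assms by (auto simp: young_function_def)
  have nn: "0 \<le> \<phi> x" if "0 \<le> x" for x
    using strict_mono_onD[OF Y(1), of 0 x] that Y(4) by (cases "x = 0") auto
  have "s \<in> \<phi> ` {0..}" if "0 \<le> s" for s
  proof -
    have "\<forall>\<^sub>F x in at_top. s \<le> \<phi> x \<and> 0 \<le> x"
      using Y(5) eventually_ge_at_top[of 0] by (auto simp: filterlim_at_top eventually_conj_iff)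
    then obtain x where x: "s \<le> \<phi> x" "0 \<le> x" using eventually_happens by force
    have "\<exists>y\<ge>0. y \<le> x \<and> \<phi> y = s"
      using x that Y(4) by (intro IVT') (auto intro: continuous_on_subset[OF Y(2)])
    then show ?thesis by auto
  qed
  then have "bij_betw \<phi> {0..} {0..}"
    using nn strict_mono_on_imp_inj_on[OF Y(1)] by (auto simp: bij_betw_def)
  moreover have "\<phi> (c * x) \<le> c * \<phi> x" if "0 \<le> c" "c \<le> 1" "0 \<le> x" for c x
    using convex_onD[OF Y(3), of c 0 x] that Y(4) by auto
  ultimately show ?thesis using Y(1) by (auto simp: orlicz_function_def)
qed

text \<open>For an inverse function g the star condition reads c g(s) \<le> g(c s) with 0 \<le> c
  \<le> 1. It passes to weighted geometric means, because c = c^(1-\<theta>) c^\<theta>; strict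
  monotonicity passes likewise.\<close>

lemma interpolated_orlicz:
  assumes 0: "orlicz_function \<phi>0" and 1: "orlicz_function \<phi>1" and \<theta>: "0 < \<theta>" "\<theta> < 1"
    and bij: "bij_betw \<phi> {0..} {0..}"
    and inv: "\<And>s. 0 \<le> s \<Longrightarrow> inv_into {0..} \<phi> s =
      (inv_into {0..} \<phi>0 s) powr (1 - \<theta>) * (inv_into {0..} \<phi>1 s) powr \<theta>"
  shows "orlicz_function \<phi>"
proof -
  let ?g = "inv_into {0..} \<phi>" and ?p = "inv_into {0..} \<phi>0" and ?q = "inv_into {0..} \<phi>1"
  have nn: "0 \<le> \<phi> x" if "0 \<le> x" for x using bij_betwE[OF bij] that by auto
  have g\<phi>: "?g (\<phi> x) = x" if "0 \<le> x" for x
    using bij that by (intro inv_into_f_f) (auto simp: bij_betw_def)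
  have \<phi>g: "\<phi> (?g s) = s" if "0 \<le> s" for s
    using bij that by (intro f_inv_into_f) (auto simp: bij_betw_def)
  have gnn: "0 \<le> ?g s" if "0 \<le> s" for s by (simp add: inv that)
  have mono: "?g s < ?g t" if "0 \<le> s" "s < t" for s t
  proof -
    have "?p s < ?p t" "?q s < ?q t" using inv_orlicz_less 0 1 that by auto
    then show ?thesis
      unfolding inv[OF that(1)] using that \<theta>
      by (subst inv, simp, intro mult_strict_mono' powr_less_mono2) (auto intro: inv_orlicz_nonneg 0 1)
  qed
  have less: "\<phi> x < \<phi> y" if "0 \<le> x" "x < y" for x y
  proof (rule ccontr)
    assume "\<not> \<phi> x < \<phi> y"
    then consider "\<phi> y < \<phi> x" | "\<phi> x = \<phi> y" by linarith
    then show False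
    proof cases
      case 1
      then have "?g (\<phi> y) < ?g (\<phi> x)" using nn that by (intro mono) auto
      then show False using g\<phi> that by auto
    next
      case 2
      then have "?g (\<phi> x) = ?g (\<phi> y)" by simp
      then show False using g\<phi> that by auto
    qed
  qed
  have star: "\<phi> (c * x) \<le> c * \<phi> x" if "0 \<le> c" "c \<le> 1" "0 \<le> x" for c x
  proof -
    define s where "s = \<phi> x"
    have s: "0 \<le> s" using nn that by (simp add: s_def)
    have "c * x = c * ?g s" using g\<phi> that by (simp add: s_def)
    also have "\<dots> = (c powr (1 - \<theta>) * c powr \<theta>) * (?p s powr (1 - \<theta>) * ?q s powr \<theta>)"
      using that by (simp add: inv[OF s] powr_add[symmetric])
    also have "\<dots> = (c * ?p s) powr (1 - \<theta>) * (c * ?q s) powr \<theta>"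
      using that s by (simp add: powr_mult inv_orlicz_nonneg 0 1)
    also have "\<dots> \<le> ?p (c * s) powr (1 - \<theta>) * ?q (c * s) powr \<theta>"
      using that s \<theta> inv_orlicz_nonneg[OF 0] inv_orlicz_nonneg[OF 1]
        inv_orlicz_star[OF 0, of c s] inv_orlicz_star[OF 1, of c s]
      by (intro mult_mono powr_mono2) auto
    also have "\<dots> = ?g (c * s)" using that s by (subst inv) auto
    finally have "c * x \<le> ?g (c * s)" .
    moreover have "\<phi> (c * x) \<le> \<phi> (?g (c * s))"
      using calculation less[of "c * x" "?g (c * s)"] that
      by (cases "c * x = ?g (c * s)") auto
    ultimately show ?thesis using \<phi>g[of "c * s"] that s by (simp add: s_def)
  qed
  show ?thesis
    unfolding orlicz_function_def using bij less star by (auto intro!: strict_mono_onI)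
qed

section \<open>Orlicz spaces over the semivariation\<close>

context semivariation_space
begin

definition modular :: "(real \<Rightarrow> real) \<Rightarrow> ('w \<Rightarrow> complex) \<Rightarrow> real \<Rightarrow> ennreal" where
  "modular \<phi> f k = choquet (\<lambda>w. \<phi> (norm (f w) / k))"

abbreviation "L \<phi> \<equiv> orlicz_space \<mu> m \<phi>"

lemma L1_qnorm_eq: "L1_qnorm \<mu> m f = choquet (\<lambda>w. norm (f w))"
  by (simp add: L1_qnorm_def choquet_def)

context
  fixes \<phi> assumes \<phi>: "orlicz_function \<phi>"
begin

lemma measurable_modular [measurable]:
  fixes f :: "'w \<Rightarrow> complex"
  assumes [measurable]: "f \<in> borel_measurable \<mu>" and k: "0 < k"
  shows "(\<lambda>w. \<phi> (norm (f w) / k)) \<in> borel_measurable \<mu>"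
  using k by (intro measurable_orlicz[OF \<phi>]) auto

lemma L1_qnorm_modular: "0 < k \<Longrightarrow> L1_qnorm \<mu> m (orlicz_modular \<phi> f k) = modular \<phi> f k"
  by (simp add: L1_qnorm_eq orlicz_modular_def modular_def orlicz_nonneg[OF \<phi>])

lemma orlicz_modular_in_L1:
  assumes "f \<in> borel_measurable \<mu>" "0 < k"
  shows "orlicz_modular \<phi> f k \<in> L1_semivar \<mu> m \<longleftrightarrow> modular \<phi> f k < \<infinity>"
  using assms L1_qnorm_modular[of k f] measurable_modular[of f k]
  by (auto simp: L1_semivar_def orlicz_modular_def)

lemma in_L_iff: "f \<in> carrier_of (L \<phi>) \<longleftrightarrow> f \<in> borel_measurable \<mu> \<and> (\<exists>c>0. modular \<phi> f c < \<infinity>)"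
  using orlicz_modular_in_L1[of f] by (auto simp: orlicz_space_def)

lemma in_L_measurable: "f \<in> carrier_of (L \<phi>) \<Longrightarrow> f \<in> borel_measurable \<mu>"
  by (simp add: in_L_iff)

lemma qnorm_L_eq:
  "f \<in> borel_measurable \<mu> \<Longrightarrow> qnorm_of (L \<phi>) f = Inf {k. k > 0 \<and> modular \<phi> f k \<le> 1}"
  unfolding orlicz_space_def snd_conv
  by (rule arg_cong[where f = Inf]) (auto simp: orlicz_modular_in_L1 L1_qnorm_modular order_le_less_trans)

lemma modular_mono_AE:
  assumes "AE w in \<mu>. norm (f w) / k \<le> norm (g w) / l" "0 < k" "0 < l"
    "f \<in> borel_measurable \<mu>" "g \<in> borel_measurable \<mu>"
  shows "modular \<phi> f k \<le> modular \<phi> g l"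
  unfolding modular_def
proof (rule choquet_mono_AE)
  show "AE w in \<mu>. \<phi> (norm (f w) / k) \<le> \<phi> (norm (g w) / l)"
    using assms(1) by eventually_elim (rule orlicz_mono[OF \<phi>], use assms in auto)
qed (use assms in auto)

lemma modular_scale:
  assumes [measurable]: "f \<in> borel_measurable \<mu>" and "0 < k" "1 \<le> s"
  shows "modular \<phi> f (s * k) \<le> ennreal (1 / s) * modular \<phi> f k"
proof -
  have "\<phi> (norm (f w) / (s * k)) \<le> (1 / s) * \<phi> (norm (f w) / k)" for w
    using orlicz_star[OF \<phi>, of "1 / s" "norm (f w) / k"] assms by (simp add: field_simps)
  then have "modular \<phi> f (s * k) \<le> choquet (\<lambda>w. (1 / s) * \<phi> (norm (f w) / k))"
    unfolding modular_def using assms by (intro choquet_mono_AE borel_measurable_times) auto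
  also have "\<dots> = ennreal (1 / s) * modular \<phi> f k"
    unfolding modular_def using assms by (intro choquet_cmult) auto
  finally show ?thesis .
qed

lemma in_L_modular_le_1:
  assumes "f \<in> carrier_of (L \<phi>)"
  shows "\<exists>k>0. modular \<phi> f k \<le> 1"
proof -
  obtain c where c: "c > 0" "modular \<phi> f c < \<infinity>" and [measurable]: "f \<in> borel_measurable \<mu>"
    using assms by (auto simp: in_L_iff)
  obtain a where a: "modular \<phi> f c = ennreal a" "0 \<le> a"
    using c(2) by (cases "modular \<phi> f c") auto
  define s where "s = max 1 a"
  have s: "1 \<le> s" "a \<le> s" by (auto simp: s_def)
  have "modular \<phi> f (s * c) \<le> ennreal (1 / s) * ennreal a"
    using modular_scale[of f c s] c s a by simp
  also have "\<dots> = ennreal (a / s)" using s a by (simp add: ennreal_mult[symmetric])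
  also have "\<dots> \<le> 1" using s by (simp add: ennreal_le_1)
  finally show ?thesis using c s by (intro exI[of _ "s * c"]) auto
qed

lemma modular_le_1_of_qnorm_less:
  assumes f: "f \<in> carrier_of (L \<phi>)" and k: "qnorm_of (L \<phi>) f < k"
  shows "0 < k" "modular \<phi> f k \<le> 1"
proof -
  note [measurable] = in_L_measurable[OF f]
  have "{k. k > 0 \<and> modular \<phi> f k \<le> 1} \<noteq> {}" using in_L_modular_le_1[OF f] by auto
  then obtain l where l: "l < k" "l > 0" "modular \<phi> f l \<le> 1"
    using k cInf_lessD[of "{k. k > 0 \<and> modular \<phi> f k \<le> 1}" k] by (auto simp: qnorm_L_eq)
  then show "0 < k" by simp
  have "modular \<phi> f k \<le> modular \<phi> f l"
    using l by (intro modular_mono_AE AE_I2 frac_le) auto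
  then show "modular \<phi> f k \<le> 1" using l by simp
qed

lemma qnorm_le:
  assumes "f \<in> borel_measurable \<mu>" "0 < k" "modular \<phi> f k \<le> 1"
  shows "f \<in> carrier_of (L \<phi>)" "qnorm_of (L \<phi>) f \<le> k"
proof -
  have "modular \<phi> f k < \<infinity>" using assms(3) order_le_less_trans by fastforce
  then show "f \<in> carrier_of (L \<phi>)" using assms by (auto simp: in_L_iff)
  show "qnorm_of (L \<phi>) f \<le> k"
    unfolding qnorm_L_eq[OF assms(1)] using assms
    by (intro cInf_lower) (auto intro!: bdd_belowI[of _ 0])
qed

lemma qnorm_nonneg:
  assumes "f \<in> carrier_of (L \<phi>)" shows "0 \<le> qnorm_of (L \<phi>) f"
  unfolding qnorm_L_eq[OF in_L_measurable[OF assms]]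
  using in_L_modular_le_1[OF assms] by (intro cInf_greatest) auto

text \<open>The quotient |f + g| / (a + b) is at most the larger of |f| / a and |g| / b, so
  \<open>choquet_max\<close> applies and no triangle inequality for \<open>choquet\<close> is called
  for.\<close>

lemma L_add:
  assumes "f \<in> carrier_of (L \<phi>)" "g \<in> carrier_of (L \<phi>)"
  shows "(\<lambda>w. f w + g w) \<in> carrier_of (L \<phi>)"
proof -
  note [measurable] = in_L_measurable[OF assms(1)] in_L_measurable[OF assms(2)]
  obtain a b where a: "a > 0" "modular \<phi> f a < \<infinity>" and b: "b > 0" "modular \<phi> g b < \<infinity>"
    using assms by (auto simp: in_L_iff)
  have "\<phi> (norm (f w + g w) / (a + b)) \<le> max (\<phi> (norm (f w) / a)) (\<phi> (norm (g w) / b))" for w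
  proof -
    define x where "x = max (norm (f w) / a) (norm (g w) / b)"
    have "norm (f w) \<le> a * x" "norm (g w) \<le> b * x"
      using a b by (auto simp: x_def max_def field_simps)
    then have "norm (f w + g w) \<le> (a + b) * x"
      using norm_triangle_ineq[of "f w" "g w"] by (simp add: distrib_right)
    then have "norm (f w + g w) / (a + b) \<le> x" using a b by (simp add: field_simps)
    then have "\<phi> (norm (f w + g w) / (a + b)) \<le> \<phi> x" using a b by (intro orlicz_mono[OF \<phi>]) auto
    also have "\<dots> \<le> max (\<phi> (norm (f w) / a)) (\<phi> (norm (g w) / b))"
      by (auto simp: x_def max_def)
    finally show ?thesis .
  qed
  then have "modular \<phi> (\<lambda>w. f w + g w) (a + b) \<le> choquet (\<lambda>w. max (\<phi> (norm (f w) / a)) (\<phi> (norm (g w) / b)))"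
    unfolding modular_def using a b by (intro choquet_mono_AE borel_measurable_max) auto
  also have "\<dots> \<le> modular \<phi> f a + modular \<phi> g b"
    unfolding modular_def using a b by (intro choquet_max) auto
  also have "\<dots> < \<infinity>" using a b by (simp add: ennreal_add_less_top)
  finally show ?thesis using a b by (auto simp: in_L_iff intro!: exI[of _ "a + b"])
qed

lemma L_cmult:
  assumes "f \<in> carrier_of (L \<phi>)"
  shows "(\<lambda>w. c * f w) \<in> carrier_of (L \<phi>)"
proof -
  note [measurable] = in_L_measurable[OF assms]
  obtain a where a: "a > 0" "modular \<phi> f a < \<infinity>" using assms by (auto simp: in_L_iff)
  have "modular \<phi> (\<lambda>w. c * f w) ((norm c + 1) * a) \<le> modular \<phi> f a"
  proof (intro modular_mono_AE AE_I2)
    fix w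
    have "norm (c * f w) / ((norm c + 1) * a) = (norm c / (norm c + 1)) * (norm (f w) / a)"
      by (simp add: norm_mult)
    also have "\<dots> \<le> 1 * (norm (f w) / a)" using a by (intro mult_right_mono) (auto simp: field_simps add_pos_nonneg)
    finally show "norm (c * f w) / ((norm c + 1) * a) \<le> norm (f w) / a" by simp
  qed (use a in \<open>auto simp: add_nonneg_pos\<close>)
  also have "\<dots> < \<infinity>" by (rule a(2))
  finally show ?thesis using a
    by (auto simp: in_L_iff add_nonneg_pos intro!: exI[of _ "(norm c + 1) * a"])
qed

text \<open>Linear growth of \<phi> bounds |f| by k (1 + \<phi>(|f| / k) / \<phi>(1)), and the
  integral of \<phi>(|f| / k) is at most the modular, hence at most 1.\<close>

lemma nn_integral_norm_le_qnorm:
  assumes f: "f \<in> carrier_of (L \<phi>)" and k: "qnorm_of (L \<phi>) f < k"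
  shows "(\<integral>\<^sup>+w. ennreal (norm (f w)) \<partial>\<mu>) \<le> ennreal ((measure \<mu> (space \<mu>) + 1 / \<phi> 1) * k)"
proof -
  note [measurable] = in_L_measurable[OF f]
  note k = modular_le_1_of_qnorm_less[OF f k]
  note [measurable] = measurable_modular[OF in_L_measurable[OF f] k(1)]
  have p1: "0 < \<phi> 1" by (rule orlicz_pos[OF \<phi>]) simp
  have "(\<integral>\<^sup>+w. ennreal (norm (f w)) \<partial>\<mu>)
      \<le> (\<integral>\<^sup>+w. ennreal k * (1 + ennreal (1 / \<phi> 1) * ennreal (\<phi> (norm (f w) / k))) \<partial>\<mu>)"
  proof (rule nn_integral_mono)
    fix w
    have nn: "0 \<le> \<phi> (norm (f w) / k)" using k by (intro orlicz_nonneg[OF \<phi>]) auto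
    have "norm (f w) / k \<le> 1 + \<phi> (norm (f w) / k) / \<phi> 1"
      using k by (intro le_one_plus_orlicz[OF \<phi>]) auto
    then have "norm (f w) \<le> k * (1 + (1 / \<phi> 1) * \<phi> (norm (f w) / k))"
      using k by (simp add: field_simps)
    then have "ennreal (norm (f w)) \<le> ennreal (k * (1 + (1 / \<phi> 1) * \<phi> (norm (f w) / k)))"
      by (rule ennreal_leI)
    also have "\<dots> = ennreal k * ennreal (1 + (1 / \<phi> 1) * \<phi> (norm (f w) / k))"
      using k nn p1 by (intro ennreal_mult) (auto intro!: add_nonneg_nonneg)
    also have "ennreal (1 + (1 / \<phi> 1) * \<phi> (norm (f w) / k)) = 1 + ennreal ((1 / \<phi> 1) * \<phi> (norm (f w) / k))"
      using nn p1 by (subst ennreal_plus) (auto simp del: times_divide_eq_left)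
    also have "ennreal ((1 / \<phi> 1) * \<phi> (norm (f w) / k)) = ennreal (1 / \<phi> 1) * ennreal (\<phi> (norm (f w) / k))"
      using nn p1 by (intro ennreal_mult) auto
    finally show "ennreal (norm (f w)) \<le> ennreal k * (1 + ennreal (1 / \<phi> 1) * ennreal (\<phi> (norm (f w) / k)))" .
  qed
  also have "\<dots> = ennreal k * (emeasure \<mu> (space \<mu>) + ennreal (1 / \<phi> 1) * (\<integral>\<^sup>+w. ennreal (\<phi> (norm (f w) / k)) \<partial>\<mu>))"
    by (simp add: nn_integral_cmult nn_integral_add)
  also have "\<dots> \<le> ennreal k * (emeasure \<mu> (space \<mu>) + ennreal (1 / \<phi> 1) * 1)"
  proof (intro mult_left_mono add_left_mono)
    have "(\<integral>\<^sup>+w. ennreal (\<phi> (norm (f w) / k)) \<partial>\<mu>) \<le> modular \<phi> f k"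
      unfolding modular_def by (rule nn_integral_le_choquet) measurable
    then show "(\<integral>\<^sup>+w. ennreal (\<phi> (norm (f w) / k)) \<partial>\<mu>) \<le> 1" using k(2) by simp
  qed auto
  also have "\<dots> = ennreal ((measure \<mu> (space \<mu>) + 1 / \<phi> 1) * k)"
    using k p1 by (simp add: emeasure_eq_measure ennreal_plus[symmetric] ennreal_mult[symmetric] mult.commute del: ennreal_plus)
  finally show ?thesis .
qed

text \<open>By \<open>Delta2\<close> the modular of \<open>g\<close> is finite at every scale, so
  \<open>choquet_dominated\<close> sends the modular of \<open>f n\<close> to 0 at each scale. A
  modular below 1 at the scale e / 2 bounds the quasi-norm by e / 2.\<close>

lemma dominated_qnorm:
  fixes f :: "nat \<Rightarrow> 'w \<Rightarrow> complex"
  assumes D: "Delta2 \<phi>" and g: "g \<in> carrier_of (L \<phi>)"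
    and [measurable]: "\<And>n. f n \<in> borel_measurable \<mu>"
    and le: "\<And>n. AE w in \<mu>. norm (f n w) \<le> norm (g w)" and lim: "AE w in \<mu>. (\<lambda>n. f n w) \<longlonglongrightarrow> 0"
  shows "(\<lambda>n. qnorm_of (L \<phi>) (f n)) \<longlonglongrightarrow> 0"
proof -
  note [measurable] = in_L_measurable[OF g]
  obtain a where a: "a > 0" "modular \<phi> g a < \<infinity>" using g by (auto simp: in_L_iff)
  have lim': "(\<lambda>n. modular \<phi> (f n) \<epsilon>) \<longlonglongrightarrow> 0" if \<epsilon>: "0 < \<epsilon>" for \<epsilon>
    unfolding modular_def
  proof (rule choquet_dominated)
    show "AE w in \<mu>. \<phi> (norm (f n w) / \<epsilon>) \<le> \<phi> (norm (g w) / \<epsilon>)" for n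
      using le[of n]
      by eventually_elim (rule orlicz_mono[OF \<phi>], use \<epsilon> in \<open>auto intro: divide_right_mono\<close>)
    have "0 \<le> a / \<epsilon>" using a \<epsilon> by simp
    then obtain C where C: "0 < C" "\<And>x. 0 \<le> x \<Longrightarrow> \<phi> ((a / \<epsilon>) * x) \<le> C * \<phi> x"
      using Delta2_scale[OF \<phi> D] by metis
    have "choquet (\<lambda>w. \<phi> (norm (g w) / \<epsilon>)) \<le> choquet (\<lambda>w. C * \<phi> (norm (g w) / a))"
    proof (rule choquet_mono_AE, rule AE_I2)
      fix w
      have "\<phi> (norm (g w) / \<epsilon>) = \<phi> ((a / \<epsilon>) * (norm (g w) / a))" using a by simp
      then show "\<phi> (norm (g w) / \<epsilon>) \<le> C * \<phi> (norm (g w) / a)" using C(2)[of "norm (g w) / a"] a by simp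
    qed (use a \<epsilon> in \<open>auto intro!: borel_measurable_times\<close>)
    also have "\<dots> = ennreal C * modular \<phi> g a"
      unfolding modular_def using a C by (intro choquet_cmult) auto
    also have "\<dots> < \<infinity>" using a by (simp add: ennreal_mult_less_top)
    finally show "choquet (\<lambda>w. \<phi> (norm (g w) / \<epsilon>)) < \<infinity>" .
    show "AE w in \<mu>. (\<lambda>n. \<phi> (norm (f n w) / \<epsilon>)) \<longlonglongrightarrow> 0"
      using lim
    proof eventually_elim
      case (elim w)
      have "(\<lambda>n. norm (f n w) / \<epsilon>) \<longlonglongrightarrow> norm (0::complex) / \<epsilon>"
        using \<epsilon> by (intro tendsto_intros elim) auto
      then show ?case using \<epsilon> by (intro orlicz_tendsto_0[OF \<phi>]) auto
    qed
  qed (use \<epsilon> in auto)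
  have carrier: "f n \<in> carrier_of (L \<phi>)" for n
  proof -
    have "AE w in \<mu>. norm (f n w) / a \<le> norm (g w) / a"
      using le[of n] by eventually_elim (use a in \<open>auto intro: divide_right_mono\<close>)
    then have "modular \<phi> (f n) a \<le> modular \<phi> g a" using a by (intro modular_mono_AE) auto
    with a show ?thesis by (auto simp: in_L_iff intro!: exI[of _ a] dest: order_le_less_trans)
  qed
  show ?thesis
  proof (rule order_tendstoI)
    fix e :: real assume "e < 0"
    then show "\<forall>\<^sub>F n in sequentially. e < qnorm_of (L \<phi>) (f n)"
      using qnorm_nonneg[OF carrier] by (intro always_eventually) (auto intro: less_le_trans)
  next
    fix e :: real assume e: "0 < e"
    have "\<forall>\<^sub>F n in sequentially. modular \<phi> (f n) (e / 2) < 1"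
      using lim'[of "e / 2"] e by (simp add: order_tendsto_iff)
    then show "\<forall>\<^sub>F n in sequentially. qnorm_of (L \<phi>) (f n) < e"
    proof eventually_elim
      case (elim n)
      have "qnorm_of (L \<phi>) (f n) \<le> e / 2" using e elim by (intro qnorm_le) auto
      then show ?case using e by simp
    qed
  qed
qed

end

end

section \<open>The sum space\<close>

lemma sequentially_imp_tendsto_at_within:
  fixes f :: "'a::first_countable_topology \<Rightarrow> 'b::topological_space"
  assumes "\<And>X. (\<And>i. X i \<in> S) \<Longrightarrow> X \<longlonglongrightarrow> a \<Longrightarrow> (\<lambda>n. f (X n)) \<longlonglongrightarrow> l"
  shows "(f \<longlongrightarrow> l) (at a within S)"
  unfolding tendsto_at_iff_sequentially using assms by (auto simp: comp_def)

lemma closed_strip: "closed {z. 0 \<le> Re z \<and> Re z \<le> 1}"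
  by (intro closed_Collect_conj closed_Collect_le continuous_intros)

lemma closure_unit_strip: "closure unit_strip \<subseteq> {z. 0 \<le> Re z \<and> Re z \<le> 1}"
  by (rule closure_minimal[OF _ closed_strip]) (auto simp: unit_strip_def)

lemma convex_combination_le_max:
  fixes p q x :: real
  assumes "0 \<le> x" "x \<le> 1"
  shows "(1 - x) * p + x * q \<le> max p q"
proof -
  have "(1 - x) * p + x * q \<le> (1 - x) * max p q + x * max p q"
    using assms by (intro add_mono mult_left_mono) auto
  then show ?thesis by (simp add: algebra_simps)
qed

lemma exp_sums_complex: "(\<lambda>n. h ^ n / fact n) sums exp h" for h :: complex
  using exp_converges[of h] by (simp add: scaleR_conv_of_real divide_inverse mult.commute)

lemma norm_exp_partial_le: "norm (\<Sum>k<n. h ^ k / fact k :: complex) \<le> exp (norm h)"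
proof -
  have "norm (\<Sum>k<n. h ^ k / fact k) \<le> (\<Sum>k<n. norm h ^ k / fact k)"
    by (rule order_trans[OF norm_sum]) (simp add: norm_divide norm_power)
  also have "\<dots> \<le> (\<Sum>k. norm h ^ k / fact k)"
    using exp_converges[of "norm h"]
    by (intro sum_le_suminf) (auto simp: sums_iff divide_inverse mult.commute)
  also have "\<dots> = exp (norm h)"
    using exp_converges[of "norm h"] by (simp add: sums_iff divide_inverse mult.commute)
  finally show ?thesis .
qed

lemma power_over_fact_le_exp: "0 \<le> x \<Longrightarrow> x ^ n / fact n \<le> exp (x::real)"
proof -
  assume x: "0 \<le> x"
  have "(\<Sum>k\<in>{n}. x ^ k / fact k) \<le> (\<Sum>k. x ^ k / fact k)"
    using exp_converges[of x] x
    by (intro sum_le_suminf) (auto simp: sums_iff divide_inverse mult.commute)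
  also have "\<dots> = exp x"
    using exp_converges[of x] by (simp add: sums_iff divide_inverse mult.commute)
  finally show ?thesis by simp
qed

context semivariation_space
begin

lemma qnorm_mono:
  assumes \<phi>: "orlicz_function \<phi>" and g: "g \<in> carrier_of (L \<phi>)" and f: "f \<in> borel_measurable \<mu>"
    and le: "AE w in \<mu>. norm (f w) \<le> norm (g w)"
  shows "f \<in> carrier_of (L \<phi>)" "qnorm_of (L \<phi>) f \<le> qnorm_of (L \<phi>) g"
proof -
  have *: "f \<in> carrier_of (L \<phi>) \<and> qnorm_of (L \<phi>) f \<le> k" if "qnorm_of (L \<phi>) g < k" for k
  proof -
    have k: "0 < k" "modular \<phi> g k \<le> 1" using modular_le_1_of_qnorm_less[OF \<phi> g that] by auto
    have "AE w in \<mu>. norm (f w) / k \<le> norm (g w) / k"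
      using le by eventually_elim (use k in \<open>auto intro: divide_right_mono\<close>)
    then have "modular \<phi> f k \<le> modular \<phi> g k"
      using k f in_L_measurable[OF \<phi> g] by (intro modular_mono_AE[OF \<phi>]) auto
    then show ?thesis using qnorm_le[OF \<phi> f k(1)] k(2) by auto
  qed
  from *[of "qnorm_of (L \<phi>) g + 1"] show "f \<in> carrier_of (L \<phi>)" by simp
  show "qnorm_of (L \<phi>) f \<le> qnorm_of (L \<phi>) g"
  proof (rule field_le_epsilon)
    fix e :: real assume "0 < e"
    with *[of "qnorm_of (L \<phi>) g + e"] show "qnorm_of (L \<phi>) f \<le> qnorm_of (L \<phi>) g + e" by simp
  qed
qed

context
  fixes \<phi>0 \<phi>1 :: "real \<Rightarrow> real"
  assumes \<phi>0: "orlicz_function \<phi>0" and \<phi>1: "orlicz_function \<phi>1"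
begin

abbreviation "LS \<equiv> sum_space \<mu> (L \<phi>0) (L \<phi>1)"

lemma in_LS_iff: "f \<in> carrier_of LS \<longleftrightarrow> f \<in> borel_measurable \<mu> \<and>
   (\<exists>g\<in>carrier_of (L \<phi>0). \<exists>h\<in>carrier_of (L \<phi>1). AE w in \<mu>. f w = g w + h w)"
  by (simp add: sum_space_def)

lemma in_LS_I:
  "f \<in> borel_measurable \<mu> \<Longrightarrow> g \<in> carrier_of (L \<phi>0) \<Longrightarrow> h \<in> carrier_of (L \<phi>1) \<Longrightarrow>
    AE w in \<mu>. f w = g w + h w \<Longrightarrow> f \<in> carrier_of LS"
  unfolding in_LS_iff by blast

lemma in_LS_measurable: "f \<in> carrier_of LS \<Longrightarrow> f \<in> borel_measurable \<mu>"
  by (simp add: in_LS_iff)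

lemma qnorm_LS_le:
  assumes "g \<in> carrier_of (L \<phi>0)" "h \<in> carrier_of (L \<phi>1)" "AE w in \<mu>. f w = g w + h w"
  shows "qnorm_of LS f \<le> qnorm_of (L \<phi>0) g + qnorm_of (L \<phi>1) h"
  unfolding sum_space_def snd_conv
  by (rule cInf_lower) (use assms in \<open>auto intro!: bdd_belowI[of _ 0] add_nonneg_nonneg qnorm_nonneg \<phi>0 \<phi>1\<close>)

lemma qnorm_LS_nonneg:
  assumes "f \<in> carrier_of LS" shows "0 \<le> qnorm_of LS f"
  unfolding sum_space_def snd_conv
  by (rule cInf_greatest)
     (use assms in \<open>auto simp: in_LS_iff intro!: add_nonneg_nonneg qnorm_nonneg \<phi>0 \<phi>1\<close>)

lemma LS_add:
  assumes "f \<in> carrier_of LS" "g \<in> carrier_of LS"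
  shows "(\<lambda>w. f w + g w) \<in> carrier_of LS"
proof -
  obtain f0 f1 where f: "f0 \<in> carrier_of (L \<phi>0)" "f1 \<in> carrier_of (L \<phi>1)" "AE w in \<mu>. f w = f0 w + f1 w"
    and [measurable]: "f \<in> borel_measurable \<mu>" using assms(1) by (auto simp: in_LS_iff)
  obtain g0 g1 where g: "g0 \<in> carrier_of (L \<phi>0)" "g1 \<in> carrier_of (L \<phi>1)" "AE w in \<mu>. g w = g0 w + g1 w"
    and [measurable]: "g \<in> borel_measurable \<mu>" using assms(2) by (auto simp: in_LS_iff)
  have "AE w in \<mu>. f w + g w = (f0 w + g0 w) + (f1 w + g1 w)"
    using f(3) g(3) by eventually_elim simp
  then show ?thesis
    by (intro in_LS_I[OF _ L_add[OF \<phi>0 f(1) g(1)] L_add[OF \<phi>1 f(2) g(2)]]) measurable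
qed

lemma LS_cmult:
  assumes "f \<in> carrier_of LS"
  shows "(\<lambda>w. c * f w) \<in> carrier_of LS"
proof -
  obtain f0 f1 where f: "f0 \<in> carrier_of (L \<phi>0)" "f1 \<in> carrier_of (L \<phi>1)" "AE w in \<mu>. f w = f0 w + f1 w"
    and [measurable]: "f \<in> borel_measurable \<mu>" using assms(1) by (auto simp: in_LS_iff)
  have "AE w in \<mu>. c * f w = c * f0 w + c * f1 w"
    using f(3) by eventually_elim (simp add: distrib_left)
  then show ?thesis
    by (intro in_LS_I[OF _ L_cmult[OF \<phi>0 f(1)] L_cmult[OF \<phi>1 f(2)]]) measurable
qed

lemma LS_diff:
  assumes "f \<in> carrier_of LS" "g \<in> carrier_of LS"
  shows "(\<lambda>w. f w - g w) \<in> carrier_of LS"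
  using LS_add[OF assms(1) LS_cmult[OF assms(2), of "-1"]] by simp

lemma LS_sum:
  assumes "\<And>k::nat. a k \<in> carrier_of LS" "f \<in> carrier_of LS"
  shows "(\<lambda>w. f w - (\<Sum>k<n. c k * a k w)) \<in> carrier_of LS"
proof (induction n)
  case (Suc n)
  from LS_diff[OF this LS_cmult[OF assms(1), of "c n" n]] show ?case
    by (simp add: diff_diff_eq)
qed (use assms in simp)

lemma nn_integral_norm_le_qnorm_LS:
  assumes f: "f \<in> carrier_of LS" and k: "qnorm_of LS f < k"
  shows "(\<integral>\<^sup>+w. ennreal (norm (f w)) \<partial>\<mu>)
    \<le> ennreal (((measure \<mu> (space \<mu>) + 1 / \<phi>0 1) + (measure \<mu> (space \<mu>) + 1 / \<phi>1 1)) * k)"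
proof -
  define A B where "A = measure \<mu> (space \<mu>) + 1 / \<phi>0 1" and "B = measure \<mu> (space \<mu>) + 1 / \<phi>1 1"
  have AB: "0 \<le> A" "0 \<le> B"
    using orlicz_pos[OF \<phi>0, of 1] orlicz_pos[OF \<phi>1, of 1] by (auto simp: A_def B_def)
  let ?Q = "{qnorm_of (L \<phi>0) g + qnorm_of (L \<phi>1) h | g h.
      g \<in> carrier_of (L \<phi>0) \<and> h \<in> carrier_of (L \<phi>1) \<and> (AE w in \<mu>. f w = g w + h w)}"
  have ne: "?Q \<noteq> {}" using f by (auto simp: in_LS_iff)
  have "Inf ?Q < k" using k by (simp add: sum_space_def)
  from cInf_lessD[OF ne this] obtain g h where gh: "g \<in> carrier_of (L \<phi>0)" "h \<in> carrier_of (L \<phi>1)" "AE w in \<mu>. f w = g w + h w"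
    "qnorm_of (L \<phi>0) g + qnorm_of (L \<phi>1) h < k" by blast
  note [measurable] = in_L_measurable[OF \<phi>0 gh(1)] in_L_measurable[OF \<phi>1 gh(2)]
  \<comment> \<open>Half of the slack goes to each summand, since the single-space estimate needs a
    scale strictly above the quasi-norm.\<close>
  have "\<exists>e>0. qnorm_of (L \<phi>0) g + e + (qnorm_of (L \<phi>1) h + e) \<le> k"
    using gh(4) by (intro exI[of _ "(k - qnorm_of (L \<phi>0) g - qnorm_of (L \<phi>1) h) / 2"]) (simp add: field_simps)
  then obtain e where e: "e > 0" "qnorm_of (L \<phi>0) g + e + (qnorm_of (L \<phi>1) h + e) \<le> k" by blast
  define a b where "a = qnorm_of (L \<phi>0) g + e" and "b = qnorm_of (L \<phi>1) h + e"
  have ab: "a + b \<le> k" "0 \<le> a" "0 \<le> b"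
    using e qnorm_nonneg[OF \<phi>0 gh(1)] qnorm_nonneg[OF \<phi>1 gh(2)] by (auto simp: a_def b_def)
  have "(\<integral>\<^sup>+w. ennreal (norm (f w)) \<partial>\<mu>) \<le> (\<integral>\<^sup>+w. ennreal (norm (g w)) + ennreal (norm (h w)) \<partial>\<mu>)"
  proof (rule nn_integral_mono_AE)
    show "AE w in \<mu>. ennreal (norm (f w)) \<le> ennreal (norm (g w)) + ennreal (norm (h w))"
      using gh(3) by eventually_elim (simp add: ennreal_plus[symmetric] norm_triangle_ineq ennreal_leI del: ennreal_plus)
  qed
  also have "\<dots> = (\<integral>\<^sup>+w. ennreal (norm (g w)) \<partial>\<mu>) + (\<integral>\<^sup>+w. ennreal (norm (h w)) \<partial>\<mu>)"
    by (rule nn_integral_add) auto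
  also have "\<dots> \<le> ennreal (A * a) + ennreal (B * b)"
    unfolding A_def B_def using e
    by (intro add_mono nn_integral_norm_le_qnorm gh \<phi>0 \<phi>1) (auto simp: a_def b_def)
  also have "\<dots> = ennreal (A * a + B * b)" using AB ab by simp
  also have "\<dots> \<le> ennreal ((A + B) * k)"
  proof (rule ennreal_leI)
    have "A * a + B * b \<le> (A + B) * (a + b)" using AB ab by (simp add: algebra_simps)
    also have "\<dots> \<le> (A + B) * k" using AB ab by (intro mult_left_mono) auto
    finally show "A * a + B * b \<le> (A + B) * k" .
  qed
  finally show ?thesis by (simp add: A_def B_def)
qed

text \<open>Both \<open>L \<phi>0\<close> and \<open>L \<phi>1\<close> are solid, so a function dominated by \<open>max \<bar>u\<bar> \<bar>v\<bar>\<close> splits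
  along \<open>{\<bar>v\<bar> \<le> \<bar>u\<bar>}\<close>.\<close>

lemma dominated_LS:
  assumes u: "u \<in> carrier_of (L \<phi>0)" and v: "v \<in> carrier_of (L \<phi>1)"
    and [measurable]: "f \<in> borel_measurable \<mu>" and le: "\<And>w. norm (f w) \<le> max (norm (u w)) (norm (v w))"
  shows "f \<in> carrier_of LS" "qnorm_of LS f \<le> qnorm_of (L \<phi>0) u + qnorm_of (L \<phi>1) v"
    "qnorm_of LS f \<le> qnorm_of (L \<phi>0) (\<lambda>w. if norm (v w) \<le> norm (u w) then f w else 0)
      + qnorm_of (L \<phi>1) (\<lambda>w. if norm (v w) \<le> norm (u w) then 0 else f w)"
proof -
  note [measurable] = in_L_measurable[OF \<phi>0 u] in_L_measurable[OF \<phi>1 v]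
  let ?g = "\<lambda>w. if norm (v w) \<le> norm (u w) then f w else 0"
  let ?h = "\<lambda>w. if norm (v w) \<le> norm (u w) then 0 else f w"
  have lg: "norm (?g w) \<le> norm (u w)" and lh: "norm (?h w) \<le> norm (v w)" for w
    using le[of w] by (auto simp: max_def split: if_splits)
  have g: "?g \<in> carrier_of (L \<phi>0)" "qnorm_of (L \<phi>0) ?g \<le> qnorm_of (L \<phi>0) u"
    using lg by (intro qnorm_mono[OF \<phi>0 u] AE_I2; measurable)+
  have h: "?h \<in> carrier_of (L \<phi>1)" "qnorm_of (L \<phi>1) ?h \<le> qnorm_of (L \<phi>1) v"
    using lh by (intro qnorm_mono[OF \<phi>1 v] AE_I2; measurable)+
  have fgh: "AE w in \<mu>. f w = ?g w + ?h w" by auto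
  show "f \<in> carrier_of LS" by (rule in_LS_I[OF _ g(1) h(1) fgh]) measurable
  show *: "qnorm_of LS f \<le> qnorm_of (L \<phi>0) ?g + qnorm_of (L \<phi>1) ?h"
    by (rule qnorm_LS_le[OF g(1) h(1) fgh])
  show "qnorm_of LS f \<le> qnorm_of (L \<phi>0) u + qnorm_of (L \<phi>1) v"
    using * g h by linarith
qed

text \<open>The splitting set {|v| \<le> |u|} does not depend on n, so each half is a dominated
  sequence in a single Orlicz space.\<close>

lemma dominated_qnorm_LS:
  assumes D: "Delta2 \<phi>0" "Delta2 \<phi>1"
    and u: "u \<in> carrier_of (L \<phi>0)" and v: "v \<in> carrier_of (L \<phi>1)"
    and [measurable]: "\<And>n. f n \<in> borel_measurable \<mu>"
    and le: "\<And>n w. norm (f n w) \<le> max (norm (u w)) (norm (v w))"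
    and lim: "\<And>w. (\<lambda>n::nat. f n w) \<longlonglongrightarrow> 0"
  shows "(\<lambda>n. qnorm_of LS (f n)) \<longlonglongrightarrow> 0"
proof -
  note [measurable] = in_L_measurable[OF \<phi>0 u] in_L_measurable[OF \<phi>1 v]
  let ?g = "\<lambda>n w. if norm (v w) \<le> norm (u w) then f n w else 0"
  let ?h = "\<lambda>n w. if norm (v w) \<le> norm (u w) then 0 else f n w"
  have "(\<lambda>n. qnorm_of (L \<phi>0) (?g n)) \<longlonglongrightarrow> 0"
  proof (rule dominated_qnorm[OF \<phi>0 D(1) u])
    have "norm (?g n w) \<le> norm (u w)" for n w
      using le[of n w] by (simp add: max_def split: if_splits)
    then show "AE w in \<mu>. norm (?g n w) \<le> norm (u w)" for n by (intro AE_I2)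
    have "(\<lambda>n. ?g n w) \<longlonglongrightarrow> 0" for w using lim[of w] by (cases "norm (v w) \<le> norm (u w)") simp_all
    then show "AE w in \<mu>. (\<lambda>n. ?g n w) \<longlonglongrightarrow> 0" by (intro AE_I2)
  qed measurable
  moreover have "(\<lambda>n. qnorm_of (L \<phi>1) (?h n)) \<longlonglongrightarrow> 0"
  proof (rule dominated_qnorm[OF \<phi>1 D(2) v])
    have "norm (?h n w) \<le> norm (v w)" for n w
      using le[of n w] by (simp add: max_def split: if_splits)
    then show "AE w in \<mu>. norm (?h n w) \<le> norm (v w)" for n by (intro AE_I2)
    have "(\<lambda>n. ?h n w) \<longlonglongrightarrow> 0" for w using lim[of w] by (cases "norm (v w) \<le> norm (u w)") simp_all
    then show "AE w in \<mu>. (\<lambda>n. ?h n w) \<longlonglongrightarrow> 0" by (intro AE_I2)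
  qed measurable
  ultimately have "(\<lambda>n. qnorm_of (L \<phi>0) (?g n) + qnorm_of (L \<phi>1) (?h n)) \<longlonglongrightarrow> 0 + 0"
    by (rule tendsto_add)
  then have lim': "(\<lambda>n. qnorm_of (L \<phi>0) (?g n) + qnorm_of (L \<phi>1) (?h n)) \<longlonglongrightarrow> 0" by simp
  show ?thesis
  proof (rule tendsto_sandwich[OF _ _ tendsto_const lim'])
    show "\<forall>\<^sub>F n in sequentially. 0 \<le> qnorm_of LS (f n)"
      using dominated_LS(1)[OF u v _ le] by (intro always_eventually allI qnorm_LS_nonneg) auto
    show "\<forall>\<^sub>F n in sequentially. qnorm_of LS (f n) \<le> qnorm_of (L \<phi>0) (?g n) + qnorm_of (L \<phi>1) (?h n)"
      using dominated_LS(3)[OF u v _ le] by (intro always_eventually allI) auto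
  qed
qed

end

end

section \<open>Calderon functions\<close>

context semivariation_space
begin

lemma qn_continuous_dominated:
  fixes F :: "real \<Rightarrow> 'w \<Rightarrow> complex"
  assumes \<phi>: "orlicz_function \<phi>" and D: "Delta2 \<phi>" and u: "u \<in> carrier_of (L \<phi>)"
    and [measurable]: "\<And>t. F t \<in> borel_measurable \<mu>" and le: "\<And>t w. norm (F t w) \<le> norm (u w)"
    and lim: "\<And>X t w. X \<longlonglongrightarrow> t \<Longrightarrow> (\<lambda>n::nat. F (X n) w - F t w) \<longlonglongrightarrow> 0"
  shows "qn_continuous_on (L \<phi>) UNIV F"
  unfolding qn_continuous_on_def
proof (intro conjI ballI)
  fix t
  show "F t \<in> carrier_of (L \<phi>)" using le by (intro qnorm_mono(1)[OF \<phi> u]) auto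
  show "((\<lambda>s. qnorm_of (L \<phi>) (\<lambda>w. F s w - F t w)) \<longlongrightarrow> 0) (at t)"
  proof (rule sequentially_imp_tendsto_at_within)
    fix X :: "nat \<Rightarrow> real" assume X: "X \<longlonglongrightarrow> t"
    have "norm (F (X n) w - F t w) \<le> norm (2 * u w)" for n w
      using norm_triangle_ineq4[of "F (X n) w" "F t w"] le[of "X n" w] le[of t w] by (simp add: norm_mult)
    then show "(\<lambda>n. qnorm_of (L \<phi>) (\<lambda>w. F (X n) w - F t w)) \<longlonglongrightarrow> 0"
      using lim[OF X] by (intro dominated_qnorm[OF \<phi> D L_cmult[OF \<phi> u, of 2]]) auto
  qed
qed

context
  fixes \<phi>0 \<phi>1 \<phi> :: "real \<Rightarrow> real" and \<theta> :: real
  assumes \<phi>0: "orlicz_function \<phi>0" and \<phi>1: "orlicz_function \<phi>1" and \<phi>: "orlicz_function \<phi>"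
    and D: "Delta2 \<phi>0" "Delta2 \<phi>1" and \<theta>: "0 < \<theta>" "\<theta> < 1"
    and inv: "\<And>s. 0 \<le> s \<Longrightarrow> inv_into {0..} \<phi> s =
      (inv_into {0..} \<phi>0 s) powr (1 - \<theta>) * (inv_into {0..} \<phi>1 s) powr \<theta>"
begin

text \<open>On the lines Re z = 0 and Re z = 1 the modulus of the Calderon function is at most k a
  and k b, and the modulars of these two functions at the scale k equal that of \<open>f\<close>.
  Hence no constant is lost in this direction.\<close>

lemma interp_function_of_modular:
  assumes [measurable]: "f \<in> borel_measurable \<mu>" and k: "0 < k" and f1: "modular \<phi> f k \<le> 1"
  shows "\<exists>F\<in>interp_functions \<mu> (L \<phi>0) (L \<phi>1). (\<forall>w. F (complex_of_real \<theta>) w = f w) \<and>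
    interp_functions_norm (L \<phi>0) (L \<phi>1) F \<le> k"
proof -
  let ?LS = "sum_space \<mu> (L \<phi>0) (L \<phi>1)"
  define W where "W w = \<phi> (norm (f w) / k)" for w
  define a where "a w = inv_into {0..} \<phi>0 (W w)" for w
  define b where "b w = inv_into {0..} \<phi>1 (W w)" for w
  have Wnn: "0 \<le> W w" for w using k by (auto simp: W_def intro!: orlicz_nonneg[OF \<phi>])
  have [measurable]: "W \<in> borel_measurable \<mu>"
    unfolding W_def[abs_def] by (rule measurable_modular[OF \<phi>]) (use k in auto)
  have [measurable]: "a \<in> borel_measurable \<mu>" "b \<in> borel_measurable \<mu>"
    unfolding a_def[abs_def] b_def[abs_def]
    by (rule measurable_inv_orlicz[OF \<phi>0] measurable_inv_orlicz[OF \<phi>1]; simp add: Wnn)+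
  have ann: "0 \<le> a w" and bnn: "0 \<le> b w" for w
    using inv_orlicz_nonneg[OF \<phi>0 Wnn] inv_orlicz_nonneg[OF \<phi>1 Wnn] by (auto simp: a_def b_def)
  have fk: "norm (f w) / k = a w powr (1 - \<theta>) * b w powr \<theta>" for w
    using inv_orlicz[OF \<phi>, of "norm (f w) / k"] inv[OF Wnn[of w]] k by (simp add: W_def a_def b_def)
  \<comment> \<open>Where \<open>f\<close> does not vanish, neither factor of the geometric mean
    does, so the logarithms in \<open>E\<close> are taken at positive numbers.\<close>
  have ab: "0 < a w" "0 < b w" if "f w \<noteq> 0" for w
  proof -
    have "norm (f w) / k \<noteq> 0" using that k by simp
    then have "a w \<noteq> 0" "b w \<noteq> 0" using fk[of w] by auto
    then show "0 < a w" "0 < b w" using ann[of w] bnn[of w] by auto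
  qed
  define E where "E z w = exp ((1 - z) * complex_of_real (ln (a w)) + z * complex_of_real (ln (b w)))" for z w
  define F where "F z w = (if f w = 0 then 0
     else of_real k * (f w / of_real (norm (f w))) * E z w)" for z w
  have F_meas[measurable]: "F z \<in> borel_measurable \<mu>" for z
    unfolding F_def[abs_def] E_def[abs_def] by measurable
  have normF: "norm (F z w) = k * exp ((1 - Re z) * ln (a w) + Re z * ln (b w))" if "f w \<noteq> 0" for z w
    using that k by (simp add: F_def E_def norm_mult norm_divide)
  have exp_le: "exp ((1 - x) * ln (a w) + x * ln (b w)) \<le> max (a w) (b w)" if "f w \<noteq> 0" "0 \<le> x" "x \<le> 1" for x w
  proof -
    have "exp ((1 - x) * ln (a w) + x * ln (b w)) \<le> exp (max (ln (a w)) (ln (b w)))"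
      using convex_combination_le_max[OF that(2,3)] by simp
    also have "\<dots> = max (a w) (b w)" using ab[OF that(1)] by (simp add: max_def)
    finally show ?thesis .
  qed
  \<comment> \<open>One pair of majorants at several sizes: c = 1 for \<open>F\<close>, c = 2 for
    differences and remainders, c = 1 / r ^ n for the Taylor coefficients.\<close>
  define u where "u c w = complex_of_real (c * k * a w)" for c w
  define v where "v c w = complex_of_real (c * k * b w)" for c w
  have u1: "u 1 \<in> carrier_of (L \<phi>0)" "qnorm_of (L \<phi>0) (u 1) \<le> k"
  proof -
    have "modular \<phi>0 (u 1) k = modular \<phi> f k"
      unfolding modular_def u_def using k ann orlicz_inv[OF \<phi>0 Wnn]
      by (simp add: norm_mult a_def) (simp add: W_def)
    then show "u 1 \<in> carrier_of (L \<phi>0)" "qnorm_of (L \<phi>0) (u 1) \<le> k"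
      using f1 k by (auto intro!: qnorm_le[OF \<phi>0] simp: u_def[abs_def])
  qed
  have v1: "v 1 \<in> carrier_of (L \<phi>1)" "qnorm_of (L \<phi>1) (v 1) \<le> k"
  proof -
    have "modular \<phi>1 (v 1) k = modular \<phi> f k"
      unfolding modular_def v_def using k bnn orlicz_inv[OF \<phi>1 Wnn]
      by (simp add: norm_mult b_def) (simp add: W_def)
    then show "v 1 \<in> carrier_of (L \<phi>1)" "qnorm_of (L \<phi>1) (v 1) \<le> k"
      using f1 k by (auto intro!: qnorm_le[OF \<phi>1] simp: v_def[abs_def])
  qed
  have u: "u c \<in> carrier_of (L \<phi>0)" and v: "v c \<in> carrier_of (L \<phi>1)" for c
    using L_cmult[OF \<phi>0 u1(1), of "of_real c"] L_cmult[OF \<phi>1 v1(1), of "of_real c"]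
    by (simp_all add: u_def[abs_def] v_def[abs_def] mult.assoc)
  have max_uv: "max (norm (u c w)) (norm (v c w)) = c * (k * max (a w) (b w))" if "0 \<le> c" for c w
    using that k ann[of w] bnn[of w]
    by (simp add: u_def v_def norm_mult max_mult_distrib_left mult.assoc)
  have F_le: "norm (F z w) \<le> k * max (a w) (b w)" if "0 \<le> Re z" "Re z \<le> 1" for z w
  proof (cases "f w = 0")
    case True
    then show ?thesis using k ann[of w] by (simp add: F_def max_def)
  next
    case False
    then show ?thesis using exp_le[OF False that] k by (simp add: normF)
  qed
  have F_le': "norm (F z w) \<le> max (norm (u 1 w)) (norm (v 1 w))" if "0 \<le> Re z" "Re z \<le> 1" for z w
    using F_le[OF that] by (simp add: max_uv)
  have F_diff: "norm (F z w - F z' w) \<le> max (norm (u 2 w)) (norm (v 2 w))"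
    if "0 \<le> Re z" "Re z \<le> 1" "0 \<le> Re z'" "Re z' \<le> 1" for z z' w
    using norm_triangle_ineq4[of "F z w" "F z' w"] F_le[OF that(1,2), of w] F_le[OF that(3,4), of w]
    by (simp add: max_uv)
  have F_lim: "(\<lambda>n. F (X n) w - F z w) \<longlonglongrightarrow> 0" if "X \<longlonglongrightarrow> z" for X z w
  proof -
    have "(\<lambda>n. E (X n) w) \<longlonglongrightarrow> E z w" unfolding E_def by (intro tendsto_intros that)
    then have "(\<lambda>n. F (X n) w) \<longlonglongrightarrow> F z w"
      by (cases "f w = 0") (auto simp: F_def intro!: tendsto_intros)
    from tendsto_diff[OF this tendsto_const[of "F z w"]] show ?thesis by simp
  qed
  have F_0: "norm (F (Complex 0 t) w) \<le> norm (u 1 w)" and F_1: "norm (F (Complex 1 t) w) \<le> norm (v 1 w)" for t w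
    using ab[of w] k ann[of w] bnn[of w]
    by (cases "f w = 0"; simp add: normF u_def v_def norm_mult; simp add: F_def)+
  have in0: "F (Complex 0 t) \<in> carrier_of (L \<phi>0)" and q0: "qnorm_of (L \<phi>0) (F (Complex 0 t)) \<le> k" for t
    using qnorm_mono[OF \<phi>0 u1(1) F_meas, of "Complex 0 t"] F_0[of t] u1(2) by auto
  have in1: "F (Complex 1 t) \<in> carrier_of (L \<phi>1)" and q1: "qnorm_of (L \<phi>1) (F (Complex 1 t)) \<le> k" for t
    using qnorm_mono[OF \<phi>1 v1(1) F_meas, of "Complex 1 t"] F_1[of t] v1(2) by auto
  have F_LS: "F z \<in> carrier_of ?LS" "qnorm_of ?LS (F z) \<le> 2 * k" if "0 \<le> Re z" "Re z \<le> 1" for z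
    using dominated_LS(1,2)[OF \<phi>0 \<phi>1 u1(1) v1(1) F_meas F_le'[OF that]] u1(2) v1(2) by auto
  have cont: "qn_continuous_on ?LS (closure unit_strip) F"
    unfolding qn_continuous_on_def
  proof (intro conjI ballI)
    fix z assume "z \<in> closure unit_strip"
    then have z: "0 \<le> Re z" "Re z \<le> 1" using closure_unit_strip by auto
    then show "F z \<in> carrier_of ?LS" by (rule F_LS)
    show "((\<lambda>z'. qnorm_of ?LS (\<lambda>w. F z' w - F z w)) \<longlongrightarrow> 0) (at z within closure unit_strip)"
    proof (rule sequentially_imp_tendsto_at_within)
      fix X :: "nat \<Rightarrow> complex" assume X: "\<And>i. X i \<in> closure unit_strip" "X \<longlonglongrightarrow> z"
      then have X': "0 \<le> Re (X n)" "Re (X n) \<le> 1" for n using closure_unit_strip by auto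
      show "(\<lambda>n. qnorm_of ?LS (\<lambda>w. F (X n) w - F z w)) \<longlonglongrightarrow> 0"
        using F_diff[OF X' z] F_lim[OF X(2)]
        by (intro dominated_qnorm_LS[OF \<phi>0 \<phi>1 D u v]) auto
    qed
  qed
  have cont0: "qn_continuous_on (L \<phi>0) UNIV (\<lambda>t. F (Complex 0 t))"
    by (intro qn_continuous_dominated[OF \<phi>0 D(1) u1(1) F_meas F_0] F_lim tendsto_Complex tendsto_const)
  have cont1: "qn_continuous_on (L \<phi>1) UNIV (\<lambda>t. F (Complex 1 t))"
    by (intro qn_continuous_dominated[OF \<phi>1 D(2) v1(1) F_meas F_1] F_lim tendsto_Complex tendsto_const)
  have analytic: "qn_analytic_on ?LS unit_strip F"
    unfolding qn_analytic_on_def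
  proof (intro conjI ballI)
    fix z0 assume z0: "z0 \<in> unit_strip"
    then show "F z0 \<in> carrier_of ?LS" by (intro F_LS) (auto simp: unit_strip_def)
    define r where "r = min (Re z0) (1 - Re z0)"
    have r: "0 < r" using z0 by (auto simp: r_def unit_strip_def)
    define d where "d w = ln (b w) - ln (a w)" for w
    define A where "A n w = F z0 w * (of_real (d w)) ^ n / fact n" for n :: nat and w
    have [measurable]: "A n \<in> borel_measurable \<mu>" for n
      unfolding A_def[abs_def] d_def[abs_def] by measurable
    \<comment> \<open>Moving the real part of \<open>z0\<close> by \<rho> towards the larger of
      \<open>a\<close> and \<open>b\<close> multiplies the modulus of \<open>F\<close> by exp
      (\<rho> |d|). The moved point is still in the closed strip, so the exponential growth is
      absorbed by the maximum of \<open>a\<close> and \<open>b\<close>.\<close>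
    have key: "norm (F z0 w) * exp (\<rho> * \<bar>d w\<bar>) \<le> k * max (a w) (b w)" if \<rho>: "0 \<le> \<rho>" "\<rho> \<le> r" for \<rho> w
    proof (cases "f w = 0")
      case True
      then show ?thesis using k ann[of w] by (simp add: F_def max_def)
    next
      case False
      define x where "x = Re z0 + (if 0 \<le> d w then \<rho> else - \<rho>)"
      have x: "0 \<le> x" "x \<le> 1" using \<rho> by (auto simp: x_def r_def)
      have "norm (F z0 w) * exp (\<rho> * \<bar>d w\<bar>) = k * exp ((1 - x) * ln (a w) + x * ln (b w))"
        by (simp add: normF[OF False] mult.assoc exp_add[symmetric])
           (simp add: x_def d_def algebra_simps abs_if)
      also have "\<dots> \<le> k * max (a w) (b w)" using k exp_le[OF False x] by simp
      finally show ?thesis .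
    qed
    show "\<exists>r>0. \<exists>a::nat \<Rightarrow> 'w \<Rightarrow> complex. ball z0 r \<subseteq> unit_strip \<and> (\<forall>n. a n \<in> carrier_of ?LS) \<and>
        (\<forall>z \<in> ball z0 r. (\<lambda>n. qnorm_of ?LS (\<lambda>w. F z w - (\<Sum>k<n. (z - z0) ^ k * a k w))) \<longlonglongrightarrow> 0)"
    proof (intro exI[of _ r] exI[of _ A] conjI allI ballI r)
      show "ball z0 r \<subseteq> unit_strip"
      proof
        fix z assume "z \<in> ball z0 r"
        then have "\<bar>Re (z - z0)\<bar> < r"
          using abs_Re_le_cmod[of "z - z0"] by (simp add: dist_norm norm_minus_commute)
        then show "z \<in> unit_strip" by (auto simp: unit_strip_def r_def)
      qed
    next
      fix n
      have "norm (A n w) \<le> max (norm (u (1 / r ^ n) w)) (norm (v (1 / r ^ n) w))" for w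
      proof -
        have "r ^ n * norm (A n w) = norm (F z0 w) * ((r * \<bar>d w\<bar>) ^ n / fact n)"
          by (simp add: A_def norm_mult norm_divide norm_power power_mult_distrib)
        also have "\<dots> \<le> norm (F z0 w) * exp (r * \<bar>d w\<bar>)"
          using r by (intro mult_left_mono power_over_fact_le_exp) auto
        also have "\<dots> \<le> k * max (a w) (b w)" using r by (intro key) auto
        finally show ?thesis using r by (simp add: max_uv field_simps)
      qed
      then show "A n \<in> carrier_of ?LS" by (intro dominated_LS(1)[OF \<phi>0 \<phi>1 u v]) auto
    next
      fix z assume "z \<in> ball z0 r"
      then have z: "norm (z - z0) < r" by (simp add: dist_norm norm_minus_commute)
      define h where "h w = (z - z0) * of_real (d w)" for w
      have FE: "F z w = F z0 w * exp (h w)" for w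
        by (simp add: F_def E_def h_def d_def exp_add[symmetric] algebra_simps)
      have part: "F z w - (\<Sum>k<n. (z - z0) ^ k * A k w) = F z0 w * (exp (h w) - (\<Sum>k<n. h w ^ k / fact k))" for n w
        by (simp add: FE A_def h_def right_diff_distrib sum_distrib_left power_mult_distrib mult_ac)
      show "(\<lambda>n. qnorm_of ?LS (\<lambda>w. F z w - (\<Sum>k<n. (z - z0) ^ k * A k w))) \<longlonglongrightarrow> 0"
      proof (rule dominated_qnorm_LS[OF \<phi>0 \<phi>1 D u v])
        show "norm (F z w - (\<Sum>k<n. (z - z0) ^ k * A k w)) \<le> max (norm (u 2 w)) (norm (v 2 w))" for n w
        proof -
          have "norm (exp (h w) - (\<Sum>k<n. h w ^ k / fact k)) \<le> exp (norm (h w)) + exp (norm (h w))"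
            by (intro order_trans[OF norm_triangle_ineq4] add_mono norm_exp norm_exp_partial_le)
          then have "norm (F z w - (\<Sum>k<n. (z - z0) ^ k * A k w)) \<le> norm (F z0 w) * (2 * exp (norm (h w)))"
            unfolding part norm_mult by (intro mult_left_mono) auto
          also have "\<dots> = 2 * (norm (F z0 w) * exp (norm (z - z0) * \<bar>d w\<bar>))"
            by (simp add: h_def norm_mult)
          also have "\<dots> \<le> 2 * (k * max (a w) (b w))" using z by (intro mult_left_mono key) auto
          finally show ?thesis by (simp add: max_uv)
        qed
        show "(\<lambda>n. F z w - (\<Sum>k<n. (z - z0) ^ k * A k w)) \<longlonglongrightarrow> 0" for w
        proof -
          have "(\<lambda>n. F z0 w * (exp (h w) - (\<Sum>k<n. h w ^ k / fact k))) \<longlonglongrightarrow> F z0 w * (exp (h w) - exp (h w))"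
            using exp_sums_complex[of "h w"] by (intro tendsto_intros) (simp add: sums_def)
          then show ?thesis by (simp add: part)
        qed
      qed measurable
    qed
  qed
  have "F \<in> interp_functions \<mu> (L \<phi>0) (L \<phi>1)"
    unfolding interp_functions_def qn_bounded_on_def
    using F_LS in0 in1 q0 q1 analytic cont cont0 cont1
    by (auto simp: unit_strip_def intro: less_imp_le)
  moreover have "F (complex_of_real \<theta>) w = f w" for w
  proof (cases "f w = 0")
    case False
    have "E (complex_of_real \<theta>) w = of_real (exp ((1 - \<theta>) * ln (a w) + \<theta> * ln (b w)))"
      by (simp add: E_def exp_of_real[symmetric])
    also have "exp ((1 - \<theta>) * ln (a w) + \<theta> * ln (b w)) = norm (f w) / k"
      using ab[OF False] by (simp add: fk powr_def exp_add)
    finally show ?thesis using False k by (simp add: F_def)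
  qed (simp add: F_def)
  moreover have "interp_functions_norm (L \<phi>0) (L \<phi>1) F \<le> k"
    unfolding interp_functions_norm_def using q0 q1 by (auto intro!: cSUP_least)
  ultimately show ?thesis by blast
qed

end

end

section \<open>Subharmonicity of the square root of the modulus\<close>

text \<open>Cauchy's formula at the centre. Holomorphy is asked only inside the circle: the square
  roots to which this is applied are merely continuous at a zero lying on it.\<close>

lemma norm_centre_le_circle_mean:
  fixes S :: "complex \<Rightarrow> complex"
  assumes "continuous_on (cball 0 r) S" "S holomorphic_on ball 0 r" "0 < r"
  shows "ennreal (norm (S 0)) \<le> (\<integral>\<^sup>+x\<in>{0..1}. ennreal (norm (S (of_real r * cis (2 * pi * x)))) \<partial>lborel)"
proof -
  let ?u = "\<lambda>x. S (of_real r * cis (2 * pi * x))"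
  have "((\<lambda>u. S u / (u - 0)) has_contour_integral (2 * of_real pi * \<i> * S 0)) (circlepath 0 r)"
    using Cauchy_integral_circlepath[of 0 r S 0] assms by auto
  then have "((\<lambda>x. S (circlepath 0 r x) / circlepath 0 r x *
      vector_derivative (circlepath 0 r) (at x within {0..1})) has_integral (2 * of_real pi * \<i> * S 0)) {0..1}"
    by (simp add: has_contour_integral_def)
  then have "((\<lambda>x. 2 * of_real pi * \<i> * ?u x) has_integral (2 * of_real pi * \<i> * S 0)) {0..1}"
  proof (rule has_integral_eq[rotated])
    fix x :: real assume x: "x \<in> {0..1}"
    have c: "circlepath 0 r x = of_real r * cis (2 * pi * x)"
      by (simp add: circlepath cis_conv_exp mult_ac)
    show "S (circlepath 0 r x) / circlepath 0 r x *
      vector_derivative (circlepath 0 r) (at x within {0..1}) = 2 * of_real pi * \<i> * ?u x"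
      using x assms by (simp add: vector_derivative_circlepath01 c) (simp add: cis_conv_exp mult_ac)
  qed
  from has_integral_mult_right[OF this, of "1 / (2 * of_real pi * \<i>)"]
  have I: "(?u has_integral S 0) {0..1}" by simp
  have cont: "continuous_on {0..1} ?u"
    by (intro continuous_on_compose2[OF assms(1)] continuous_intros)
       (use assms in \<open>auto simp: norm_mult\<close>)
  then have "(\<lambda>x. norm (?u x)) integrable_on {0..1}"
    by (intro integrable_continuous_real continuous_intros)
  then obtain J where J: "((\<lambda>x. norm (?u x)) has_integral J) {0..1}" by blast
  have "norm (S 0) \<le> J"
    using integral_norm_bound_integral[OF has_integral_integrable[OF I] has_integral_integrable[OF J]]
    by (simp add: integral_unique[OF I] integral_unique[OF J])
  moreover have "(\<integral>\<^sup>+x\<in>{0..1}. ennreal (norm (?u x)) \<partial>lborel) = ennreal J"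
    using nn_integral_has_integral_lebesgue'[OF _ J] by simp
  ultimately show ?thesis by (simp add: ennreal_leI)
qed

text \<open>Away from 0 the closed half-plane avoids the cut; at 0 continuity follows from |csqrt z|
  = sqrt |z|.\<close>

lemma continuous_on_csqrt_halfplane: "continuous_on {z. 0 \<le> Re z} csqrt"
  unfolding continuous_on_def
proof
  fix z :: complex assume z: "z \<in> {z. 0 \<le> Re z}"
  show "(csqrt \<longlongrightarrow> csqrt z) (at z within {z. 0 \<le> Re z})"
  proof (cases "z = 0")
    case False
    with z have "z \<notin> \<real>\<^sub>\<le>\<^sub>0"
      by (auto simp: complex_nonpos_Reals_iff complex_eq_iff)
    then show ?thesis
      using continuous_within continuous_at_imp_continuous_at_within isCont_def
        continuous_within_csqrt by blast
  next
    case True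
    have "((\<lambda>x::complex. sqrt (norm x)) \<longlongrightarrow> sqrt (norm (0::complex))) (at 0 within {z. 0 \<le> Re z})"
      by (intro tendsto_intros)
    then have "((\<lambda>x. norm (csqrt x)) \<longlongrightarrow> 0) (at 0 within {z. 0 \<le> Re z})"
      by simp
    then have "(csqrt \<longlongrightarrow> 0) (at 0 within {z. 0 \<le> Re z})"
      by (rule tendsto_norm_zero_cancel)
    then show ?thesis using True by simp
  qed
qed

text \<open>Reflecting a root inside the circle to the outside keeps the modulus on the circle and does not
  decrease it at the centre.  The new factor is a constant times \<open>1 - k z\<close> with \<open>r \<bar>k\<bar> \<le> 1\<close>, so the principal
  square root is continuous up to the circle.\<close>

lemma linear_factor_sqrt:
  fixes a :: complex
  assumes r: "0 < r"
  obtains T where "continuous_on (cball 0 r) T" "T holomorphic_on ball 0 r"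
    "\<And>z. norm z = r \<Longrightarrow> norm (T z) = sqrt (norm (z - a))" "norm (T 0) \<ge> sqrt (norm (0 - a))"
proof -
  define k where "k = (if norm a \<ge> r then 1 / a else cnj a / of_real (r ^ 2))"
  \<comment> \<open>The prefactor is |a| for a root outside or on the circle, where the factor is
    unchanged in modulus, and r for a reflected root, where r > |a| gives the gain at the
    centre.\<close>
  define T where "T z = of_real (sqrt (max r (norm a))) * csqrt (1 - k * z)" for z :: complex
  have k: "r * norm k \<le> 1"
  proof (cases "norm a \<ge> r")
    case True
    then have "norm a > 0" using r by linarith
    then show ?thesis using True by (simp add: k_def norm_divide)
  next
    case False
    have "r * norm k = norm a / r"
      using r False by (simp add: k_def norm_divide norm_mult power2_eq_square)
    then show ?thesis using False r by simp
  qed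
  have kz: "norm (k * z) \<le> norm z / r" for z :: complex
  proof -
    have "norm k * norm z \<le> (1 / r) * norm z"
      using k r by (intro mult_right_mono) (auto simp: field_simps)
    then show ?thesis by (simp add: norm_mult)
  qed
  have Re1: "Re (1 - k * z) \<ge> 0" if "norm z \<le> r" for z :: complex
  proof -
    have "Re (k * z) \<le> norm (k * z)" by (rule complex_Re_le_cmod)
    also have "\<dots> \<le> norm z / r" by (rule kz)
    also have "\<dots> \<le> 1" using that r by simp
    finally show ?thesis by simp
  qed
  have Re2: "Re (1 - k * z) > 0" if "norm z < r" for z :: complex
  proof -
    have "Re (k * z) \<le> norm (k * z)" by (rule complex_Re_le_cmod)
    also have "\<dots> \<le> norm z / r" by (rule kz)
    also have "\<dots> < 1" using that r by simp
    finally show ?thesis by simp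
  qed
  show thesis
  proof
    show "continuous_on (cball 0 r) T" unfolding T_def
      by (intro continuous_intros continuous_on_compose2[OF continuous_on_csqrt_halfplane])
         (use Re1 in auto)
    show "T holomorphic_on ball 0 r" unfolding T_def
    proof (intro holomorphic_intros)
      fix z :: complex assume "z \<in> ball 0 r"
      then have "Re (1 - k * z) > 0" using Re2 by simp
      then show "1 - k * z \<notin> \<real>\<^sub>\<le>\<^sub>0" by (simp add: complex_nonpos_Reals_iff)
    qed
    have nT: "norm (T z) = sqrt (max r (norm a) * norm (1 - k * z))" for z :: complex
      using r by (simp add: T_def norm_mult real_sqrt_mult)
    show "norm (T 0) \<ge> sqrt (norm (0 - a))"
      by (simp add: nT)
    fix z :: complex assume z: "norm z = r"
    have "max r (norm a) * norm (1 - k * z) = norm (z - a)"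
    proof (cases "norm a \<ge> r")
      case True
      then have "a \<noteq> 0" using r by auto
      then have "norm a * norm (1 - k * z) = norm (a - z)"
        using True by (simp add: k_def norm_mult[symmetric] right_diff_distrib)
      then show ?thesis using True by (simp add: max_def norm_minus_commute)
    next
      case False
      have zz: "of_real (r^2) = z * cnj z" using z complex_norm_square[of z] by simp
      have "z \<noteq> 0" using z r by auto
      have "1 - k * z = cnj (z - a) / cnj z"
        using False \<open>z \<noteq> 0\<close> unfolding k_def zz by (simp add: field_simps)
      then have "norm (1 - k * z) = norm (z - a) / r"
        using z by (metis complex_mod_cnj norm_divide)
      then show ?thesis using False r by (simp add: max_def)
    qed
    then show "norm (T z) = sqrt (norm (z - a))" by (simp add: nT)
  qed
qed

text \<open>The product of the modified square roots from \<open>linear_factor_sqrt\<close>, one for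
  each root and times a constant, is holomorphic inside, has modulus sqrt |P| on the circle and at
  least sqrt |P| at the centre. The mean value inequality for this product gives the claim.\<close>

lemma sqrt_norm_poly_le_circle_mean:
  fixes P :: "complex poly"
  assumes r: "0 < r"
  shows "ennreal (sqrt (norm (poly P 0)))
    \<le> (\<integral>\<^sup>+x\<in>{0..1}. ennreal (sqrt (norm (poly P (of_real r * cis (2 * pi * x))))) \<partial>lborel)"
proof (cases "P = 0")
  case False
  then obtain A where A: "P = smult (lead_coeff P) (\<Prod>x\<in>#A. [:- x, 1:])"
    using alg_closed_imp_factorization[OF False] by auto
  have *: "\<exists>T. continuous_on (cball 0 r) T \<and> T holomorphic_on ball 0 r \<and>
    (\<forall>z. norm z = r \<longrightarrow> norm (T z) = sqrt (norm (poly (\<Prod>x\<in>#A. [:- x, 1:]) z))) \<and>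
    norm (T 0) \<ge> sqrt (norm (poly (\<Prod>x\<in>#A. [:- x, 1:]) 0))"
  proof (induction A)
    case empty
    show ?case by (rule exI[of _ "\<lambda>_. 1"]) auto
  next
    case (add a A)
    then obtain T where T: "continuous_on (cball 0 r) T" "T holomorphic_on ball 0 r"
      "\<And>z. norm z = r \<Longrightarrow> norm (T z) = sqrt (norm (poly (\<Prod>x\<in>#A. [:- x, 1:]) z))"
      "norm (T 0) \<ge> sqrt (norm (poly (\<Prod>x\<in>#A. [:- x, 1:]) 0))" by blast
    obtain T' where T': "continuous_on (cball 0 r) T'" "T' holomorphic_on ball 0 r"
    "\<And>z. norm z = r \<Longrightarrow> norm (T' z) = sqrt (norm (z - a))" "norm (T' 0) \<ge> sqrt (norm (0 - a))"
      using linear_factor_sqrt[OF r] by metis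
    have e: "norm (poly (\<Prod>x\<in>#add_mset a A. [:- x, 1:]) z)
       = norm (z - a) * norm (poly (\<Prod>x\<in>#A. [:- x, 1:]) z)" for z
      by (simp add: norm_mult[symmetric] algebra_simps)
    show ?case
    proof (intro exI[of _ "\<lambda>z. T' z * T z"] conjI allI impI)
      show "sqrt (norm (poly (\<Prod>x\<in>#add_mset a A. [:- x, 1:]) 0)) \<le> norm (T' 0 * T 0)"
        unfolding e real_sqrt_mult norm_mult using T(4) T'(4) by (intro mult_mono) auto
    qed (use T(1-3) T'(1-3) in \<open>auto intro!: continuous_intros holomorphic_intros
         simp: e real_sqrt_mult norm_mult simp del: poly_prod_mset prod_mset.insert image_mset_add_mset\<close>)
  qed
  then obtain T where T: "continuous_on (cball 0 r) T" "T holomorphic_on ball 0 r"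
      "\<And>z. norm z = r \<Longrightarrow> norm (T z) = sqrt (norm (poly (\<Prod>x\<in>#A. [:- x, 1:]) z))"
      "norm (T 0) \<ge> sqrt (norm (poly (\<Prod>x\<in>#A. [:- x, 1:]) 0))" by blast
  define c where "c = lead_coeff P"
  have P: "poly P z = c * poly (\<Prod>x\<in>#A. [:- x, 1:]) z" for z
    by (subst A) (simp add: c_def)
  define S where "S z = of_real (sqrt (norm c)) * T z" for z
  have "ennreal (norm (S 0)) \<le> (\<integral>\<^sup>+x\<in>{0..1}. ennreal (norm (S (of_real r * cis (2 * pi * x)))) \<partial>lborel)"
    by (rule norm_centre_le_circle_mean)
       (auto simp: S_def intro!: continuous_intros holomorphic_intros T r)
  moreover have "norm (S (of_real r * cis (2 * pi * x))) = sqrt (norm (poly P (of_real r * cis (2 * pi * x))))" for x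
    using r by (simp add: S_def P norm_mult T(3) real_sqrt_mult)
  moreover have "sqrt (norm (poly P 0)) \<le> norm (S 0)"
    unfolding P using T(4) by (simp add: S_def norm_mult real_sqrt_mult mult_left_mono)
  ultimately show ?thesis
    using order_trans[OF ennreal_leI] by auto
qed auto

text \<open>Taylor polynomials have finitely many factors. On the circle of radius \<open>r\<close>
  they are bounded by the sum of |a n| r^n, so dominated convergence carries the inequality over to
  \<open>g\<close>.\<close>

lemma sqrt_norm_le_circle_mean:
  fixes g :: "complex \<Rightarrow> complex"
  assumes g: "g holomorphic_on ball 0 1" and r: "0 < r" "r < 1"
  shows "ennreal (sqrt (norm (g 0)))
    \<le> (\<integral>\<^sup>+x\<in>{0..1}. ennreal (sqrt (norm (g (of_real r * cis (2 * pi * x))))) \<partial>lborel)"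
proof -
  define a where "a n = (deriv ^^ n) g 0 / fact n" for n
  define P where "P n = (\<Sum>k<n. monom (a k) k)" for n
  have sums: "(\<lambda>n. a n * z ^ n) sums g z" if "norm z < 1" for z
    using holomorphic_power_series[OF g, of z] that by (simp add: a_def)
  have PP: "poly (P n) z = (\<Sum>k<n. a k * z ^ k)" for n z
    by (simp add: P_def poly_sum poly_monom)
  have lim: "(\<lambda>n. poly (P n) z) \<longlonglongrightarrow> g z" if "norm z < 1" for z
    using sums[OF that] by (simp add: PP sums_def)
  have summ: "summable (\<lambda>n. norm (a n) * r ^ n)"
  proof -
    obtain r' where r': "r < r'" "r' < 1" using dense r by blast
    have "summable (\<lambda>n. a n * of_real r' ^ n)" using sums[of "of_real r'"] r r' by (simp add: sums_iff)
    from powser_insidea[OF this, of "of_real r"] show ?thesis using r r'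
      by (simp add: norm_mult norm_power)
  qed
  define B where "B = (\<Sum>n. norm (a n) * r ^ n)"
  have bound: "norm (poly (P n) z) \<le> B" if "norm z = r" for n z
  proof -
    have "norm (poly (P n) z) \<le> (\<Sum>k<n. norm (a k) * r ^ k)"
      unfolding PP by (rule order_trans[OF norm_sum]) (simp add: norm_mult norm_power that)
    also have "\<dots> \<le> B" unfolding B_def using summ r by (intro sum_le_suminf) auto
    finally show ?thesis .
  qed
  let ?z = "\<lambda>x. of_real r * cis (2 * pi * x) :: complex"
  have [measurable]: "?z \<in> borel_measurable borel"
    by (intro borel_measurable_continuous_onI continuous_intros)
  have mp[measurable]: "(\<lambda>x. poly (P n) (?z x)) \<in> borel_measurable borel" for n
    by (intro borel_measurable_continuous_onI continuous_intros)
  have L: "(\<lambda>n. \<integral>\<^sup>+x. ennreal (sqrt (norm (poly (P n) (?z x)))) * indicator {0..1} x \<partial>lborel)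
     \<longlonglongrightarrow> (\<integral>\<^sup>+x. ennreal (sqrt (norm (g (?z x)))) * indicator {0..1} x \<partial>lborel)"
  proof (rule nn_integral_dominated_convergence[where w = "\<lambda>x. ennreal (sqrt B) * indicator {0..1} x"])
    have [measurable]: "(\<lambda>x. g (?z x)) \<in> borel_measurable borel"
      by (rule borel_measurable_LIMSEQ_metric[OF mp]) (use r in \<open>auto intro!: lim simp: norm_mult\<close>)
    show "(\<lambda>x. ennreal (sqrt (norm (g (?z x)))) * indicator {0..1} x) \<in> borel_measurable lborel"
      by measurable
    show "AE x in lborel. ennreal (sqrt (norm (poly (P n) (?z x)))) * indicator {0..1} x
        \<le> ennreal (sqrt B) * indicator {0..1} x" for n
      using r by (intro AE_I2 mult_right_mono ennreal_leI) (auto intro!: bound simp: norm_mult)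
    show "(\<integral>\<^sup>+x. ennreal (sqrt B) * indicator {0..1::real} x \<partial>lborel) < \<infinity>"
      by (simp add: nn_integral_cmult ennreal_mult_less_top)
    show "AE x in lborel. (\<lambda>n. ennreal (sqrt (norm (poly (P n) (?z x)))) * indicator {0..1} x)
       \<longlonglongrightarrow> ennreal (sqrt (norm (g (?z x)))) * indicator {0..1} x"
    proof (rule AE_I2)
      fix x
      have "(\<lambda>n. ennreal (sqrt (norm (poly (P n) (?z x))))) \<longlonglongrightarrow> ennreal (sqrt (norm (g (?z x))))"
        using r by (intro tendsto_ennrealI tendsto_intros lim) (auto simp: norm_mult)
      then show "(\<lambda>n. ennreal (sqrt (norm (poly (P n) (?z x)))) * indicator {0..1} x)
       \<longlonglongrightarrow> ennreal (sqrt (norm (g (?z x)))) * indicator {0..1} x"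
        by (auto simp: indicator_def)
    qed
  qed measurable
  have L0: "(\<lambda>n. ennreal (sqrt (norm (poly (P n) 0)))) \<longlonglongrightarrow> ennreal (sqrt (norm (g 0)))"
    by (intro tendsto_ennrealI tendsto_intros lim) auto
  show ?thesis
    by (rule LIMSEQ_le[OF L0 L]) (use sqrt_norm_poly_le_circle_mean[OF r(1)] in auto)
qed

section \<open>From the disc to the strip\<close>

text \<open>A conformal map of the unit disc onto the strip with \<open>0 \<mapsto> \<theta>\<close>: the Moebius map
  \<open>z \<mapsto> (a - cnj a z) / (1 - z)\<close> with \<open>a = cis (\<pi>\<theta>)\<close> takes the disc to the upper half-plane and \<open>0\<close> to \<open>a\<close>.
  The factor \<open>-\<i>\<close> keeps the principal logarithm away from its cut, also on the boundary.\<close>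

definition half_plane_map :: "real \<Rightarrow> complex \<Rightarrow> complex" where
  "half_plane_map \<theta> z = - \<i> * ((cis (pi * \<theta>) - cnj (cis (pi * \<theta>)) * z) / (1 - z))"

definition disc_to_strip :: "real \<Rightarrow> complex \<Rightarrow> complex" where
  "disc_to_strip \<theta> z = 1 / 2 + Ln (half_plane_map \<theta> z) / (\<i> * of_real pi)"

text \<open>A multiple of the Poisson kernel with pole at 1: positive in the disc and zero on the
  circle.\<close>

lemma Re_half_plane_map:
  "Re (half_plane_map \<theta> z) = sin (pi * \<theta>) * (1 - (norm z)\<^sup>2) / (norm (1 - z))\<^sup>2"
proof -
  let ?N = "cis (pi * \<theta>) - cnj (cis (pi * \<theta>)) * z"
  have "half_plane_map \<theta> z = (- \<i> * (?N * cnj (1 - z))) / of_real ((norm (1 - z))\<^sup>2)"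
    unfolding half_plane_map_def by (subst complex_div_cnj) simp
  moreover have "Re (- \<i> * W / of_real s) = Im W / s" for W s
    by (simp add: Re_divide_of_real)
  ultimately have "Re (half_plane_map \<theta> z) = Im (?N * cnj (1 - z)) / (norm (1 - z))\<^sup>2"
    by metis
  also have "Im (?N * cnj (1 - z)) = sin (pi * \<theta>) * (1 - (norm z)\<^sup>2)"
    unfolding cmod_power2 by (simp add: power2_eq_square algebra_simps)
  finally show ?thesis .
qed

context
  fixes \<theta> :: real assumes \<theta>: "0 < \<theta>" "\<theta> < 1"
begin

lemma sin_pi_theta_pos: "0 < sin (pi * \<theta>)"
  using \<theta> by (intro sin_gt_zero) auto

lemma Re_disc_to_strip: "Re (disc_to_strip \<theta> z) = 1 / 2 + Im (Ln (half_plane_map \<theta> z)) / pi"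
proof -
  have "w / (\<i> * of_real pi) = - \<i> * w / of_real pi" for w :: complex
    by (simp add: field_simps)
  then show ?thesis by (simp add: disc_to_strip_def Re_divide_of_real del: Re_divide_of_real)
qed

lemma half_plane_map_disc: "norm z < 1 \<Longrightarrow> 0 < Re (half_plane_map \<theta> z)"
proof -
  assume z: "norm z < 1"
  then have "1 - z \<noteq> 0" by auto
  moreover have "(norm z)\<^sup>2 < 1" using z by (simp add: power_less_one_iff abs_square_less_1)
  ultimately show ?thesis
    unfolding Re_half_plane_map using sin_pi_theta_pos by (intro divide_pos_pos mult_pos_pos) auto
qed

lemma disc_to_strip_in_strip: "norm z < 1 \<Longrightarrow> disc_to_strip \<theta> z \<in> unit_strip"
proof -
  assume "norm z < 1"
  then have "\<bar>Im (Ln (half_plane_map \<theta> z))\<bar> < pi / 2"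
    by (intro Re_Ln_pos_lt_imp half_plane_map_disc)
  then show ?thesis
    unfolding unit_strip_def mem_Collect_eq Re_disc_to_strip
    by (auto simp: field_simps abs_less_iff)
qed

lemma disc_to_strip_holomorphic: "disc_to_strip \<theta> holomorphic_on ball 0 1"
  unfolding disc_to_strip_def[abs_def]
proof (intro holomorphic_intros)
  fix z :: complex assume "z \<in> ball 0 1"
  then have "0 < Re (half_plane_map \<theta> z)" by (intro half_plane_map_disc) simp
  then show "half_plane_map \<theta> z \<notin> \<real>\<^sub>\<le>\<^sub>0" by (auto simp: complex_nonpos_Reals_iff)
next
  show "half_plane_map \<theta> holomorphic_on ball 0 1"
    unfolding half_plane_map_def[abs_def] by (intro holomorphic_intros) auto
qed auto

lemma disc_to_strip_0: "disc_to_strip \<theta> 0 = of_real \<theta>"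
proof -
  have "half_plane_map \<theta> 0 = cis (pi * \<theta> - pi / 2)"
    by (simp add: half_plane_map_def complex_eq_iff cos_diff sin_diff)
  also have "\<dots> = exp (\<i> * of_real (pi * \<theta> - pi / 2))" by (simp add: cis_conv_exp)
  finally have *: "half_plane_map \<theta> 0 = exp (\<i> * of_real (pi * \<theta> - pi / 2))" .
  have "0 < pi * \<theta>" "pi * \<theta> < pi" using \<theta> by auto
  then have c: "- pi < pi * \<theta> - pi / 2" "pi * \<theta> - pi / 2 \<le> pi" using pi_gt_zero by linarith+
  have "Im (\<i> * of_real (pi * \<theta> - pi / 2)) = pi * \<theta> - pi / 2"
    by (simp del: of_real_diff of_real_mult)
  then have "Ln (half_plane_map \<theta> 0) = \<i> * of_real (pi * \<theta> - pi / 2)"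
    unfolding * using c by (intro Ln_exp) simp_all
  then show ?thesis by (simp add: disc_to_strip_def field_simps)
qed

text \<open>Numerator and denominator of the Moebius map both carry the factor cis (\<pi> x), which
  cancels and leaves a quotient of sines. Its sign, that of sin (\<pi> (\<theta> - x)), decides
  which line the boundary point reaches.\<close>

lemma half_plane_map_circle:
  assumes x: "0 < x" "x < 1"
  shows "Re (half_plane_map \<theta> (cis (2 * pi * x))) = 0"
    "Im (half_plane_map \<theta> (cis (2 * pi * x))) = sin (pi * (\<theta> - x)) / sin (pi * x)"
proof -
  show "Re (half_plane_map \<theta> (cis (2 * pi * x))) = 0" by (simp add: Re_half_plane_map)
  have s: "sin (pi * x) > 0" using x by (intro sin_gt_zero) auto
  have sq: "cis (2 * pi * x) = cis (pi * x) * cis (pi * x)" by (simp add: cis_mult algebra_simps)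
  have 1: "1 - cis (2 * pi * x) = cis (pi * x) * (- 2 * \<i> * of_real (sin (pi * x)))"
    unfolding sq using sin_cos_squared_add[of "pi * x"]
    by (simp add: complex_eq_iff power2_eq_square)
  have 2: "cis (pi * \<theta>) - cnj (cis (pi * \<theta>)) * cis (2 * pi * x)
     = cis (pi * x) * (2 * \<i> * of_real (sin (pi * (\<theta> - x))))"
  proof -
    have "cis (pi * \<theta>) = cis (pi * x) * cis (pi * (\<theta> - x))"
      by (simp add: cis_mult algebra_simps)
    moreover have "cnj (cis (pi * \<theta>)) * cis (2 * pi * x) = cis (pi * x) * cis (- (pi * (\<theta> - x)))"
      by (simp add: cis_mult cis_cnj algebra_simps)
    ultimately have "cis (pi * \<theta>) - cnj (cis (pi * \<theta>)) * cis (2 * pi * x)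
       = cis (pi * x) * (cis (pi * (\<theta> - x)) - cis (- (pi * (\<theta> - x))))"
      by (simp add: right_diff_distrib)
    also have "cis (pi * (\<theta> - x)) - cis (- (pi * (\<theta> - x))) = 2 * \<i> * of_real (sin (pi * (\<theta> - x)))"
      by (simp add: complex_eq_iff)
    finally show ?thesis .
  qed
  have "half_plane_map \<theta> (cis (2 * pi * x)) = \<i> * of_real (sin (pi * (\<theta> - x)) / sin (pi * x))"
    unfolding half_plane_map_def 1 2 using s by (simp add: field_simps)
  then show "Im (half_plane_map \<theta> (cis (2 * pi * x))) = sin (pi * (\<theta> - x)) / sin (pi * x)" by simp
qed

text \<open>The positive half of the imaginary axis goes to Re z = 1, the negative half to Re z = 0.
  Thus the two lines receive arcs of relative length \<theta> and 1 - \<theta>, their harmonic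
  measures seen from \<theta>. The excluded angles correspond to the two ends of the strip.\<close>

lemma disc_to_strip_circle:
  assumes x: "0 < x" "x < 1" "x \<noteq> \<theta>"
  shows "isCont (disc_to_strip \<theta>) (cis (2 * pi * x))"
    "Re (disc_to_strip \<theta> (cis (2 * pi * x))) = (if x < \<theta> then 1 else 0)"
proof -
  let ?z = "cis (2 * pi * x)" and ?q = "half_plane_map \<theta> (cis (2 * pi * x))"
  have s: "sin (pi * x) > 0" using x by (intro sin_gt_zero) auto
  have sgn: "0 < Im ?q" if "x < \<theta>"
  proof -
    have "0 < sin (pi * (\<theta> - x))" using that x \<theta> by (intro sin_gt_zero) auto
    then show ?thesis using half_plane_map_circle(2)[OF x(1,2)] s by simp
  qed
  have sgn': "Im ?q < 0" if "\<theta> < x"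
  proof -
    have "0 < sin (pi * (x - \<theta>))" using that x \<theta> by (intro sin_gt_zero) auto
    also have "sin (pi * (x - \<theta>)) = - sin (pi * (\<theta> - x))"
      using sin_minus[of "pi * (\<theta> - x)"] by (simp add: algebra_simps)
    finally show ?thesis using half_plane_map_circle(2)[OF x(1,2)] s by (simp add: divide_neg_pos)
  qed
  have Im: "Im ?q \<noteq> 0" using sgn sgn' x(3) by (cases "x < \<theta>") auto
  then have q: "?q \<noteq> 0" "?q \<notin> \<real>\<^sub>\<le>\<^sub>0" by (auto simp: complex_nonpos_Reals_iff)
  show "Re (disc_to_strip \<theta> ?z) = (if x < \<theta> then 1 else 0)"
  proof (cases "x < \<theta>")
    case True
    then have "Im (Ln ?q) = pi / 2"
      using Im_Ln_eq_pi_half(1)[OF q(1)] half_plane_map_circle(1)[OF x(1,2)] sgn by blast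
    then show ?thesis using True by (simp only: Re_disc_to_strip) simp
  next
    case False
    then have "Im (Ln ?q) = - pi / 2"
      using Im_Ln_eq_pi_half(2)[OF q(1)] half_plane_map_circle(1)[OF x(1,2)] sgn' x(3) by simp
    then show ?thesis using False by (simp only: Re_disc_to_strip) simp
  qed
  have "1 - ?z \<noteq> 0"
  proof
    assume "1 - ?z = 0"
    then have "?q = 0" by (simp add: half_plane_map_def)
    with q show False by simp
  qed
  then have "isCont (half_plane_map \<theta>) ?z"
    unfolding half_plane_map_def[abs_def] by (intro continuous_intros) auto
  then show "isCont (disc_to_strip \<theta>) ?z"
    unfolding disc_to_strip_def[abs_def] using q by (intro continuous_intros isCont_Ln') auto
qed

end

section \<open>Pointwise holomorphic versions of analytic functions with values in L1\<close>

lemma L1_power_series_pointwise: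
  fixes F :: "complex \<Rightarrow> 'a \<Rightarrow> complex" and a :: "nat \<Rightarrow> 'a \<Rightarrow> complex"
  assumes r: "0 < r" and [measurable]: "\<And>z. z \<in> ball z0 r \<Longrightarrow> F z \<in> borel_measurable M"
      "\<And>n. a n \<in> borel_measurable M"
    and fin: "\<And>n. (\<integral>\<^sup>+w. ennreal (norm (a n w)) \<partial>M) < \<infinity>"
    and lim: "\<And>z. z \<in> ball z0 r \<Longrightarrow>
      (\<lambda>n. \<integral>\<^sup>+w. ennreal (norm (F z w - (\<Sum>k<n. (z - z0) ^ k * a k w))) \<partial>M) \<longlonglongrightarrow> 0"
  shows "AE w in M. summable (\<lambda>k. norm (a k w) * (r / 2) ^ k)"
    and "\<And>z. z \<in> ball z0 (r / 2) \<Longrightarrow> AE w in M. F z w = (\<Sum>k. (z - z0) ^ k * a k w)"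
proof -
  \<comment> \<open>At a radius strictly between r / 2 and r the terms of the series are bounded in
    L1, as differences of consecutive remainders. On the disc of radius r / 2 this yields a
    geometric majorant with ratio 2 / 3.\<close>
  define \<rho> where "\<rho> = 3 / 4 * r"
  define z1 where "z1 = z0 + of_real \<rho>"
  have z1: "z1 \<in> ball z0 r" "norm (z1 - z0) = \<rho>" using r by (auto simp: z1_def \<rho>_def dist_norm)
  note [measurable] = assms(2)[OF z1(1)]
  define I where "I n = (\<integral>\<^sup>+w. ennreal (norm (a n w)) \<partial>M)" for n
  define E where "E n = (\<integral>\<^sup>+w. ennreal (norm (F z1 w - (\<Sum>k<n. (z1 - z0) ^ k * a k w))) \<partial>M)" for n
  have term_le: "ennreal (\<rho> ^ n) * I n \<le> E n + E (Suc n)" for n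
  proof -
    have "ennreal (\<rho> ^ n) * I n = (\<integral>\<^sup>+w. ennreal (norm ((z1 - z0) ^ n * a n w)) \<partial>M)"
      unfolding I_def using r
      by (subst nn_integral_cmult[symmetric]) (auto simp: ennreal_mult norm_mult norm_power z1(2) \<rho>_def)
    also have "\<dots> \<le> (\<integral>\<^sup>+w. ennreal (norm (F z1 w - (\<Sum>k<n. (z1 - z0) ^ k * a k w)))
       + ennreal (norm (F z1 w - (\<Sum>k<Suc n. (z1 - z0) ^ k * a k w))) \<partial>M)"
    proof (intro nn_integral_mono)
      fix w
      let ?X = "F z1 w - (\<Sum>k<n. (z1 - z0) ^ k * a k w)"
      have "norm ((z1 - z0) ^ n * a n w) \<le> norm ?X + norm (?X - (z1 - z0) ^ n * a n w)"
        using norm_triangle_ineq4[of ?X "?X - (z1 - z0) ^ n * a n w"] by simp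
      then show "ennreal (norm ((z1 - z0) ^ n * a n w)) \<le> ennreal (norm ?X)
         + ennreal (norm (F z1 w - (\<Sum>k<Suc n. (z1 - z0) ^ k * a k w)))"
        by (subst ennreal_plus[symmetric]) (auto simp: diff_diff_eq simp del: ennreal_plus intro: ennreal_leI)
    qed
    also have "\<dots> = E n + E (Suc n)"
      unfolding E_def by (rule nn_integral_add) auto
    finally show ?thesis .
  qed
  have "E \<longlonglongrightarrow> 0" unfolding E_def[abs_def] by (rule lim[OF z1(1)])
  then have "(\<lambda>n. E n + E (Suc n)) \<longlonglongrightarrow> 0 + 0" by (intro tendsto_add LIMSEQ_Suc)
  then have "\<forall>\<^sub>F n in sequentially. E n + E (Suc n) < 1" by (simp add: order_tendsto_iff)
  then obtain N where N: "E n + E (Suc n) < 1" if "n \<ge> N" for n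
    unfolding eventually_sequentially by blast
  define C where "C = 1 + (\<Sum>n<N. ennreal (\<rho> ^ n) * I n)"
  have C: "ennreal (\<rho> ^ n) * I n \<le> C" for n
  proof (cases "n < N")
    case True
    then have "ennreal (\<rho> ^ n) * I n \<le> (\<Sum>n<N. ennreal (\<rho> ^ n) * I n)"
      by (intro member_le_sum) auto
    then show ?thesis unfolding C_def by (simp add: add_increasing)
  next
    case False
    then have "ennreal (\<rho> ^ n) * I n \<le> 1"
      using term_le[of n] N[of n] by (meson le_less_trans less_imp_le not_less)
    then show ?thesis unfolding C_def by (simp add: add_increasing2)
  qed
  have "I n < \<infinity>" for n using fin by (simp add: I_def)
  then have Cfin: "C < \<infinity>" unfolding C_def
    by (simp add: ennreal_add_less_top ennreal_mult_less_top)
  have half: "(r / 2) ^ n = \<rho> ^ n * (2 / 3) ^ n" for n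
    by (simp add: \<rho>_def power_mult_distrib[symmetric])
  have "(\<integral>\<^sup>+w. (\<Sum>n. ennreal (norm (a n w) * (r / 2) ^ n)) \<partial>M)
     = (\<Sum>n. \<integral>\<^sup>+w. ennreal (norm (a n w) * (r / 2) ^ n) \<partial>M)"
    by (rule nn_integral_suminf) auto
  also have "\<dots> = (\<Sum>n. ennreal ((r / 2) ^ n) * I n)"
    unfolding I_def using r
    by (subst nn_integral_cmult[symmetric]) (auto simp: ennreal_mult mult.commute)
  also have "\<dots> \<le> (\<Sum>n. C * ennreal ((2 / 3) ^ n))"
  proof (rule suminf_le)
    fix n
    have "ennreal ((r / 2) ^ n) * I n = ennreal (\<rho> ^ n) * I n * ennreal ((2 / 3) ^ n)"
      using r unfolding half by (subst ennreal_mult) (auto simp: \<rho>_def mult_ac)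
    also have "\<dots> \<le> C * ennreal ((2 / 3) ^ n)" by (intro mult_right_mono C) auto
    finally show "ennreal ((r / 2) ^ n) * I n \<le> C * ennreal ((2 / 3) ^ n)" .
  qed auto
  also have "\<dots> = C * (\<Sum>n. ennreal ((2 / 3) ^ n))" by simp
  also have "(\<Sum>n. ennreal ((2 / 3 :: real) ^ n)) = ennreal 3"
    using geometric_sums[of "2 / 3 :: real"] by (intro suminf_ennreal_eq) auto
  also have "C * ennreal 3 < \<infinity>" using Cfin by (simp add: ennreal_mult_less_top)
  finally have "AE w in M. (\<Sum>n. ennreal (norm (a n w) * (r / 2) ^ n)) \<noteq> \<infinity>"
    by (intro nn_integral_PInf_AE) auto
  then show S: "AE w in M. summable (\<lambda>k. norm (a k w) * (r / 2) ^ k)"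
  proof eventually_elim
    case (elim w)
    then show ?case using r by (intro summable_suminf_not_top) (auto simp: top_unique)
  qed
  fix z assume z: "z \<in> ball z0 (r / 2)"
  then have zr: "z \<in> ball z0 r" using r by auto
  note [measurable] = assms(2)[OF zr]
  let ?S = "\<lambda>w. \<Sum>k. (z - z0) ^ k * a k w"
  have "(\<integral>\<^sup>+w. ennreal (norm (F z w - ?S w)) \<partial>M)
     \<le> (\<integral>\<^sup>+w. liminf (\<lambda>n. ennreal (norm (F z w - (\<Sum>k<n. (z - z0) ^ k * a k w)))) \<partial>M)"
  proof (rule nn_integral_mono_AE)
    show "AE w in M. ennreal (norm (F z w - ?S w))
       \<le> liminf (\<lambda>n. ennreal (norm (F z w - (\<Sum>k<n. (z - z0) ^ k * a k w))))"
      using S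
    proof eventually_elim
      case (elim w)
      have "summable (\<lambda>k. (z - z0) ^ k * a k w)"
      proof (rule summable_comparison_test'[OF elim])
        fix n
        have "norm (z - z0) ^ n \<le> (r / 2) ^ n"
          using z by (intro power_mono) (auto simp: dist_norm norm_minus_commute)
        then show "norm ((z - z0) ^ n * a n w) \<le> norm (a n w) * (r / 2) ^ n"
          by (simp add: norm_mult norm_power mult.commute mult_left_mono)
      qed
      then have "(\<lambda>n. \<Sum>k<n. (z - z0) ^ k * a k w) \<longlonglongrightarrow> ?S w" by (rule summable_LIMSEQ)
      then have "(\<lambda>n. ennreal (norm (F z w - (\<Sum>k<n. (z - z0) ^ k * a k w)))) \<longlonglongrightarrow> ennreal (norm (F z w - ?S w))"
        by (intro tendsto_ennrealI tendsto_intros)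
      from lim_imp_Liminf[OF sequentially_bot this] show ?case by simp
    qed
  qed
  also have "\<dots> \<le> liminf (\<lambda>n. \<integral>\<^sup>+w. ennreal (norm (F z w - (\<Sum>k<n. (z - z0) ^ k * a k w))) \<partial>M)"
    by (rule nn_integral_liminf) measurable
  also have "\<dots> = 0" by (rule lim_imp_Liminf[OF sequentially_bot lim[OF zr]])
  finally have "(\<integral>\<^sup>+w. ennreal (norm (F z w - ?S w)) \<partial>M) = 0" by simp
  then have "AE w in M. ennreal (norm (F z w - ?S w)) = 0"
    by (subst (asm) nn_integral_0_iff_AE) auto
  then show "AE w in M. F z w = ?S w" by eventually_elim simp
qed

text \<open>Each \<open>F z\<close> is given only up to a null set that depends on \<open>z\<close>.
  Countably many discs cover \<open>S\<close>, and off one null set all their power series converge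
  and agree with \<open>F\<close> at the points of a countable dense set. On overlaps, holomorphic
  sums that agree on a dense set coincide, so the sums glue together.\<close>

theorem L1_analytic_pointwise:
  fixes F :: "complex \<Rightarrow> 'a \<Rightarrow> complex"
  assumes [measurable]: "\<And>z. z \<in> S \<Longrightarrow> F z \<in> borel_measurable M"
    and loc: "\<And>z0. z0 \<in> S \<Longrightarrow> \<exists>r>0. \<exists>a::nat \<Rightarrow> 'a \<Rightarrow> complex. ball z0 r \<subseteq> S \<and>
      (\<forall>n. a n \<in> borel_measurable M \<and> (\<integral>\<^sup>+w. ennreal (norm (a n w)) \<partial>M) < \<infinity>) \<and>
      (\<forall>z\<in>ball z0 r. (\<lambda>n. \<integral>\<^sup>+w. ennreal (norm (F z w - (\<Sum>k<n. (z - z0) ^ k * a k w))) \<partial>M) \<longlonglongrightarrow> 0)"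
  shows "\<exists>G. (\<forall>w. (\<lambda>z. G z w) holomorphic_on S) \<and> (\<forall>z\<in>S. G z \<in> borel_measurable M) \<and>
    (\<forall>z\<in>S. AE w in M. G z w = F z w)"
proof -
  define P where "P z0 r a \<longleftrightarrow> 0 < r \<and> ball z0 r \<subseteq> S \<and>
      (\<forall>n. a n \<in> borel_measurable M \<and> (\<integral>\<^sup>+w. ennreal (norm (a n w)) \<partial>M) < \<infinity>) \<and>
      (\<forall>z\<in>ball z0 r. (\<lambda>n::nat. \<integral>\<^sup>+w. ennreal (norm (F z w - (\<Sum>k<n. (z - z0) ^ k * a k w))) \<partial>M) \<longlonglongrightarrow> 0)"
    for z0 r a
  have "\<forall>z0\<in>S. \<exists>r a. P z0 r a"
  proof
    fix z0 assume "z0 \<in> S"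
    from loc[OF this] show "\<exists>r a. P z0 r a"
      unfolding P_def by (elim exE conjE) (intro exI conjI; assumption)
  qed
  then obtain r a where P: "\<forall>z0\<in>S. P z0 (r z0) (a z0)" by metis
  have r: "0 < r c" "ball c (r c) \<subseteq> S" and a[measurable]: "a c n \<in> borel_measurable M"
    and afin: "(\<integral>\<^sup>+w. ennreal (norm (a c n w)) \<partial>M) < \<infinity>"
    and alim: "z \<in> ball c (r c) \<Longrightarrow>
      (\<lambda>n::nat. \<integral>\<^sup>+w. ennreal (norm (F z w - (\<Sum>k<n. (z - c) ^ k * a c k w))) \<partial>M) \<longlonglongrightarrow> 0"
    if "c \<in> S" for c n z
    using bspec[OF P that] unfolding P_def by blast+
  have Fm: "F z \<in> borel_measurable M" if "c \<in> S" "z \<in> ball c (r c)" for c z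
    using r(2)[OF that(1)] that(2) assms(1) by blast
  define B where "B c = ball c (r c / 2)" for c
  define T where "T c z w = (\<Sum>k. (z - c) ^ k * a c k w)" for c z w
  have BS: "B c \<subseteq> S" "c \<in> B c" "open (B c)" if "c \<in> S" for c
    using r[OF that] by (auto simp: B_def)
  have AE1: "AE w in M. summable (\<lambda>k. norm (a c k w) * (r c / 2) ^ k)" if "c \<in> S" for c
    by (rule L1_power_series_pointwise(1)[OF r(1) Fm a afin alim]) (use that in auto)
  have AE2: "AE w in M. F z w = T c z w" if "c \<in> S" "z \<in> B c" for c z
    unfolding T_def
    by (rule L1_power_series_pointwise(2)[OF r(1) Fm a afin alim]) (use that in \<open>auto simp: B_def\<close>)
  have "\<And>X. X \<in> B ` S \<Longrightarrow> open X" using BS(3) by auto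
  then obtain \<C> where \<C>: "\<C> \<subseteq> B ` S" "countable \<C>" "\<Union>\<C> = \<Union>(B ` S)"
    using Lindelof[of "B ` S"] by metis
  from \<C>(1,2) have "\<exists>C. countable C \<and> C \<subseteq> S \<and> \<C> = B ` C"
    using countable_subset_image[of \<C> B S] by metis
  then obtain C where C: "C \<subseteq> S" "countable C" "\<C> = B ` C" by metis
  have "\<Union>(B ` S) = S" using BS(1,2) by blast
  then have cover: "\<Union>(B ` C) = S" using \<C>(3) unfolding C(3) by simp
  obtain Q :: "complex set" where Q: "countable Q" "\<And>X. open X \<Longrightarrow> X \<noteq> {} \<Longrightarrow> \<exists>d\<in>Q. d \<in> X"
    using countable_dense_setE by metis
  define good where "good w \<longleftrightarrow> (\<forall>c\<in>C. summable (\<lambda>k. norm (a c k w) * (r c / 2) ^ k)) \<and>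
    (\<forall>c\<in>C. \<forall>q\<in>Q \<inter> B c. F q w = T c q w)" for w
  have "AE w in M. \<forall>c\<in>C. summable (\<lambda>k. norm (a c k w) * (r c / 2) ^ k)"
    using AE1 C by (intro AE_ball_countable') auto
  moreover have "AE w in M. \<forall>c\<in>C. \<forall>q\<in>Q \<inter> B c. F q w = T c q w"
    using AE2 C Q(1) by (intro AE_ball_countable') auto
  ultimately have AEgood: "AE w in M. good w" by eventually_elim (simp add: good_def)
  then obtain N where N: "{w\<in>space M. \<not> good w} \<subseteq> N" "N \<in> sets M" "emeasure M N = 0"
    by (auto elim: AE_E)
  have Thol: "(\<lambda>z. T c z w) holomorphic_on B c" if c: "c \<in> C" and w: "good w" for c w
    unfolding B_def
  proof (rule power_series_holomorphic)
    fix z assume z: "z \<in> ball c (r c / 2)"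
    have "summable (\<lambda>k. (z - c) ^ k * a c k w)"
    proof (rule summable_comparison_test')
      show "summable (\<lambda>k. norm (a c k w) * (r c / 2) ^ k)" using w c by (simp add: good_def)
      fix n
      have "norm (z - c) ^ n \<le> (r c / 2) ^ n"
        using z by (intro power_mono) (auto simp: dist_norm norm_minus_commute)
      then show "norm ((z - c) ^ n * a c n w) \<le> norm (a c n w) * (r c / 2) ^ n"
        by (simp add: norm_mult norm_power mult.commute mult_left_mono)
    qed
    then show "(\<lambda>k. a c k w * (z - c) ^ k) sums T c z w"
      unfolding T_def by (simp add: summable_sums mult.commute)
  qed
  have agree: "T c z w = T c' z w" if c: "c \<in> C" "c' \<in> C" and w: "good w" and z: "z \<in> B c \<inter> B c'" for c c' w z
  proof (rule ccontr)
    assume ne: "T c z w \<noteq> T c' z w"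
    define X where "X = {y \<in> B c \<inter> B c'. T c y w - T c' y w \<noteq> 0}"
    have o: "open (B c \<inter> B c')" by (simp add: B_def open_Int)
    have c: "continuous_on (B c \<inter> B c') (\<lambda>y. T c y w - T c' y w)"
      using Thol[OF c(1) w] Thol[OF c(2) w]
      by (intro continuous_intros holomorphic_on_imp_continuous_on) (auto intro: holomorphic_on_subset)
    have "X = (B c \<inter> B c') \<inter> (\<lambda>y. T c y w - T c' y w) -` (- {0})" by (auto simp: X_def)
    then have "open X"
      using continuous_open_preimage[OF c o open_Compl[OF closed_singleton[of 0]]] by simp
    moreover have "z \<in> X" using z ne by (simp add: X_def)
    ultimately obtain q where "q \<in> Q" "q \<in> X" using Q(2)[of X] by auto
    have "\<forall>c\<in>C. \<forall>q\<in>Q \<inter> B c. F q w = T c q w" using w by (simp add: good_def)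
    then have "F q w = T c q w" "F q w = T c' q w"
      using \<open>c \<in> C\<close> \<open>c' \<in> C\<close> \<open>q \<in> Q\<close> \<open>q \<in> X\<close> unfolding X_def by blast+
    then show False using \<open>q \<in> X\<close> by (simp add: X_def)
  qed
  define sel where "sel z = (SOME c. c \<in> C \<and> z \<in> B c)" for z
  have sel: "sel z \<in> C" "z \<in> B (sel z)" if "z \<in> S" for z
  proof -
    have "\<exists>c. c \<in> C \<and> z \<in> B c" using that cover by blast
    from someI_ex[OF this] show "sel z \<in> C" "z \<in> B (sel z)" by (auto simp: sel_def)
  qed
  \<comment> \<open>On the exceptional null set \<open>G\<close> is 0, so holomorphy in
    \<open>z\<close> holds for every \<open>w\<close>.\<close>
  define G where "G z w = (if w \<in> space M - N then T (sel z) z w else 0)" for z w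
  have "(\<lambda>z. G z w) holomorphic_on S" for w
  proof (cases "w \<in> space M - N")
    case True
    then have w: "good w" using N by auto
    have "(\<lambda>z. G z w) holomorphic_on (\<Union>c\<in>C. B c)"
    proof (rule holomorphic_on_UN_open)
      fix c assume c: "c \<in> C"
      show "(\<lambda>z. G z w) holomorphic_on B c"
      proof (rule holomorphic_transform[OF Thol[OF c w]])
        fix z assume z: "z \<in> B c"
        then have "z \<in> S" using cover c by blast
        then show "T c z w = G z w"
          using True sel[of z] agree[OF c _ w, of "sel z" z] z by (simp add: G_def)
      qed
    qed (simp add: B_def)
    then show ?thesis using cover by simp
  next
    case False
    then show ?thesis unfolding G_def by auto
  qed
  moreover have "G z \<in> borel_measurable M" if z: "z \<in> S" for z
  proof -
    have sS: "sel z \<in> S" using sel[OF z] C by auto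
    note [measurable] = a[OF sS] N(2)
    show ?thesis unfolding G_def[abs_def] T_def by measurable
  qed
  moreover have "AE w in M. G z w = F z w" if z: "z \<in> S" for z
  proof -
    have sS: "sel z \<in> S" using sel[OF z] C by auto
    have "AE w in M. w \<notin> N" using N by (intro AE_not_in) (auto intro: null_setsI)
    with AE2[OF sS sel(2)[OF z]] AE_space show ?thesis
      by eventually_elim (simp add: G_def)
  qed
  ultimately show ?thesis by blast
qed

section \<open>Boundary values on a grid\<close>

text \<open>The midpoint of the cell of length 1 / (n + 1) containing \<open>y\<close>. Midpoints
  avoid the ends of the unit interval, where the boundary values of \<open>disc_to_strip\<close> are
  singular.\<close>

definition midpoint_grid :: "nat \<Rightarrow> real \<Rightarrow> real" where
  "midpoint_grid n y = (real (nat \<lfloor>real (Suc n) * y\<rfloor>) + 1 / 2) / real (Suc n)"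

lemma midpoint_in_unit_interval: "i < Suc n \<Longrightarrow> (real i + 1 / 2) / real (Suc n) \<in> {0<..<1}"
  by (simp add: field_simps)

lemma midpoint_index_less: "0 < y \<Longrightarrow> y < 1 \<Longrightarrow> nat \<lfloor>real (Suc n) * y\<rfloor> < Suc n"
proof -
  assume y: "0 < y" "y < 1"
  then have "real (Suc n) * y < real (Suc n)" by simp
  then have "\<lfloor>real (Suc n) * y\<rfloor> < int (Suc n)" by (simp add: floor_less_iff)
  then show ?thesis using y by (simp add: nat_less_iff)
qed

lemma midpoint_grid_in: "y \<in> {0<..<1} \<Longrightarrow> midpoint_grid n y \<in> {0<..<1}"
  unfolding midpoint_grid_def by (intro midpoint_in_unit_interval midpoint_index_less) auto

lemma midpoint_grid_tendsto: "0 < y \<Longrightarrow> (\<lambda>n. midpoint_grid n y) \<longlonglongrightarrow> y"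
proof -
  assume y: "0 < y"
  have le: "\<bar>midpoint_grid n y - y\<bar> \<le> 1 / real (Suc n)" for n
  proof -
    have "\<bar>real (nat \<lfloor>real (Suc n) * y\<rfloor>) + 1 / 2 - real (Suc n) * y\<bar> \<le> 1"
      using y of_int_floor_le[of "real (Suc n) * y"] floor_correct[of "real (Suc n) * y"]
      by (simp add: of_nat_nat del: of_nat_Suc) linarith
    moreover have "midpoint_grid n y - y = (real (nat \<lfloor>real (Suc n) * y\<rfloor>) + 1 / 2 - real (Suc n) * y) / real (Suc n)"
      by (simp add: midpoint_grid_def field_simps)
    ultimately show ?thesis by (simp add: divide_right_mono del: of_nat_Suc)
  qed
  have "(\<lambda>n. 1 / real (Suc n)) \<longlonglongrightarrow> 0" using LIMSEQ_inverse_real_of_nat by (simp only: inverse_eq_divide)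
  then have "(\<lambda>n. midpoint_grid n y - y) \<longlonglongrightarrow> 0"
    by (rule Lim_null_comparison[rotated]) (use le in auto)
  then show ?thesis by (simp add: LIM_zero_iff)
qed

text \<open>The integrand is constant on each cell, so the integral is a finite average. Averages of
  this form are what \<open>choquet_average\<close> accepts.\<close>

lemma nn_integral_midpoint:
  fixes f :: "real \<Rightarrow> real"
  assumes "\<And>y. 0 \<le> f y"
  shows "(\<integral>\<^sup>+y\<in>{0<..<1}. ennreal (f (midpoint_grid n y)) \<partial>lborel)
    = ennreal ((\<Sum>i<Suc n. f ((real i + 1 / 2) / real (Suc n))) / real (Suc n))"
proof -
  let ?N = "real (Suc n)"
  let ?J = "\<lambda>i. {real i / ?N..<(real i + 1) / ?N}"
  have "(\<integral>\<^sup>+y\<in>{0<..<1}. ennreal (f (midpoint_grid n y)) \<partial>lborel)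
     = (\<integral>\<^sup>+y. (\<Sum>i<Suc n. ennreal (f ((real i + 1 / 2) / ?N)) * indicator (?J i) y) \<partial>lborel)"
  proof (rule nn_integral_cong_AE)
    show "AE y in lborel. ennreal (f (midpoint_grid n y)) * indicator {0<..<1} y
       = (\<Sum>i<Suc n. ennreal (f ((real i + 1 / 2) / ?N)) * indicator (?J i) y)"
      using AE_lborel_singleton[of 0]
    proof eventually_elim
      case (elim y)
      have mem: "y \<in> ?J i \<longleftrightarrow> 0 \<le> y \<and> nat \<lfloor>?N * y\<rfloor> = i" for i
      proof -
        have "y \<in> ?J i \<longleftrightarrow> real i \<le> ?N * y \<and> ?N * y < real i + 1" by (simp add: field_simps)
        also have "\<dots> \<longleftrightarrow> \<lfloor>?N * y\<rfloor> = int i" by (simp add: floor_eq_iff)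
        also have "\<dots> \<longleftrightarrow> 0 \<le> y \<and> nat \<lfloor>?N * y\<rfloor> = i"
        proof
          assume *: "\<lfloor>?N * y\<rfloor> = int i"
          then have "0 \<le> \<lfloor>?N * y\<rfloor>" by simp
          then have "0 \<le> ?N * y" by (simp only: zero_le_floor)
          then show "0 \<le> y \<and> nat \<lfloor>?N * y\<rfloor> = i" using * by (simp add: zero_le_mult_iff)
        next
          assume *: "0 \<le> y \<and> nat \<lfloor>?N * y\<rfloor> = i"
          then have "0 \<le> \<lfloor>?N * y\<rfloor>" by simp
          then show "\<lfloor>?N * y\<rfloor> = int i" using * by linarith
        qed
        finally show ?thesis .
      qed
      show ?case
      proof (cases "0 < y \<and> y < 1")
        case True
        let ?i = "nat \<lfloor>?N * y\<rfloor>"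
        have i: "?i < Suc n" using midpoint_index_less True by blast
        have "(\<Sum>i<Suc n. ennreal (f ((real i + 1 / 2) / ?N)) * indicator (?J i) y)
           = (\<Sum>i<Suc n. if ?i = i then ennreal (f ((real i + 1 / 2) / ?N)) else 0)"
          using True by (intro sum.cong refl) (simp only: indicator_def mem, simp)
        also have "\<dots> = ennreal (f (midpoint_grid n y))"
          using i unfolding midpoint_grid_def by (subst sum.delta') auto
        finally show ?thesis using True by simp
      next
        case False
        have "y \<notin> ?J i" if "i < Suc n" for i
        proof
          assume "y \<in> ?J i"
          then have "real i / ?N \<le> y" "?N * y < real i + 1" by (auto simp: field_simps)
          moreover have "0 \<le> real i / ?N" by simp
          ultimately have y0: "0 \<le> y" and "?N * y < real i + 1" by linarith+
          moreover have "real i + 1 \<le> ?N" using that by simp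
          ultimately have "?N * y < ?N" by (rule_tac less_le_trans)
          then have y1: "?N * y < ?N * 1" by (simp only: mult_1_right)
          have "y < 1" using y1 by (rule mult_left_less_imp_less) simp
          then show False using False elim y0 by auto
        qed
        then show ?thesis using False by (simp del: sum.lessThan_Suc)
      qed
    qed
  qed
  also have "\<dots> = (\<Sum>i<Suc n. ennreal (f ((real i + 1 / 2) / ?N)) * ennreal (1 / ?N))"
  proof (subst nn_integral_sum)
    show "(\<Sum>i<Suc n. \<integral>\<^sup>+y. ennreal (f ((real i + 1 / 2) / ?N)) * indicator (?J i) y \<partial>lborel)
       = (\<Sum>i<Suc n. ennreal (f ((real i + 1 / 2) / ?N)) * ennreal (1 / ?N))"
    proof (intro sum.cong refl)
      fix i
      have "(real i + 1) / ?N - real i / ?N = 1 / ?N" by (simp add: diff_divide_distrib[symmetric])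
      moreover have "real i / ?N \<le> (real i + 1) / ?N" by (intro divide_right_mono) auto
      ultimately show "(\<integral>\<^sup>+y. ennreal (f ((real i + 1 / 2) / ?N)) * indicator (?J i) y \<partial>lborel)
         = ennreal (f ((real i + 1 / 2) / ?N)) * ennreal (1 / ?N)"
        by (subst nn_integral_cmult_indicator) (simp_all only: sets_lborel atLeastLessThan_borel emeasure_lborel_Ico)
    qed
  qed measurable
  also have "\<dots> = ennreal ((\<Sum>i<Suc n. f ((real i + 1 / 2) / ?N)) / ?N)"
    using assms by (simp add: ennreal_mult[symmetric] sum_ennreal sum_divide_distrib del: sum.lessThan_Suc of_nat_Suc)
  finally show ?thesis .
qed

lemma measurable_step:
  fixes H :: "real \<Rightarrow> 'a \<Rightarrow> complex"
  assumes [measurable]: "\<And>y. y \<in> {0<..<1} \<Longrightarrow> H y \<in> borel_measurable M"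
  shows "(\<lambda>x. if snd x \<in> {0<..<1} then H (midpoint_grid n (snd x)) (fst x) else 0)
    \<in> borel_measurable (M \<Otimes>\<^sub>M lborel)"
proof -
  let ?f = "\<lambda>i x. if i < Suc n then H ((real i + 1 / 2) / real (Suc n)) (fst x) else 0"
  have [measurable]: "?f i \<in> borel_measurable (M \<Otimes>\<^sub>M lborel)" for i
  proof (cases "i < Suc n")
    case True
    note [measurable] = assms[OF midpoint_in_unit_interval[OF True]]
    show ?thesis using True by simp
  qed simp
  have "(\<lambda>x. ?f (nat \<lfloor>real (Suc n) * snd x\<rfloor>) x) \<in> borel_measurable (M \<Otimes>\<^sub>M lborel)"
    by (rule measurable_compose_countable) measurable
  then have "(\<lambda>x. if snd x \<in> {0<..<1} then ?f (nat \<lfloor>real (Suc n) * snd x\<rfloor>) x else 0)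
     \<in> borel_measurable (M \<Otimes>\<^sub>M lborel)"
    by measurable
  then show ?thesis
    by (rule measurable_cong[THEN iffD1, rotated])
       (auto simp: midpoint_grid_def midpoint_index_less simp del: of_nat_Suc)
qed

text \<open>A function measurable in \<open>w\<close> and continuous in \<open>y\<close> is the
  pointwise limit of its grid samples, hence jointly measurable, as Fubini requires.\<close>

lemma measurable_caratheodory:
  fixes u :: "real \<Rightarrow> 'a \<Rightarrow> complex"
  assumes "\<And>y. y \<in> {0<..<1} \<Longrightarrow> u y \<in> borel_measurable M"
    and cont: "\<And>w. continuous_on {0<..<1} (\<lambda>y. u y w)"
  shows "(\<lambda>x. if snd x \<in> {0<..<1} then u (snd x) (fst x) else 0) \<in> borel_measurable (M \<Otimes>\<^sub>M lborel)"
proof (rule borel_measurable_LIMSEQ_metric[OF measurable_step[OF assms(1)]])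
  fix x :: "'a \<times> real"
  show "(\<lambda>n. if snd x \<in> {0<..<1} then u (midpoint_grid n (snd x)) (fst x) else 0)
     \<longlonglongrightarrow> (if snd x \<in> {0<..<1} then u (snd x) (fst x) else 0)"
  proof (cases "snd x \<in> {0<..<1}")
    case True
    then have "isCont (\<lambda>y. u y (fst x)) (snd x)"
      using cont[of "fst x"] by (auto simp: continuous_on_eq_continuous_at)
    then have "(\<lambda>n. u (midpoint_grid n (snd x)) (fst x)) \<longlonglongrightarrow> u (snd x) (fst x)"
      using midpoint_grid_tendsto[of "snd x"] True by (intro isCont_tendsto_compose[of _ "\<lambda>y. u y (fst x)"]) auto
    then show ?thesis using True by simp
  next
    case False
    then show ?thesis by (simp only: if_False tendsto_const)
  qed
qed

section \<open>Convergence of the sampled boundary values\<close>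

lemma sqrt_le_one_plus: "0 \<le> x \<Longrightarrow> sqrt x \<le> 1 + x"
  by (rule real_le_lsqrt) (auto simp: power2_eq_square algebra_simps)

lemma sqrt_le_add_divide:
  assumes "0 \<le> x" "0 < e" shows "sqrt x \<le> e + x / e"
proof (cases "sqrt x \<le> e")
  case True
  then show ?thesis using assms by (simp add: add_increasing2)
next
  case False
  then have "e * sqrt x \<le> sqrt x * sqrt x" using assms by (intro mult_right_mono) auto
  then have "sqrt x \<le> x / e" using assms by (simp add: field_simps)
  then show ?thesis using assms by simp
qed

text \<open>From sqrt x \<le> e + x / e: on a finite measure space the first term contributes at
  most e times the total mass, and the second tends to 0 for fixed e.\<close>

lemma (in finite_measure) tendsto_nn_integral_sqrt:
  fixes f :: "nat \<Rightarrow> 'a \<Rightarrow> real"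
  assumes [measurable]: "\<And>n. f n \<in> borel_measurable M" and nn: "\<And>n w. 0 \<le> f n w"
    and lim: "(\<lambda>n. \<integral>\<^sup>+w. ennreal (f n w) \<partial>M) \<longlonglongrightarrow> 0"
  shows "(\<lambda>n. \<integral>\<^sup>+w. ennreal (sqrt (f n w)) \<partial>M) \<longlonglongrightarrow> 0"
proof (rule order_tendstoI)
  fix a :: ennreal assume a: "0 < a"
  obtain e :: real where e: "0 < e" "ennreal (e * measure M (space M)) + ennreal e < a"
  proof -
    define m where "m = measure M (space M) + 1"
    have m: "m \<ge> 1" by (simp add: m_def)
    obtain c where c: "0 < c" "c < a" using dense[OF a] by blast
    then obtain b :: real where b: "0 < b" "ennreal b < a"
      by (cases c) (auto simp: ennreal_less_zero_iff)
    define e where "e = min 1 (b / m)"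
    have "e * measure M (space M) + e = e * m" by (simp add: m_def algebra_simps)
    also have "\<dots> \<le> b" using m b by (simp add: e_def min_def field_simps)
    finally have "ennreal (e * measure M (space M) + e) < a" using b ennreal_leI le_less_trans by blast
    moreover have "0 < e" using m b by (simp add: e_def)
    ultimately show thesis using that[of e] by (simp add: ennreal_plus[symmetric] del: ennreal_plus)
  qed
  have "0 < ennreal (e * e)" using e by simp
  then have "\<forall>\<^sub>F n in sequentially. (\<integral>\<^sup>+w. ennreal (f n w) \<partial>M) < ennreal (e * e)"
    using lim by (simp add: order_tendsto_iff)
  then show "\<forall>\<^sub>F n in sequentially. (\<integral>\<^sup>+w. ennreal (sqrt (f n w)) \<partial>M) < a"
  proof eventually_elim
    case (elim n)
    have "(\<integral>\<^sup>+w. ennreal (sqrt (f n w)) \<partial>M) \<le> (\<integral>\<^sup>+w. ennreal e + ennreal (1 / e) * ennreal (f n w) \<partial>M)"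
    proof (rule nn_integral_mono)
      fix w
      have "sqrt (f n w) \<le> e + (1 / e) * f n w" using sqrt_le_add_divide[OF nn e(1)] by simp
      then show "ennreal (sqrt (f n w)) \<le> ennreal e + ennreal (1 / e) * ennreal (f n w)"
        using e nn by (simp add: ennreal_mult[symmetric] ennreal_plus[symmetric] ennreal_leI del: ennreal_plus)
    qed
    also have "\<dots> = ennreal e * emeasure M (space M) + ennreal (1 / e) * (\<integral>\<^sup>+w. ennreal (f n w) \<partial>M)"
      by (simp add: nn_integral_add nn_integral_cmult)
    also have "ennreal e * emeasure M (space M) = ennreal (e * measure M (space M))"
      using e by (simp add: emeasure_eq_measure ennreal_mult)
    also have "ennreal (e * measure M (space M)) + ennreal (1 / e) * (\<integral>\<^sup>+w. ennreal (f n w) \<partial>M)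
      \<le> ennreal (e * measure M (space M)) + ennreal (1 / e) * ennreal (e * e)"
      using elim by (intro add_left_mono mult_left_mono) auto
    also have "ennreal (1 / e) * ennreal (e * e) = ennreal e"
      using e by (simp add: ennreal_mult[symmetric])
    also note e(2)
    finally show ?case .
  qed
qed simp

definition radius :: "nat \<Rightarrow> real" where
  "radius n = 1 - 1 / real (Suc (Suc n))"

lemma radius: "0 < radius n" "radius n < 1"
  by (auto simp: radius_def field_simps)

lemma radius_tendsto: "radius \<longlonglongrightarrow> 1"
proof -
  have "(\<lambda>n. 1 / real (Suc n)) \<longlonglongrightarrow> 0"
    using LIMSEQ_inverse_real_of_nat by (simp only: inverse_eq_divide)
  from tendsto_diff[OF tendsto_const[of 1] LIMSEQ_Suc[OF this]] show ?thesis
    by (simp add: radius_def[abs_def])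
qed

abbreviation closed_strip :: "complex set" where
  "closed_strip \<equiv> {z. 0 \<le> Re z \<and> Re z \<le> 1}"

text \<open>Sampling the boundary values on a grid makes their averages finite sums, so that the measurability
  of \<open>t \<mapsto> \<sigma> {\<bar>F(j + it)\<bar> > s}\<close> never matters.  The second summand controls the exponential weights
  used in the final optimisation.\<close>

lemma (in finite_measure) boundary_error:
  fixes F G :: "complex \<Rightarrow> 'a \<Rightarrow> complex" and \<psi> :: "complex \<Rightarrow> complex" and b :: "real \<Rightarrow> complex"
  assumes Fm: "\<And>z. z \<in> closed_strip \<Longrightarrow> F z \<in> borel_measurable M"
    and Gm: "\<And>z. z \<in> unit_strip \<Longrightarrow> G z \<in> borel_measurable M"
    and GF: "\<And>z. z \<in> unit_strip \<Longrightarrow> AE w in M. G z w = F z w"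
    and Gcont: "\<And>w. continuous_on unit_strip (\<lambda>z. G z w)"
    and Fcont: "\<And>X z. (\<And>n. X n \<in> closed_strip) \<Longrightarrow> X \<longlonglongrightarrow> z \<Longrightarrow>
      (\<lambda>n::nat. \<integral>\<^sup>+w. ennreal (norm (F (X n) w - F z w)) \<partial>M) \<longlonglongrightarrow> 0"
    and Fbd: "\<And>z. z \<in> closed_strip \<Longrightarrow> (\<integral>\<^sup>+w. ennreal (norm (F z w)) \<partial>M) \<le> ennreal B"
    and \<psi>: "\<And>z. norm z < 1 \<Longrightarrow> \<psi> z \<in> unit_strip" "continuous_on (ball 0 1) \<psi>"
    and b: "\<And>y. norm (b y) = 1" "continuous_on UNIV b"
    and \<psi>b: "\<And>y. y \<in> {0<..<1} \<Longrightarrow> isCont \<psi> (b y)" "\<And>y. y \<in> {0<..<1} \<Longrightarrow> Re (\<psi> (b y)) = j"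
    and j: "0 \<le> j" "j \<le> 1"
  defines "err \<equiv> \<lambda>n w. \<integral>\<^sup>+y\<in>{0<..<1}. ennreal
      (sqrt (norm (G (\<psi> (radius n * b y)) w - F (\<psi> (b (midpoint_grid n y))) w)) +
       sqrt (norm (F (\<psi> (b (midpoint_grid n y))) w)) * \<bar>Re (\<psi> (radius n * b y)) - j\<bar>) \<partial>lborel"
  shows "err n \<in> borel_measurable M" "(\<lambda>n. \<integral>\<^sup>+w. err n w \<partial>M) \<longlonglongrightarrow> 0"
proof -
  interpret P: pair_sigma_finite M "lborel :: real measure" ..
  have sc: "unit_strip \<subseteq> closed_strip" by (auto simp: unit_strip_def)
  define p where "p n y = \<psi> (of_real (radius n) * b y)" for n y
  define q where "q y = \<psi> (b y)" for y
  define h where "h n y = F (q (midpoint_grid n y))" for n y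
  have nb: "norm (of_real (radius n) * b y) < 1" for n y
    using radius[of n] b(1)[of y] by (simp add: norm_mult)
  have p: "p n y \<in> unit_strip" for n y unfolding p_def by (rule \<psi>(1)[OF nb])
  have pcs: "p n y \<in> closed_strip" for n y using p sc by blast
  have q: "q y \<in> closed_strip" if "y \<in> {0<..<1}" for y
    using \<psi>b(2)[OF that] j by (simp add: q_def)
  have hm: "h n y \<in> borel_measurable M" if "y \<in> {0<..<1}" for n y
    unfolding h_def by (intro Fm q midpoint_grid_in that)
  have pc: "continuous_on UNIV (p n)" for n
    unfolding p_def[abs_def]
    by (intro continuous_on_compose2[OF \<psi>(2)] continuous_intros b(2)) (use nb in auto)
  have uc: "continuous_on {0<..<1} (\<lambda>y. G (p n y) w)" for n w
    by (rule continuous_on_compose2[OF Gcont continuous_on_subset[OF pc]]) (use p in auto)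
  note [measurable] = measurable_caratheodory[of "\<lambda>y. G (p n y)" M for n, OF Gm[OF p] uc]
  have [measurable]: "(\<lambda>x. if snd x \<in> {0<..<1} then h n (snd x) (fst x) else 0)
     \<in> borel_measurable (M \<Otimes>\<^sub>M lborel)" for n
    unfolding h_def by (rule measurable_step) (intro Fm q)
  have [measurable]: "p n \<in> borel_measurable borel" for n
    by (rule borel_measurable_continuous_onI[OF pc])
  define e where "e n w y = ennreal (sqrt (norm (G (p n y) w - h n y w)) + sqrt (norm (h n y w)) * \<bar>Re (p n y) - j\<bar>)
     * indicator {0<..<1} y" for n w y
  have em[measurable]: "(\<lambda>(w, y). e n w y) \<in> borel_measurable (M \<Otimes>\<^sub>M lborel)" for n
  proof -
    have "(\<lambda>(w, y). e n w y) = (\<lambda>x. ennreal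
      (sqrt (norm ((if snd x \<in> {0<..<1} then G (p n (snd x)) (fst x) else 0)
          - (if snd x \<in> {0<..<1} then h n (snd x) (fst x) else 0)))
        + sqrt (norm (if snd x \<in> {0<..<1} then h n (snd x) (fst x) else 0)) * \<bar>Re (p n (snd x)) - j\<bar>)
        * indicator {0<..<1} (snd x))"
      by (auto simp: fun_eq_iff e_def indicator_def)
    also have "\<dots> \<in> borel_measurable (M \<Otimes>\<^sub>M lborel)" by measurable
    finally show ?thesis .
  qed
  have err: "err n w = (\<integral>\<^sup>+y. e n w y \<partial>lborel)" for n w
    by (simp add: err_def e_def p_def q_def h_def)
  show "err n \<in> borel_measurable M" for n
    unfolding err[abs_def] by (rule lborel.borel_measurable_nn_integral) measurable
  define I where "I n y = (\<integral>\<^sup>+w. e n w y \<partial>M)" for n y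
  have Fub: "(\<integral>\<^sup>+w. err n w \<partial>M) = (\<integral>\<^sup>+y. I n y \<partial>lborel)" for n
    unfolding err I_def by (rule P.Fubini'[symmetric, OF em])
  have Im: "I n \<in> borel_measurable lborel" for n
    unfolding I_def[abs_def] by (rule borel_measurable_nn_integral) measurable
  \<comment> \<open>For fixed \<open>y\<close> the point \<open>p n y\<close> is fixed, so the
    version \<open>G\<close> may be replaced by \<open>F\<close>. The null set may vary with
    \<open>y\<close>, because the integral over \<open>w\<close> is taken first.\<close>
  have I_eq: "I n y = (\<integral>\<^sup>+w. ennreal (sqrt (norm (F (p n y) w - h n y w))) \<partial>M)
      + ennreal \<bar>Re (p n y) - j\<bar> * (\<integral>\<^sup>+w. ennreal (sqrt (norm (h n y w))) \<partial>M)" if y: "y \<in> {0<..<1}" for n y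
  proof -
    have [measurable]: "h n y \<in> borel_measurable M" "F (p n y) \<in> borel_measurable M" "G (p n y) \<in> borel_measurable M"
      using hm[OF y] Fm[OF pcs] Gm[OF p] by auto
    have "I n y = (\<integral>\<^sup>+w. ennreal (sqrt (norm (F (p n y) w - h n y w))) +
        ennreal \<bar>Re (p n y) - j\<bar> * ennreal (sqrt (norm (h n y w))) \<partial>M)"
      unfolding I_def
    proof (rule nn_integral_cong_AE)
      show "AE w in M. e n w y = ennreal (sqrt (norm (F (p n y) w - h n y w))) +
        ennreal \<bar>Re (p n y) - j\<bar> * ennreal (sqrt (norm (h n y w)))"
        using GF[OF p[of n y]]
        by eventually_elim (use y in \<open>simp add: e_def ennreal_mult mult.commute\<close>)
    qed
    also have "\<dots> = (\<integral>\<^sup>+w. ennreal (sqrt (norm (F (p n y) w - h n y w))) \<partial>M)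
      + ennreal \<bar>Re (p n y) - j\<bar> * (\<integral>\<^sup>+w. ennreal (sqrt (norm (h n y w))) \<partial>M)"
      by (simp add: nn_integral_add nn_integral_cmult)
    finally show ?thesis .
  qed
  define m where "m = measure M (space M)"
  have sqrt_bd: "(\<integral>\<^sup>+w. ennreal (sqrt (g w)) \<partial>M) \<le> ennreal m + (\<integral>\<^sup>+w. ennreal (g w) \<partial>M)"
    if [measurable]: "g \<in> borel_measurable M" and nn: "\<And>w. 0 \<le> g w" for g :: "'a \<Rightarrow> real"
  proof -
    have "(\<integral>\<^sup>+w. ennreal (sqrt (g w)) \<partial>M) \<le> (\<integral>\<^sup>+w. 1 + ennreal (g w) \<partial>M)"
    proof (rule nn_integral_mono)
      fix w
      have "ennreal (sqrt (g w)) \<le> ennreal (1 + g w)" by (intro ennreal_leI sqrt_le_one_plus nn)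
      then show "ennreal (sqrt (g w)) \<le> 1 + ennreal (g w)" using nn[of w] by simp
    qed
    also have "\<dots> = ennreal m + (\<integral>\<^sup>+w. ennreal (g w) \<partial>M)"
      by (simp add: nn_integral_add emeasure_eq_measure m_def)
    finally show ?thesis .
  qed
  have h_bd: "(\<integral>\<^sup>+w. ennreal (norm (h n y w)) \<partial>M) \<le> ennreal B" if "y \<in> {0<..<1}" for n y
    unfolding h_def by (intro Fbd q midpoint_grid_in that)
  have hs_bd: "(\<integral>\<^sup>+w. ennreal (sqrt (norm (h n y w))) \<partial>M) \<le> ennreal m + ennreal B" if "y \<in> {0<..<1}" for n y
    using sqrt_bd[of "\<lambda>w. norm (h n y w)"] hm[OF that] h_bd[OF that]
    by (auto intro: order_trans add_left_mono)
  have p_bd: "(\<integral>\<^sup>+w. ennreal (norm (F (p n y) w)) \<partial>M) \<le> ennreal B" for n y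
    by (rule Fbd[OF pcs])
  have I_le: "I n y \<le> ennreal m + (ennreal B + ennreal B) + (ennreal m + ennreal B)" if y: "y \<in> {0<..<1}" for n y
  proof -
    have [measurable]: "h n y \<in> borel_measurable M" "F (p n y) \<in> borel_measurable M"
      using hm[OF y] Fm[OF pcs] by auto
    have "(\<integral>\<^sup>+w. ennreal (norm (F (p n y) w - h n y w)) \<partial>M)
       \<le> (\<integral>\<^sup>+w. ennreal (norm (F (p n y) w)) + ennreal (norm (h n y w)) \<partial>M)"
      by (intro nn_integral_mono)
         (simp add: ennreal_plus[symmetric] norm_triangle_ineq4 ennreal_leI del: ennreal_plus)
    also have "\<dots> = (\<integral>\<^sup>+w. ennreal (norm (F (p n y) w)) \<partial>M) + (\<integral>\<^sup>+w. ennreal (norm (h n y w)) \<partial>M)"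
      by (rule nn_integral_add) auto
    also have "\<dots> \<le> ennreal B + ennreal B" by (intro add_mono p_bd h_bd y)
    finally have "(\<integral>\<^sup>+w. ennreal (sqrt (norm (F (p n y) w - h n y w))) \<partial>M) \<le> ennreal m + (ennreal B + ennreal B)"
      using sqrt_bd[of "\<lambda>w. norm (F (p n y) w - h n y w)"] by (auto intro: order_trans add_left_mono)
    moreover have "ennreal \<bar>Re (p n y) - j\<bar> * (\<integral>\<^sup>+w. ennreal (sqrt (norm (h n y w))) \<partial>M)
       \<le> 1 * (ennreal m + ennreal B)"
    proof (intro mult_mono hs_bd y)
      have "\<bar>Re (p n y) - j\<bar> \<le> 1" using p[of n y] j by (auto simp: unit_strip_def)
      then show "ennreal \<bar>Re (p n y) - j\<bar> \<le> 1" by (simp add: ennreal_le_1)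
    qed auto
    ultimately show ?thesis unfolding I_eq[OF y] by (intro add_mono) auto
  qed
  \<comment> \<open>The interior points and the sampled boundary points both tend to
    \<open>q y\<close>, so \<open>F (q y)\<close> serves as intermediate value; the weight tends to
    0 because \<open>Re (q y) = j\<close>.\<close>
  have I0: "(\<lambda>n. I n y) \<longlonglongrightarrow> 0" if y: "y \<in> {0<..<1}" for y
  proof -
    have [measurable]: "h n y \<in> borel_measurable M" "F (p n y) \<in> borel_measurable M" "F (q y) \<in> borel_measurable M" for n
      using hm[OF y] Fm[OF pcs] Fm[OF q[OF y]] by auto
    have "(\<lambda>n. of_real (radius n) * b y) \<longlonglongrightarrow> of_real 1 * b y"
      by (intro tendsto_intros radius_tendsto)
    then have plim: "(\<lambda>n. p n y) \<longlonglongrightarrow> q y"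
      unfolding p_def q_def by (intro isCont_tendsto_compose[OF \<psi>b(1)[OF y]]) simp
    have "isCont b y" using b(2) by (simp add: continuous_on_eq_continuous_at)
    then have "(\<lambda>n. b (midpoint_grid n y)) \<longlonglongrightarrow> b y"
      using y by (intro isCont_tendsto_compose[of _ b] midpoint_grid_tendsto) auto
    then have qlim: "(\<lambda>n. q (midpoint_grid n y)) \<longlonglongrightarrow> q y"
      unfolding q_def by (intro isCont_tendsto_compose[OF \<psi>b(1)[OF y]])
    have 1: "(\<lambda>n. \<integral>\<^sup>+w. ennreal (norm (F (p n y) w - F (q y) w)) \<partial>M) \<longlonglongrightarrow> 0"
      by (rule Fcont[OF pcs plim])
    have 2: "(\<lambda>n. \<integral>\<^sup>+w. ennreal (norm (h n y w - F (q y) w)) \<partial>M) \<longlonglongrightarrow> 0"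
      unfolding h_def by (intro Fcont qlim q midpoint_grid_in y)
    have "(\<lambda>n. \<integral>\<^sup>+w. ennreal (norm (F (p n y) w - h n y w)) \<partial>M) \<longlonglongrightarrow> 0"
    proof (rule tendsto_sandwich[OF _ _ tendsto_const])
      show "(\<lambda>n. (\<integral>\<^sup>+w. ennreal (norm (F (p n y) w - F (q y) w)) \<partial>M)
          + (\<integral>\<^sup>+w. ennreal (norm (h n y w - F (q y) w)) \<partial>M)) \<longlonglongrightarrow> 0"
        using tendsto_add[OF 1 2] by simp
      have "(\<integral>\<^sup>+w. ennreal (norm (F (p n y) w - h n y w)) \<partial>M)
         \<le> (\<integral>\<^sup>+w. ennreal (norm (F (p n y) w - F (q y) w)) + ennreal (norm (h n y w - F (q y) w)) \<partial>M)" for n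
      proof (rule nn_integral_mono)
        fix w
        have "norm (F (p n y) w - h n y w) \<le> norm (F (p n y) w - F (q y) w) + norm (h n y w - F (q y) w)"
          using norm_triangle_ineq4[of "F (p n y) w - F (q y) w" "h n y w - F (q y) w"] by simp
        then show "ennreal (norm (F (p n y) w - h n y w))
           \<le> ennreal (norm (F (p n y) w - F (q y) w)) + ennreal (norm (h n y w - F (q y) w))"
          by (simp add: ennreal_plus[symmetric] ennreal_leI del: ennreal_plus)
      qed
      then have "(\<integral>\<^sup>+w. ennreal (norm (F (p n y) w - h n y w)) \<partial>M)
         \<le> (\<integral>\<^sup>+w. ennreal (norm (F (p n y) w - F (q y) w)) \<partial>M)
          + (\<integral>\<^sup>+w. ennreal (norm (h n y w - F (q y) w)) \<partial>M)" for n
        by (subst (asm) nn_integral_add) auto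
      then show "\<forall>\<^sub>F n in sequentially. (\<integral>\<^sup>+w. ennreal (norm (F (p n y) w - h n y w)) \<partial>M)
         \<le> (\<integral>\<^sup>+w. ennreal (norm (F (p n y) w - F (q y) w)) \<partial>M)
          + (\<integral>\<^sup>+w. ennreal (norm (h n y w - F (q y) w)) \<partial>M)" by (intro always_eventually allI)
    qed auto
    then have 3: "(\<lambda>n. \<integral>\<^sup>+w. ennreal (sqrt (norm (F (p n y) w - h n y w))) \<partial>M) \<longlonglongrightarrow> 0"
      by (intro tendsto_nn_integral_sqrt) auto
    have "(\<lambda>n. \<bar>Re (p n y) - j\<bar>) \<longlonglongrightarrow> \<bar>Re (q y) - j\<bar>" by (intro tendsto_intros plim)
    then have "(\<lambda>n. ennreal \<bar>Re (p n y) - j\<bar>) \<longlonglongrightarrow> ennreal 0"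
      using \<psi>b(2)[OF y] by (intro tendsto_ennrealI) (simp add: q_def)
    from ennreal_tendsto_cmult[of "ennreal m + ennreal B", OF _ this]
    have 4: "(\<lambda>n. ennreal \<bar>Re (p n y) - j\<bar> * (ennreal m + ennreal B)) \<longlonglongrightarrow> 0" by (simp add: mult.commute)
    show ?thesis
    proof (rule tendsto_sandwich[OF _ _ tendsto_const])
      show "(\<lambda>n. (\<integral>\<^sup>+w. ennreal (sqrt (norm (F (p n y) w - h n y w))) \<partial>M)
         + ennreal \<bar>Re (p n y) - j\<bar> * (ennreal m + ennreal B)) \<longlonglongrightarrow> 0"
        using tendsto_add[OF 3 4] by simp
      show "\<forall>\<^sub>F n in sequentially. I n y \<le> (\<integral>\<^sup>+w. ennreal (sqrt (norm (F (p n y) w - h n y w))) \<partial>M)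
         + ennreal \<bar>Re (p n y) - j\<bar> * (ennreal m + ennreal B)"
        unfolding I_eq[OF y] using hs_bd[OF y]
        by (intro always_eventually allI add_left_mono mult_left_mono) auto
    qed auto
  qed
  have "(\<lambda>n. \<integral>\<^sup>+y. I n y \<partial>lborel) \<longlonglongrightarrow> (\<integral>\<^sup>+y. 0 \<partial>(lborel :: real measure))"
  proof (rule nn_integral_dominated_convergence[where
      w = "\<lambda>y. (ennreal m + (ennreal B + ennreal B) + (ennreal m + ennreal B)) * indicator {0<..<1} y"])
    have out: "I n y = 0" if "y \<notin> {0<..<1}" for n y using that by (simp add: I_def e_def)
    show "AE y in lborel. I n y \<le> (ennreal m + (ennreal B + ennreal B) + (ennreal m + ennreal B)) * indicator {0<..<1} y" for n
      using I_le[of _ n] out[of _ n] by (intro AE_I2) (metis indicator_simps mult.right_neutral mult_zero_right order_refl)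
    show "AE y in lborel. (\<lambda>n. I n y) \<longlonglongrightarrow> 0"
      using I0 out by (intro AE_I2) (metis tendsto_const ext)
    show "(\<integral>\<^sup>+y. (ennreal m + (ennreal B + ennreal B) + (ennreal m + ennreal B)) * indicator {0<..<1::real} y \<partial>lborel) < \<infinity>"
      by (subst nn_integral_cmult_indicator) (auto simp: ennreal_mult_less_top)
  qed (use Im in auto)
  then show "(\<lambda>n. \<integral>\<^sup>+w. err n w \<partial>M) \<longlonglongrightarrow> 0" by (simp add: Fub)
qed

text \<open>Indices with integrals below 2^(-k) make the sum of the errors integrable, hence finite
  almost everywhere. \<open>s\<close> is not claimed to increase: later only the vanishing of the
  error along it matters.\<close>

lemma AE_tendsto_of_nn_integral:
  fixes e :: "nat \<Rightarrow> 'a \<Rightarrow> ennreal"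
  assumes [measurable]: "\<And>n. e n \<in> borel_measurable M" and lim: "(\<lambda>n. \<integral>\<^sup>+w. e n w \<partial>M) \<longlonglongrightarrow> 0"
  shows "\<exists>s::nat \<Rightarrow> nat. AE w in M. (\<lambda>k. e (s k) w) \<longlonglongrightarrow> 0"
proof -
  have "\<exists>n. (\<integral>\<^sup>+w. e n w \<partial>M) < ennreal ((1 / 2) ^ k)" for k :: nat
  proof -
    have "\<forall>\<^sub>F n in sequentially. (\<integral>\<^sup>+w. e n w \<partial>M) < ennreal ((1 / 2) ^ k)"
      using lim by (simp add: order_tendsto_iff)
    then show ?thesis by (rule eventually_happens'[OF sequentially_bot])
  qed
  then obtain s where s: "\<And>k. (\<integral>\<^sup>+w. e (s k) w \<partial>M) < ennreal ((1 / 2) ^ k)" by metis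
  have "(\<integral>\<^sup>+w. (\<Sum>k. e (s k) w) \<partial>M) = (\<Sum>k. \<integral>\<^sup>+w. e (s k) w \<partial>M)"
    by (rule nn_integral_suminf) auto
  also have "\<dots> \<le> (\<Sum>k. ennreal ((1 / 2) ^ k))"
    using s by (intro suminf_le) (auto intro: less_imp_le)
  also have "\<dots> = ennreal 2"
    using geometric_sums[of "1 / 2 :: real"] by (intro suminf_ennreal_eq) auto
  finally have "(\<integral>\<^sup>+w. (\<Sum>k. e (s k) w) \<partial>M) \<noteq> \<infinity>" by (auto simp: top_unique)
  then have "AE w in M. (\<Sum>k. e (s k) w) \<noteq> \<infinity>" by (intro nn_integral_PInf_AE) auto
  then have "AE w in M. (\<lambda>k. e (s k) w) \<longlonglongrightarrow> 0"
  proof eventually_elim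
    case (elim w)
    have fin: "e (s k) w \<noteq> top" for k
      using elim sum_le_suminf[of "\<lambda>k. e (s k) w" "{k}"] by (auto simp: top_unique)
    then have eq: "e (s k) w = ennreal (enn2real (e (s k) w))" for k
      by (simp add: ennreal_enn2real less_top)
    have "(\<Sum>k. ennreal (enn2real (e (s k) w))) \<noteq> top" using elim unfolding eq[symmetric] by simp
    then have "summable (\<lambda>k. enn2real (e (s k) w))"
      by (intro summable_suminf_not_top) auto
    from tendsto_ennrealI[OF summable_LIMSEQ_zero[OF this]] show ?case by (simp add: eq[symmetric])
  qed
  then show ?thesis by blast
qed

section \<open>Estimates at an interior point\<close>

lemma nn_integral_split_arcs:
  fixes h :: "real \<Rightarrow> ennreal"
  assumes [measurable]: "h \<in> borel_measurable borel" and \<theta>: "0 < \<theta>" "\<theta> < 1"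
  shows "(\<integral>\<^sup>+x\<in>{0..1}. h x \<partial>lborel) = ennreal \<theta> * (\<integral>\<^sup>+y\<in>{0<..<1}. h (\<theta> * y) \<partial>lborel)
    + ennreal (1 - \<theta>) * (\<integral>\<^sup>+y\<in>{0<..<1}. h (\<theta> + (1 - \<theta>) * y) \<partial>lborel)"
proof -
  have "(\<integral>\<^sup>+x\<in>{0..1}. h x \<partial>lborel)
     = (\<integral>\<^sup>+x. h x * indicator {0<..<\<theta>} x + h x * indicator {\<theta><..<1} x \<partial>lborel)"
  proof (rule nn_integral_cong_AE)
    show "AE x in lborel. h x * indicator {0..1} x = h x * indicator {0<..<\<theta>} x + h x * indicator {\<theta><..<1} x"
      using AE_lborel_singleton[of 0] AE_lborel_singleton[of \<theta>] AE_lborel_singleton[of 1]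
      by eventually_elim (use \<theta> in \<open>auto simp: indicator_def\<close>)
  qed
  also have "\<dots> = (\<integral>\<^sup>+x. h x * indicator {0<..<\<theta>} x \<partial>lborel) + (\<integral>\<^sup>+x. h x * indicator {\<theta><..<1} x \<partial>lborel)"
    by (rule nn_integral_add) auto
  also have "(\<integral>\<^sup>+x. h x * indicator {0<..<\<theta>} x \<partial>lborel)
     = ennreal \<bar>\<theta>\<bar> * (\<integral>\<^sup>+y. h (0 + \<theta> * y) * indicator {0<..<\<theta>} (0 + \<theta> * y) \<partial>lborel)"
    using \<theta> by (intro nn_integral_real_affine) auto
  also have "(\<integral>\<^sup>+y. h (0 + \<theta> * y) * indicator {0<..<\<theta>} (0 + \<theta> * y) \<partial>lborel)
     = (\<integral>\<^sup>+y\<in>{0<..<1}. h (\<theta> * y) \<partial>lborel)"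
    using \<theta> by (intro nn_integral_cong) (auto simp: indicator_def zero_less_mult_iff)
  also have "(\<integral>\<^sup>+x. h x * indicator {\<theta><..<1} x \<partial>lborel)
     = ennreal \<bar>1 - \<theta>\<bar> * (\<integral>\<^sup>+y. h (\<theta> + (1 - \<theta>) * y) * indicator {\<theta><..<1} (\<theta> + (1 - \<theta>) * y) \<partial>lborel)"
    using \<theta> by (intro nn_integral_real_affine) auto
  also have "(\<integral>\<^sup>+y. h (\<theta> + (1 - \<theta>) * y) * indicator {\<theta><..<1} (\<theta> + (1 - \<theta>) * y) \<partial>lborel)
     = (\<integral>\<^sup>+y\<in>{0<..<1}. h (\<theta> + (1 - \<theta>) * y) \<partial>lborel)"
  proof (intro nn_integral_cong)
    fix y
    have "\<theta> < \<theta> + (1 - \<theta>) * y \<longleftrightarrow> 0 < y" using \<theta> by (simp add: zero_less_mult_iff)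
    moreover have "\<theta> + (1 - \<theta>) * y < 1 \<longleftrightarrow> (1 - \<theta>) * y < (1 - \<theta>) * 1" by auto
    then have "\<theta> + (1 - \<theta>) * y < 1 \<longleftrightarrow> y < 1" using \<theta> by (simp only: mult_less_cancel_left_pos diff_gt_0_iff_gt)
    ultimately show "h (\<theta> + (1 - \<theta>) * y) * indicator {\<theta><..<1} (\<theta> + (1 - \<theta>) * y)
      = h (\<theta> + (1 - \<theta>) * y) * indicator {0<..<1} y"
      by (simp add: indicator_def)
  qed
  finally show ?thesis using \<theta> by simp
qed

lemma exp_diff_le: "exp s \<le> exp t + exp (max s t) * \<bar>s - t\<bar>" for s t :: real
proof (cases "s \<le> t")
  case True
  then show ?thesis by (simp add: add_increasing2)
next
  case False
  have "1 + (t - s) \<le> exp (t - s)" by (rule exp_ge_add_one_self)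
  then have "exp s * (1 + (t - s)) \<le> exp s * exp (t - s)" by (intro mult_left_mono) auto
  then have "exp s * (1 + (t - s)) \<le> exp t" by (simp add: exp_add[symmetric])
  then show ?thesis using False by (simp add: max_def algebra_simps)
qed

text \<open>An interior value \<open>u\<close> at abscissa \<open>x\<close> is replaced by a
  boundary value \<open>h\<close> at abscissa \<open>j\<close>. One error is sqrt |u - h|, the other
  the change of the exponential weight, which is Lipschitz in \<open>x\<close>; one constant
  depending only on \<open>c\<close> covers both.\<close>

lemma sqrt_norm_weighted_le:
  fixes u h :: complex
  assumes x: "0 \<le> x" "x \<le> 1" and j: "0 \<le> j" "j \<le> 1" and \<theta>: "0 \<le> \<theta>" "\<theta> \<le> 1"
  shows "sqrt (norm u) * exp (c * (x - \<theta>) / 2) \<le> exp (c * (j - \<theta>) / 2) * sqrt (norm h)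
    + ((1 + \<bar>c\<bar>) * exp \<bar>c\<bar>) * (sqrt (norm (u - h)) + sqrt (norm h) * \<bar>x - j\<bar>)"
proof -
  define K where "K = (1 + \<bar>c\<bar>) * exp \<bar>c\<bar>"
  have abs_le: "c * (y - \<theta>) / 2 \<le> \<bar>c\<bar>" if "0 \<le> y" "y \<le> 1" for y
  proof -
    have "\<bar>c * (y - \<theta>)\<bar> \<le> \<bar>c\<bar> * 1"
      unfolding abs_mult using that \<theta> by (intro mult_left_mono) auto
    then show ?thesis by linarith
  qed
  have K1: "exp \<bar>c\<bar> \<le> K" by (simp add: K_def algebra_simps)
  have ex: "exp (c * (x - \<theta>) / 2) \<le> K"
    using abs_le[OF x] K1 by (meson exp_le_cancel_iff order_trans)
  have "exp (c * (x - \<theta>) / 2) \<le> exp (c * (j - \<theta>) / 2)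
      + exp (max (c * (x - \<theta>) / 2) (c * (j - \<theta>) / 2)) * \<bar>c * (x - \<theta>) / 2 - c * (j - \<theta>) / 2\<bar>"
    by (rule exp_diff_le)
  also have "c * (x - \<theta>) / 2 - c * (j - \<theta>) / 2 = c / 2 * (x - j)" by (simp add: field_simps)
  also have "exp (max (c * (x - \<theta>) / 2) (c * (j - \<theta>) / 2)) * \<bar>c / 2 * (x - j)\<bar>
      \<le> exp \<bar>c\<bar> * (\<bar>c\<bar> * \<bar>x - j\<bar>)"
    using abs_le[OF x] abs_le[OF j]
    by (intro mult_mono) (auto simp: abs_mult intro: mult_right_mono)
  also have "exp \<bar>c\<bar> * (\<bar>c\<bar> * \<bar>x - j\<bar>) \<le> K * \<bar>x - j\<bar>"
    unfolding mult.assoc[symmetric] by (intro mult_right_mono) (auto simp: K_def algebra_simps)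
  finally have ex2: "exp (c * (x - \<theta>) / 2) \<le> exp (c * (j - \<theta>) / 2) + K * \<bar>x - j\<bar>" by simp
  have "sqrt (norm u) \<le> sqrt (norm h + norm (u - h))"
    using norm_triangle_ineq[of h "u - h"] by (intro real_sqrt_le_mono) simp
  also have "\<dots> \<le> sqrt (norm h) + sqrt (norm (u - h))" by (rule sqrt_add_le_add_sqrt) auto
  finally have "sqrt (norm u) * exp (c * (x - \<theta>) / 2)
     \<le> (sqrt (norm h) + sqrt (norm (u - h))) * exp (c * (x - \<theta>) / 2)"
    by (intro mult_right_mono) auto
  also have "\<dots> = sqrt (norm h) * exp (c * (x - \<theta>) / 2) + sqrt (norm (u - h)) * exp (c * (x - \<theta>) / 2)"
    by (simp add: distrib_right)
  also have "\<dots> \<le> sqrt (norm h) * (exp (c * (j - \<theta>) / 2) + K * \<bar>x - j\<bar>) + sqrt (norm (u - h)) * K"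
    using ex ex2 by (intro add_mono mult_left_mono) auto
  finally show ?thesis unfolding K_def[symmetric] by (simp add: algebra_simps)
qed

lemma measurable_midpoint_grid [measurable]:
  fixes H :: "real \<Rightarrow> complex"
  shows "(\<lambda>y. H (midpoint_grid n y)) \<in> borel_measurable borel"
proof -
  have "(\<lambda>y. nat \<lfloor>real (Suc n) * y\<rfloor>) \<in> borel \<rightarrow>\<^sub>M count_space UNIV" by measurable
  moreover have "(\<lambda>i. H ((real i + 1 / 2) / real (Suc n))) \<in> count_space UNIV \<rightarrow>\<^sub>M borel"
    by simp
  ultimately show ?thesis unfolding midpoint_grid_def by (rule measurable_compose)
qed

lemma arc_integral_le:
  fixes g \<psi> :: "complex \<Rightarrow> complex" and H :: "real \<Rightarrow> complex" and b :: "real \<Rightarrow> complex"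
  assumes g: "continuous_on unit_strip g" and \<psi>: "continuous_on (ball 0 1) \<psi>" "\<And>z. norm z < 1 \<Longrightarrow> \<psi> z \<in> unit_strip"
    and b: "continuous_on UNIV b" "\<And>y. norm (b y) = 1" and j: "0 \<le> j" "j \<le> 1" and \<theta>: "0 \<le> \<theta>" "\<theta> \<le> 1"
  shows "(\<integral>\<^sup>+y\<in>{0<..<1}. ennreal (sqrt (norm (g (\<psi> (radius n * b y)))) * exp (c * (Re (\<psi> (radius n * b y)) - \<theta>) / 2)) \<partial>lborel)
    \<le> ennreal (exp (c * (j - \<theta>) / 2)) * (\<integral>\<^sup>+y\<in>{0<..<1}. ennreal (sqrt (norm (H (midpoint_grid n y)))) \<partial>lborel)
     + ennreal ((1 + \<bar>c\<bar>) * exp \<bar>c\<bar>) * (\<integral>\<^sup>+y\<in>{0<..<1}. ennreal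
      (sqrt (norm (g (\<psi> (radius n * b y)) - H (midpoint_grid n y))) +
       sqrt (norm (H (midpoint_grid n y))) * \<bar>Re (\<psi> (radius n * b y)) - j\<bar>) \<partial>lborel)"
proof -
  have nb: "norm (of_real (radius n) * b y) < 1" for y
    using radius[of n] b(2)[of y] by (simp add: norm_mult)
  have pc: "continuous_on UNIV (\<lambda>y. \<psi> (of_real (radius n) * b y))"
    by (intro continuous_on_compose2[OF \<psi>(1)] continuous_intros b(1)) (use nb in auto)
  have gc: "continuous_on UNIV (\<lambda>y. g (\<psi> (of_real (radius n) * b y)))"
    by (rule continuous_on_compose2[OF g pc]) (use \<psi>(2) nb in auto)
  note [measurable] = borel_measurable_continuous_onI[OF pc] borel_measurable_continuous_onI[OF gc]
  let ?p = "\<lambda>y. \<psi> (of_real (radius n) * b y)" and ?h = "\<lambda>y. H (midpoint_grid n y)"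
  let ?K = "(1 + \<bar>c\<bar>) * exp \<bar>c\<bar>"
  have "(\<integral>\<^sup>+y\<in>{0<..<1}. ennreal (sqrt (norm (g (?p y))) * exp (c * (Re (?p y) - \<theta>) / 2)) \<partial>lborel)
    \<le> (\<integral>\<^sup>+y. ennreal (exp (c * (j - \<theta>) / 2)) * (ennreal (sqrt (norm (?h y))) * indicator {0<..<1} y)
     + ennreal ?K * (ennreal (sqrt (norm (g (?p y) - ?h y)) + sqrt (norm (?h y)) * \<bar>Re (?p y) - j\<bar>) * indicator {0<..<1} y) \<partial>lborel)"
  proof (rule nn_integral_mono)
    fix y
    have x: "0 \<le> Re (?p y)" "Re (?p y) \<le> 1" using \<psi>(2)[OF nb, of y] by (auto simp: unit_strip_def)
    have "ennreal (sqrt (norm (g (?p y))) * exp (c * (Re (?p y) - \<theta>) / 2))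
      \<le> ennreal (exp (c * (j - \<theta>) / 2) * sqrt (norm (?h y))
        + ?K * (sqrt (norm (g (?p y) - ?h y)) + sqrt (norm (?h y)) * \<bar>Re (?p y) - j\<bar>))"
      by (intro ennreal_leI sqrt_norm_weighted_le x j \<theta>)
    also have "\<dots> = ennreal (exp (c * (j - \<theta>) / 2)) * ennreal (sqrt (norm (?h y)))
        + ennreal ?K * ennreal (sqrt (norm (g (?p y) - ?h y)) + sqrt (norm (?h y)) * \<bar>Re (?p y) - j\<bar>)"
      by (subst ennreal_plus) (auto simp: ennreal_mult simp del: ennreal_plus)
    finally show "ennreal (sqrt (norm (g (?p y))) * exp (c * (Re (?p y) - \<theta>) / 2)) * indicator {0<..<1} y
      \<le> ennreal (exp (c * (j - \<theta>) / 2)) * (ennreal (sqrt (norm (?h y))) * indicator {0<..<1} y)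
     + ennreal ?K * (ennreal (sqrt (norm (g (?p y) - ?h y)) + sqrt (norm (?h y)) * \<bar>Re (?p y) - j\<bar>) * indicator {0<..<1} y)"
      by (simp add: indicator_def)
  qed
  also have "\<dots> = ennreal (exp (c * (j - \<theta>) / 2)) * (\<integral>\<^sup>+y\<in>{0<..<1}. ennreal (sqrt (norm (?h y))) \<partial>lborel)
     + ennreal ?K * (\<integral>\<^sup>+y\<in>{0<..<1}. ennreal (sqrt (norm (g (?p y) - ?h y)) + sqrt (norm (?h y)) * \<bar>Re (?p y) - j\<bar>) \<partial>lborel)"
    by (simp add: nn_integral_add nn_integral_cmult)
  finally show ?thesis .
qed

text \<open>Both arcs run over the same parameter interval, and the Boolean is also, via
  \<open>of_bool\<close>, the real part of the line that the arc reaches. The two lines can then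
  share all later arguments.\<close>

definition arc :: "real \<Rightarrow> bool \<Rightarrow> real \<Rightarrow> complex" where
  "arc \<theta> right y = cis (2 * pi * (if right then \<theta> * y else \<theta> + (1 - \<theta>) * y))"

lemma norm_arc: "norm (arc \<theta> s y) = 1"
  by (simp add: arc_def)

lemma continuous_arc: "continuous_on UNIV (arc \<theta> s)"
  unfolding arc_def[abs_def] by (cases s) (auto intro!: continuous_intros)

lemma disc_to_strip_arc:
  assumes \<theta>: "0 < \<theta>" "\<theta> < 1" and y: "y \<in> {0<..<1}"
  shows "isCont (disc_to_strip \<theta>) (arc \<theta> s y)" "Re (disc_to_strip \<theta> (arc \<theta> s y)) = of_bool s"
proof -
  define x where "x = (if s then \<theta> * y else \<theta> + (1 - \<theta>) * y)"
  define u v where "u = \<theta> * y" and "v = (1 - \<theta>) * y"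
  have "u < \<theta>" "0 < u" "0 < v" using \<theta> y by (auto simp: u_def v_def)
  moreover have "v < 1 - \<theta>"
    using \<theta> y mult_strict_left_mono[of y 1 "1 - \<theta>"] by (simp add: v_def)
  moreover have "x = (if s then u else \<theta> + v)" by (simp add: x_def u_def v_def)
  ultimately have "0 < x \<and> x < 1 \<and> (if s then x < \<theta> else \<theta> < x)"
    using \<theta> by (cases s) auto
  then have x: "0 < x" "x < 1" "x \<noteq> \<theta>" "x < \<theta> \<longleftrightarrow> s" by (auto split: if_splits)
  have a: "arc \<theta> s y = cis (2 * pi * x)" by (simp add: arc_def x_def)
  show "isCont (disc_to_strip \<theta>) (arc \<theta> s y)" "Re (disc_to_strip \<theta> (arc \<theta> s y)) = of_bool s"
    unfolding a using disc_to_strip_circle[OF \<theta> x(1-3)] x(4) by auto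
qed

text \<open>\<open>g\<close> is multiplied by exp (c (z - \<theta>)), which is 1 at \<theta> and has
  constant modulus on each of the two lines. The mean value inequality for the square root of the
  modulus, transplanted to the disc, then weights the lines against each other by the free parameter
  \<open>c\<close>.\<close>

lemma sqrt_norm_interior_le:
  fixes g :: "complex \<Rightarrow> complex" and H :: "bool \<Rightarrow> real \<Rightarrow> complex" and n :: nat and c :: real
  assumes \<theta>: "0 < \<theta>" "\<theta> < 1" and g: "g holomorphic_on unit_strip"
  defines "A \<equiv> \<lambda>s. \<integral>\<^sup>+y\<in>{0<..<1}. ennreal (sqrt (norm (H s (midpoint_grid n y)))) \<partial>lborel"
    and "E \<equiv> \<lambda>s. \<integral>\<^sup>+y\<in>{0<..<1}. ennreal
      (sqrt (norm (g (disc_to_strip \<theta> (radius n * arc \<theta> s y)) - H s (midpoint_grid n y))) +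
       sqrt (norm (H s (midpoint_grid n y))) * \<bar>Re (disc_to_strip \<theta> (radius n * arc \<theta> s y)) - of_bool s\<bar>) \<partial>lborel"
  shows "ennreal (sqrt (norm (g (of_real \<theta>)))) \<le>
    ennreal \<theta> * (ennreal (exp (c * (1 - \<theta>) / 2)) * A True + ennreal ((1 + \<bar>c\<bar>) * exp \<bar>c\<bar>) * E True) +
    ennreal (1 - \<theta>) * (ennreal (exp (c * (0 - \<theta>) / 2)) * A False + ennreal ((1 + \<bar>c\<bar>) * exp \<bar>c\<bar>) * E False)"
proof -
  let ?\<psi> = "disc_to_strip \<theta>"
  have \<psi>: "?\<psi> holomorphic_on ball 0 1" "\<And>z. norm z < 1 \<Longrightarrow> ?\<psi> z \<in> unit_strip"
    using disc_to_strip_holomorphic[OF \<theta>] disc_to_strip_in_strip[OF \<theta>] by auto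
  define k where "k z = g (?\<psi> z) * exp (of_real c * (?\<psi> z - of_real \<theta>))" for z
  have "(g \<circ> ?\<psi>) holomorphic_on ball 0 1"
    by (rule holomorphic_on_compose_gen[OF \<psi>(1) g]) (use \<psi>(2) in auto)
  then have k: "k holomorphic_on ball 0 1"
    unfolding k_def[abs_def] comp_def by (intro holomorphic_intros \<psi>(1))
  have nk: "sqrt (norm (k z)) = sqrt (norm (g (?\<psi> z))) * exp (c * (Re (?\<psi> z) - \<theta>) / 2)" for z
  proof -
    have "norm (k z) = norm (g (?\<psi> z)) * (exp (c * (Re (?\<psi> z) - \<theta>) / 2))\<^sup>2"
      by (simp add: k_def norm_mult power2_eq_square exp_add[symmetric])
    then show ?thesis by (simp add: real_sqrt_mult)
  qed
  have kc: "continuous_on UNIV (\<lambda>x. k (of_real (radius n) * cis (2 * pi * x)))"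
    by (intro continuous_on_compose2[OF holomorphic_on_imp_continuous_on[OF k]] continuous_intros)
       (use radius[of n] in \<open>auto simp: norm_mult\<close>)
  note [measurable] = borel_measurable_continuous_onI[OF kc]
  have "ennreal (sqrt (norm (g (of_real \<theta>)))) = ennreal (sqrt (norm (k 0)))"
    by (simp add: k_def disc_to_strip_0[OF \<theta>])
  also have "\<dots> \<le> (\<integral>\<^sup>+x\<in>{0..1}. ennreal (sqrt (norm (k (of_real (radius n) * cis (2 * pi * x))))) \<partial>lborel)"
    by (rule sqrt_norm_le_circle_mean[OF k radius])
  also have "\<dots> = ennreal \<theta> * (\<integral>\<^sup>+y\<in>{0<..<1}. ennreal (sqrt (norm (k (of_real (radius n) * arc \<theta> True y)))) \<partial>lborel)
     + ennreal (1 - \<theta>) * (\<integral>\<^sup>+y\<in>{0<..<1}. ennreal (sqrt (norm (k (of_real (radius n) * arc \<theta> False y)))) \<partial>lborel)"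
    by (subst nn_integral_split_arcs[OF _ \<theta>]) (auto simp: arc_def)
  also have "\<dots> \<le> ennreal \<theta> * (ennreal (exp (c * (1 - \<theta>) / 2)) * A True + ennreal ((1 + \<bar>c\<bar>) * exp \<bar>c\<bar>) * E True) +
    ennreal (1 - \<theta>) * (ennreal (exp (c * (0 - \<theta>) / 2)) * A False + ennreal ((1 + \<bar>c\<bar>) * exp \<bar>c\<bar>) * E False)"
  proof (intro add_mono mult_left_mono)
    have *: "(\<integral>\<^sup>+y\<in>{0<..<1}. ennreal (sqrt (norm (k (of_real (radius n) * arc \<theta> s y)))) \<partial>lborel)
      \<le> ennreal (exp (c * (of_bool s - \<theta>) / 2)) * A s + ennreal ((1 + \<bar>c\<bar>) * exp \<bar>c\<bar>) * E s" for s
      unfolding nk A_def E_def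
      by (rule arc_integral_le[OF holomorphic_on_imp_continuous_on[OF g]
            holomorphic_on_imp_continuous_on[OF \<psi>(1)] \<psi>(2) continuous_arc norm_arc])
         (use \<theta> in auto)
    show "(\<integral>\<^sup>+y\<in>{0<..<1}. ennreal (sqrt (norm (k (of_real (radius n) * arc \<theta> True y)))) \<partial>lborel)
      \<le> ennreal (exp (c * (1 - \<theta>) / 2)) * A True + ennreal ((1 + \<bar>c\<bar>) * exp \<bar>c\<bar>) * E True"
      using *[of True] by simp
    show "(\<integral>\<^sup>+y\<in>{0<..<1}. ennreal (sqrt (norm (k (of_real (radius n) * arc \<theta> False y)))) \<partial>lborel)
      \<le> ennreal (exp (c * (0 - \<theta>) / 2)) * A False + ennreal ((1 + \<bar>c\<bar>) * exp \<bar>c\<bar>) * E False"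
      using *[of False] by simp
  qed auto
  finally show ?thesis .
qed

text \<open>The choice c = 2 (ln \<alpha> - ln \<beta>) makes both exponential terms equal to
  \<alpha>^(1-\<theta>) \<beta>^\<theta>, and the weights \<theta> and 1 - \<theta> add up to
  1.\<close>

lemma weighted_sum_optimum:
  fixes \<alpha> \<beta> \<theta> S :: real
  assumes "0 < \<alpha>" "0 < \<beta>"
    and le: "\<And>c. S \<le> \<theta> * (exp (c * (1 - \<theta>) / 2) * \<beta>) + (1 - \<theta>) * (exp (c * (0 - \<theta>) / 2) * \<alpha>)"
  shows "S \<le> \<alpha> powr (1 - \<theta>) * \<beta> powr \<theta>"
proof -
  define a b where "a = ln \<alpha>" and "b = ln \<beta>"
  have \<alpha>: "\<alpha> = exp a" and \<beta>: "\<beta> = exp b" using assms by (auto simp: a_def b_def)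
  have "S \<le> \<theta> * (exp ((2 * (a - b)) * (1 - \<theta>) / 2) * \<beta>) + (1 - \<theta>) * (exp ((2 * (a - b)) * (0 - \<theta>) / 2) * \<alpha>)"
    by (rule le)
  also have "exp ((2 * (a - b)) * (1 - \<theta>) / 2) * \<beta> = exp ((1 - \<theta>) * a + \<theta> * b)"
    unfolding \<beta> exp_add[symmetric] by (rule arg_cong[of _ _ exp]) (simp add: field_simps)
  also have "exp ((2 * (a - b)) * (0 - \<theta>) / 2) * \<alpha> = exp ((1 - \<theta>) * a + \<theta> * b)"
    unfolding \<alpha> exp_add[symmetric] by (rule arg_cong[of _ _ exp]) (simp add: field_simps)
  finally have "S \<le> exp ((1 - \<theta>) * a + \<theta> * b)" by (simp add: algebra_simps)
  also have "\<dots> = \<alpha> powr (1 - \<theta>) * \<beta> powr \<theta>" by (simp add: \<alpha> \<beta> powr_def exp_add)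
  finally show ?thesis .
qed

text \<open>Since \<open>\<phi> x / x\<close> is nondecreasing, \<open>y \<mapsto> sqrt (\<phi> (y\<^sup>2))\<close> lies above the line through the
  origin and its value at \<open>S / 2\<close> for all \<open>y \<ge> S / 2\<close>; the smaller \<open>y\<close> contribute at most half of the average \<open>S\<close>.\<close>

lemma orlicz_sqrt_average:
  fixes X :: "nat \<Rightarrow> real"
  assumes \<phi>: "orlicz_function \<phi>" and X: "\<And>k. 0 \<le> X k" and n: "0 < n" and t: "0 < t"
    and less: "t < \<phi> (((\<Sum>k<n. sqrt (X k)) / real n)\<^sup>2 / 4)"
  shows "sqrt t \<le> (\<Sum>k<n. if t < \<phi> (X k) then sqrt (\<phi> (X k)) else 0) / real n"
proof -
  define S where "S = (\<Sum>k<n. sqrt (X k)) / real n"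
  define R where "R = \<phi> (S\<^sup>2 / 4)"
  have Snn: "0 \<le> S" using X n by (auto simp: S_def intro!: divide_nonneg_nonneg sum_nonneg)
  have tR: "t < R" using less by (simp add: R_def S_def)
  then have "S \<noteq> 0" using t orlicz_0[OF \<phi>] by (auto simp: R_def)
  then have S: "0 < S" using Snn by simp
  have le: "(2 * sqrt R / S) * (sqrt (X k) - S / 2) \<le> (if t < \<phi> (X k) then sqrt (\<phi> (X k)) else 0)" for k
  proof (cases "S / 2 \<le> sqrt (X k)")
    case True
    then have "(S / 2)\<^sup>2 \<le> X k" using S X[of k] by (metis le_divide_eq_numeral1(1) less_imp_le mult_zero_left power_mono real_sqrt_pow2)
    then have XS: "S\<^sup>2 / 4 \<le> X k" by (simp add: power_divide)
    have Xpos: "0 < X k" using XS S by (meson divide_pos_pos less_le_trans zero_less_numeral zero_less_power)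
    have RX: "R \<le> \<phi> (X k)" unfolding R_def by (rule orlicz_mono[OF \<phi> _ XS]) simp
    have "R \<le> (S\<^sup>2 / 4 / X k) * \<phi> (X k)"
      using orlicz_star[OF \<phi>, of "S\<^sup>2 / 4 / X k" "X k"] XS Xpos by (simp add: R_def)
    then have "R * X k * (4 / S\<^sup>2) \<le> \<phi> (X k)" using Xpos S by (simp add: field_simps)
    then have "sqrt (R * X k * (2 / S)\<^sup>2) \<le> sqrt (\<phi> (X k))"
      by (intro real_sqrt_le_mono) (simp add: power_divide)
    then have "(2 * sqrt R / S) * sqrt (X k) \<le> sqrt (\<phi> (X k))"
      using S by (simp add: real_sqrt_mult mult_ac)
    moreover have "(2 * sqrt R / S) * (sqrt (X k) - S / 2) \<le> (2 * sqrt R / S) * sqrt (X k)"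
      using S tR t by (intro mult_left_mono) auto
    ultimately show ?thesis using tR RX by simp
  next
    case False
    then have "(2 * sqrt R / S) * (sqrt (X k) - S / 2) \<le> 0"
      using S tR t by (intro mult_nonneg_nonpos) auto
    also have "0 \<le> (if t < \<phi> (X k) then sqrt (\<phi> (X k)) else 0)" using orlicz_nonneg[OF \<phi> X] by simp
    finally show ?thesis .
  qed
  have "sqrt t \<le> sqrt R" using tR by simp
  also have "\<dots> = (2 * sqrt R / S) * (S - S / 2)" using S by (simp add: field_simps)
  also have "\<dots> = (\<Sum>k<n. (2 * sqrt R / S) * (sqrt (X k) - S / 2)) / real n"
  proof -
    have "(\<Sum>k<n. a * (sqrt (X k) - S / 2)) / real n = a * (S - S / 2)" for a
    proof -
      have "(\<Sum>k<n. sqrt (X k)) = real n * S" using n by (simp add: S_def)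
      then have "(\<Sum>k<n. a * (sqrt (X k) - S / 2)) = real n * (a * (S - S / 2))"
        by (simp add: sum_distrib_left[symmetric] sum_subtractf algebra_simps)
      then show ?thesis using n by simp
    qed
    from this[symmetric] show ?thesis .
  qed
  also have "\<dots> \<le> (\<Sum>k<n. if t < \<phi> (X k) then sqrt (\<phi> (X k)) else 0) / real n"
    by (intro divide_right_mono sum_mono le) auto
  finally show ?thesis .
qed

section \<open>Interpolation of Orlicz spaces\<close>

lemma closed_strip_subset_closure: "closed_strip \<subseteq> closure unit_strip"
proof
  fix z assume z: "z \<in> closed_strip"
  define t where "t n = 1 / real (Suc (Suc n))" for n
  have t: "0 < t n" "t n < 1" for n by (auto simp: t_def field_simps)
  define X where "X n = of_real (1 - t n) * z + of_real (t n / 2)" for n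
  have "X n \<in> unit_strip" for n
  proof -
    define p where "p = (1 - t n) * Re z"
    have "0 \<le> p" using z t[of n] by (simp add: p_def)
    moreover have "p \<le> 1 - t n" using z t[of n] mult_left_mono[of "Re z" 1 "1 - t n"] by (simp add: p_def)
    moreover have "Re (X n) = p + t n / 2" by (simp add: X_def p_def)
    ultimately show ?thesis using t[of n] by (simp add: unit_strip_def)
  qed
  moreover have "X \<longlonglongrightarrow> z"
  proof -
    have "(\<lambda>n. 1 / real (Suc n)) \<longlonglongrightarrow> 0"
      using LIMSEQ_inverse_real_of_nat by (simp only: inverse_eq_divide)
    from LIMSEQ_Suc[OF this] have "t \<longlonglongrightarrow> 0" by (simp add: t_def[abs_def])
    then have "X \<longlonglongrightarrow> of_real (1 - 0) * z + of_real (0 / 2)"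
      unfolding X_def by (intro tendsto_intros) auto
    then show ?thesis by simp
  qed
  ultimately show "z \<in> closure unit_strip" unfolding closure_sequential by blast
qed

lemma le_of_frequently_le_tendsto:
  fixes a l :: "'b::linorder_topology"
  assumes "\<exists>\<^sub>F k in A. a \<le> f k" "(f \<longlongrightarrow> l) A"
  shows "a \<le> l"
proof (rule ccontr)
  assume "\<not> a \<le> l"
  then have "\<forall>\<^sub>F k in A. f k < a" using order_tendstoD(2)[OF assms(2)] by simp
  then have "\<forall>\<^sub>F k in A. \<not> a \<le> f k" by eventually_elim simp
  then show False using assms(1) by (simp add: frequently_def)
qed

context semivariation_space
begin

lemma LS_tendsto_L1:
  assumes \<phi>0: "orlicz_function \<phi>0" and \<phi>1: "orlicz_function \<phi>1"
    and f: "\<forall>\<^sub>F x in A. f x \<in> carrier_of (sum_space \<mu> (L \<phi>0) (L \<phi>1))"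
    and lim: "((\<lambda>x. qnorm_of (sum_space \<mu> (L \<phi>0) (L \<phi>1)) (f x)) \<longlongrightarrow> 0) A"
  shows "((\<lambda>x. \<integral>\<^sup>+w. ennreal (norm (f x w)) \<partial>\<mu>) \<longlongrightarrow> 0) A"
proof (rule order_tendstoI)
  fix a :: ennreal assume a: "0 < a"
  define K where "K = (measure \<mu> (space \<mu>) + 1 / \<phi>0 1) + (measure \<mu> (space \<mu>) + 1 / \<phi>1 1)"
  have "0 < 1 / \<phi>0 1" "0 < 1 / \<phi>1 1" using orlicz_pos[OF \<phi>0, of 1] orlicz_pos[OF \<phi>1, of 1] by auto
  then have K: "0 < K" unfolding K_def using measure_nonneg[of \<mu> "space \<mu>"] by linarith
  obtain c where c: "0 < c" "c < a" using dense[OF a] by blast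
  then obtain b :: real where b: "0 < b" "ennreal b < a"
    by (cases c) (auto simp: ennreal_less_zero_iff)
  have "\<forall>\<^sub>F x in A. qnorm_of (sum_space \<mu> (L \<phi>0) (L \<phi>1)) (f x) < b / K"
    using lim b K by (simp add: order_tendsto_iff)
  with f show "\<forall>\<^sub>F x in A. (\<integral>\<^sup>+w. ennreal (norm (f x w)) \<partial>\<mu>) < a"
  proof eventually_elim
    case (elim x)
    have "(\<integral>\<^sup>+w. ennreal (norm (f x w)) \<partial>\<mu>) \<le> ennreal (K * (b / K))"
      unfolding K_def by (rule nn_integral_norm_le_qnorm_LS[OF \<phi>0 \<phi>1 elim(1)]) (use elim(2) in \<open>simp add: K_def\<close>)
    then show ?case using K b by simp
  qed
qed simp

context
  fixes \<phi>0 \<phi>1 \<phi> :: "real \<Rightarrow> real" and \<theta> :: real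
  assumes \<phi>0: "orlicz_function \<phi>0" and \<phi>1: "orlicz_function \<phi>1" and \<phi>: "orlicz_function \<phi>"
    and \<theta>: "0 < \<theta>" "\<theta> < 1"
    and inv: "\<And>s. 0 \<le> s \<Longrightarrow> inv_into {0..} \<phi> s =
      (inv_into {0..} \<phi>0 s) powr (1 - \<theta>) * (inv_into {0..} \<phi>1 s) powr \<theta>"
begin

text \<open>The common factor 4 M comes out of the weighted geometric mean unchanged, because the
  exponents add up to 1; what remains is the product of powers that defines the inverse of
  \<phi>.\<close>

lemma norm_le_of_weighted:
  assumes t: "0 < t" and M: "0 < M"
    and le: "\<And>c. sqrt x \<le> \<theta> * (exp (c * (1 - \<theta>) / 2) * sqrt (4 * M * inv_into {0..} \<phi>1 t))
      + (1 - \<theta>) * (exp (c * (0 - \<theta>) / 2) * sqrt (4 * M * inv_into {0..} \<phi>0 t))" and x: "0 \<le> x"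
  shows "\<phi> (x / (4 * M)) \<le> t"
proof -
  define a b where "a = inv_into {0..} \<phi>0 t" and "b = inv_into {0..} \<phi>1 t"
  have a: "0 < a"
    using inv_orlicz_less[OF \<phi>0, of 0 t] t inv_orlicz_nonneg[OF \<phi>0, of 0] by (simp add: a_def)
  have b: "0 < b"
    using inv_orlicz_less[OF \<phi>1, of 0 t] t inv_orlicz_nonneg[OF \<phi>1, of 0] by (simp add: b_def)
  have sq: "(sqrt y powr p)\<^sup>2 = y powr p" if "0 \<le> y" for y p :: real
    using that by (simp add: power2_eq_square powr_mult[symmetric])
  have "sqrt x \<le> sqrt (4 * M * a) powr (1 - \<theta>) * sqrt (4 * M * b) powr \<theta>"
    using le a b M by (intro weighted_sum_optimum) (auto simp: a_def b_def)
  then have "(sqrt x)\<^sup>2 \<le> (sqrt (4 * M * a) powr (1 - \<theta>) * sqrt (4 * M * b) powr \<theta>)\<^sup>2"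
    using x by (intro power_mono) auto
  also have "\<dots> = (4 * M * a) powr (1 - \<theta>) * (4 * M * b) powr \<theta>"
    using a b M by (simp only: power_mult_distrib sq mult_nonneg_nonneg less_imp_le zero_le_numeral)
  also have "\<dots> = ((4 * M) powr (1 - \<theta>) * (4 * M) powr \<theta>) * (a powr (1 - \<theta>) * b powr \<theta>)"
    using a b M by (simp add: powr_mult)
  also have "(4 * M) powr (1 - \<theta>) * (4 * M) powr \<theta> = 4 * M"
    using M by (simp add: powr_add[symmetric])
  also have "a powr (1 - \<theta>) * b powr \<theta> = inv_into {0..} \<phi> t" using t by (simp add: inv a_def b_def)
  finally have "x / (4 * M) \<le> inv_into {0..} \<phi> t" using x M by (simp add: field_simps)
  then have "\<phi> (x / (4 * M)) \<le> \<phi> (inv_into {0..} \<phi> t)" using x M by (intro orlicz_mono[OF \<phi>]) auto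
  then show ?thesis using t by (simp add: orlicz_inv[OF \<phi>])
qed

text \<open>The 4 in the scale compensates the quarter in \<open>orlicz_sqrt_average\<close>, and 8
  is the bound 4 of \<open>choquet_average\<close> for each of the two lines. Only finitely many
  boundary points enter at a time; the passage to the limit is left to
  \<open>choquet_le_liminf\<close>.\<close>

lemma modular_of_interp_function:
  assumes F: "F \<in> interp_functions \<mu> (L \<phi>0) (L \<phi>1)"
    and M: "interp_functions_norm (L \<phi>0) (L \<phi>1) F < M" "0 < M"
    and f[measurable]: "f \<in> borel_measurable \<mu>" and Ff: "AE w in \<mu>. F (complex_of_real \<theta>) w = f w"
  shows "modular \<phi> f (4 * M) \<le> 8"
proof -
  let ?LS = "sum_space \<mu> (L \<phi>0) (L \<phi>1)"
  define \<Phi> where "\<Phi> s = (if s then \<phi>1 else \<phi>0)" for s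
  have \<Phi>: "orlicz_function (\<Phi> s)" for s using \<phi>0 \<phi>1 by (simp add: \<Phi>_def)
  have Fb: "qn_bounded_on ?LS unit_strip F" "qn_analytic_on ?LS unit_strip F"
    "qn_continuous_on ?LS (closure unit_strip) F"
    "qn_bounded_on (L \<phi>0) UNIV (\<lambda>t. F (Complex 0 t))" "qn_bounded_on (L \<phi>1) UNIV (\<lambda>t. F (Complex 1 t))"
    using F by (auto simp: interp_functions_def)
  have sc: "unit_strip \<subseteq> closed_strip" by (auto simp: unit_strip_def)
  have trace: "F (Complex (of_bool s) t) \<in> carrier_of (L (\<Phi> s))"
      "qnorm_of (L (\<Phi> s)) (F (Complex (of_bool s) t)) < M" for s t
  proof -
    show "F (Complex (of_bool s) t) \<in> carrier_of (L (\<Phi> s))"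
      using Fb(4,5) by (cases s) (auto simp: qn_bounded_on_def \<Phi>_def)
    have "bdd_above (range (\<lambda>t. qnorm_of (L \<phi>0) (F (Complex 0 t))))"
      using Fb(4) by (auto simp: qn_bounded_on_def bdd_above_def)
    then have "qnorm_of (L \<phi>0) (F (Complex 0 t)) \<le> (SUP t. qnorm_of (L \<phi>0) (F (Complex 0 t)))"
      by (intro cSUP_upper) auto
    moreover have "bdd_above (range (\<lambda>t. qnorm_of (L \<phi>1) (F (Complex 1 t))))"
      using Fb(5) by (auto simp: qn_bounded_on_def bdd_above_def)
    then have "qnorm_of (L \<phi>1) (F (Complex 1 t)) \<le> (SUP t. qnorm_of (L \<phi>1) (F (Complex 1 t)))"
      by (intro cSUP_upper) auto
    ultimately show "qnorm_of (L (\<Phi> s)) (F (Complex (of_bool s) t)) < M"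
      using M(1) unfolding interp_functions_norm_def by (cases s) (auto simp: \<Phi>_def)
  qed
  have trace1: "modular (\<Phi> s) (F z) M \<le> 1" if "Re z = of_bool s" for s z
    using modular_le_1_of_qnorm_less(2)[OF \<Phi> trace(1) trace(2)] that by (metis complex.collapse)
  have F_LS: "F z \<in> carrier_of ?LS" if "z \<in> closed_strip" for z
    using Fb(3) closed_strip_subset_closure that by (auto simp: qn_continuous_on_def)
  have Fm: "F z \<in> borel_measurable \<mu>" if "z \<in> closed_strip" for z
    by (rule in_LS_measurable[OF \<phi>0 \<phi>1 F_LS[OF that]])
  have Fcont: "(\<lambda>n::nat. \<integral>\<^sup>+w. ennreal (norm (F (X n) w - F z w)) \<partial>\<mu>) \<longlonglongrightarrow> 0"
    if X: "\<And>n. X n \<in> closed_strip" "X \<longlonglongrightarrow> z" for X z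
  proof -
    have z: "z \<in> closed_strip" using closed_sequentially[OF closed_strip _ X(2)] X(1) by blast
    define I where "I z' = (\<integral>\<^sup>+w. ennreal (norm (F z' w - F z w)) \<partial>\<mu>)" for z'
    have zc: "z \<in> closure unit_strip" using z closed_strip_subset_closure by blast
    have "((\<lambda>z'. qnorm_of ?LS (\<lambda>w. F z' w - F z w)) \<longlongrightarrow> 0) (at z within closure unit_strip)"
      using Fb(3) zc by (auto simp: qn_continuous_on_def)
    moreover have "\<forall>\<^sub>F z' in at z within closure unit_strip. (\<lambda>w. F z' w - F z w) \<in> carrier_of ?LS"
      unfolding eventually_at_filter
      using closure_unit_strip by (intro always_eventually allI impI LS_diff[OF \<phi>0 \<phi>1 F_LS F_LS] z) blast
    ultimately have "(I \<longlongrightarrow> 0) (at z within closure unit_strip)"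
      unfolding I_def by (intro LS_tendsto_L1[OF \<phi>0 \<phi>1])
    \<comment> \<open>The punctured filter at \<open>z\<close> ignores \<open>z\<close> itself; the
      value 0 there extends the limit to sequences that hit \<open>z\<close>.\<close>
    moreover have "I z = 0" by (simp add: I_def)
    ultimately have "continuous (at z within closure unit_strip) I"
      by (simp add: continuous_within)
    moreover have "\<forall>n. X n \<in> closure unit_strip" using X(1) closed_strip_subset_closure by auto
    ultimately have "(I \<circ> X) \<longlonglongrightarrow> I z"
      using X(2) by (simp add: continuous_within_sequentially)
    then show ?thesis using \<open>I z = 0\<close> by (simp add: I_def comp_def)
  qed
  \<comment> \<open>Boundedness in the sum space is given on the open strip; on the two lines the
    bounded traces supply it.\<close>
  obtain B where Fbd: "(\<integral>\<^sup>+w. ennreal (norm (F z w)) \<partial>\<mu>) \<le> ennreal B" if "z \<in> closed_strip" for z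
  proof -
    obtain B1 where B1: "\<And>z. z \<in> unit_strip \<Longrightarrow> qnorm_of ?LS (F z) \<le> B1"
      using Fb(1) by (auto simp: qn_bounded_on_def)
    define K where "K = (measure \<mu> (space \<mu>) + 1 / \<phi>0 1) + (measure \<mu> (space \<mu>) + 1 / \<phi>1 1)"
    define K' where "K' s = measure \<mu> (space \<mu>) + 1 / \<Phi> s 1" for s
    show thesis
    proof (rule that)
      fix z assume z: "z \<in> closed_strip"
      have le: "(\<integral>\<^sup>+w. ennreal (norm (F z w)) \<partial>\<mu>) \<le> ennreal (K' s * M)" if "Re z = of_bool s" for s
        unfolding K'_def
        using nn_integral_norm_le_qnorm[OF \<Phi> trace(1) trace(2)] that by (metis complex.collapse)
      consider "z \<in> unit_strip" | "Re z = of_bool False" | "Re z = of_bool True"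
        using z unfolding unit_strip_def by fastforce
      then show "(\<integral>\<^sup>+w. ennreal (norm (F z w)) \<partial>\<mu>)
         \<le> ennreal (max (K * (B1 + 1)) (max (K' False * M) (K' True * M)))"
      proof cases
        case 1
        have "(\<integral>\<^sup>+w. ennreal (norm (F z w)) \<partial>\<mu>) \<le> ennreal (K * (B1 + 1))"
          unfolding K_def
          by (rule nn_integral_norm_le_qnorm_LS[OF \<phi>0 \<phi>1 F_LS[OF z]]) (use B1[OF 1] in simp)
        then show ?thesis by (rule order_trans) (intro ennreal_leI, simp)
      next
        case 2
        from le[OF this] show ?thesis by (rule order_trans) (intro ennreal_leI, simp)
      next
        case 3
        from le[OF this] show ?thesis by (rule order_trans) (intro ennreal_leI, simp)
      qed
    qed
  qed
  have "\<exists>G. (\<forall>w. (\<lambda>z. G z w) holomorphic_on unit_strip) \<and> (\<forall>z\<in>unit_strip. G z \<in> borel_measurable \<mu>) \<and>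
    (\<forall>z\<in>unit_strip. AE w in \<mu>. G z w = F z w)"
  proof (rule L1_analytic_pointwise)
    show "F z \<in> borel_measurable \<mu>" if "z \<in> unit_strip" for z using Fm that sc by blast
    fix z0 assume z0: "z0 \<in> unit_strip"
    have "\<exists>r>0. \<exists>a::nat \<Rightarrow> 'w \<Rightarrow> complex. ball z0 r \<subseteq> unit_strip \<and> (\<forall>n. a n \<in> carrier_of ?LS) \<and>
        (\<forall>z \<in> ball z0 r. (\<lambda>n. qnorm_of ?LS (\<lambda>w. F z w - (\<Sum>k<n. (z - z0) ^ k * a k w))) \<longlonglongrightarrow> 0)"
      using Fb(2) z0 unfolding qn_analytic_on_def by (elim conjE) (erule bspec)
    then obtain r and a :: "nat \<Rightarrow> 'w \<Rightarrow> complex" where r: "0 < r" "ball z0 r \<subseteq> unit_strip"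
      and a': "\<forall>n. a n \<in> carrier_of ?LS"
      and lim': "\<forall>z \<in> ball z0 r. (\<lambda>n. qnorm_of ?LS (\<lambda>w. F z w - (\<Sum>k<n. (z - z0) ^ k * a k w))) \<longlonglongrightarrow> 0"
      by (elim exE conjE) (rule that)
    have a: "a n \<in> carrier_of ?LS" for n using a' by (rule spec)
    note lim = bspec[OF lim']
    have "(\<lambda>n. \<integral>\<^sup>+w. ennreal (norm (F z w - (\<Sum>k<n. (z - z0) ^ k * a k w))) \<partial>\<mu>) \<longlonglongrightarrow> 0" if z: "z \<in> ball z0 r" for z
    proof (rule LS_tendsto_L1[OF \<phi>0 \<phi>1 _ lim[OF z]])
      have "F z \<in> carrier_of ?LS" using z r sc by (intro F_LS) blast
      then show "\<forall>\<^sub>F n in sequentially. (\<lambda>w. F z w - (\<Sum>k<n. (z - z0) ^ k * a k w)) \<in> carrier_of ?LS"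
        by (intro always_eventually allI LS_sum[OF \<phi>0 \<phi>1 a])
    qed
    moreover have "(\<integral>\<^sup>+w. ennreal (norm (a n w)) \<partial>\<mu>) < \<infinity>" for n
      using nn_integral_norm_le_qnorm_LS[OF \<phi>0 \<phi>1 a, of n "qnorm_of ?LS (a n) + 1"]
      by (auto intro: le_less_trans)
    ultimately show "\<exists>r>0. \<exists>a::nat \<Rightarrow> 'w \<Rightarrow> complex. ball z0 r \<subseteq> unit_strip \<and>
      (\<forall>n. a n \<in> borel_measurable \<mu> \<and> (\<integral>\<^sup>+w. ennreal (norm (a n w)) \<partial>\<mu>) < \<infinity>) \<and>
      (\<forall>z\<in>ball z0 r. (\<lambda>n. \<integral>\<^sup>+w. ennreal (norm (F z w - (\<Sum>k<n. (z - z0) ^ k * a k w))) \<partial>\<mu>) \<longlonglongrightarrow> 0)"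
      using r in_LS_measurable[OF \<phi>0 \<phi>1 a]
      by (intro exI[of _ r] exI[of _ a] conjI allI ballI)
  qed
  then obtain G where Ghol: "\<And>w. (\<lambda>z. G z w) holomorphic_on unit_strip"
    and Gm: "\<And>z. z \<in> unit_strip \<Longrightarrow> G z \<in> borel_measurable \<mu>"
    and GF: "\<And>z. z \<in> unit_strip \<Longrightarrow> AE w in \<mu>. G z w = F z w" by metis
  let ?\<psi> = "disc_to_strip \<theta>"
  define q where "q s y = ?\<psi> (arc \<theta> s y)" for s y
  have Re_q: "Re (q s y) = of_bool s" if "y \<in> {0<..<1}" for s y
    unfolding q_def by (rule disc_to_strip_arc(2)[OF \<theta> that])
  define err where "err s n w = (\<integral>\<^sup>+y\<in>{0<..<1}. ennreal
      (sqrt (norm (G (?\<psi> (radius n * arc \<theta> s y)) w - F (q s (midpoint_grid n y)) w)) +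
       sqrt (norm (F (q s (midpoint_grid n y)) w)) * \<bar>Re (?\<psi> (radius n * arc \<theta> s y)) - of_bool s\<bar>) \<partial>lborel)" for s n w
  have err: "err s n \<in> borel_measurable \<mu>" "(\<lambda>n. \<integral>\<^sup>+w. err s n w \<partial>\<mu>) \<longlonglongrightarrow> 0" for s n
    unfolding err_def[abs_def] q_def
    by (rule boundary_error[OF Fm Gm GF holomorphic_on_imp_continuous_on[OF Ghol] Fcont Fbd
          disc_to_strip_in_strip[OF \<theta>] holomorphic_on_imp_continuous_on[OF disc_to_strip_holomorphic[OF \<theta>]]
          norm_arc continuous_arc disc_to_strip_arc[OF \<theta>]]; simp)+
  note [measurable] = err(1)
  have "(\<lambda>n. \<integral>\<^sup>+w. err True n w + err False n w \<partial>\<mu>) \<longlonglongrightarrow> 0"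
    using tendsto_add[OF err(2)[of True] err(2)[of False]] by (simp add: nn_integral_add)
  then obtain ks :: "nat \<Rightarrow> nat" where ks: "AE w in \<mu>. (\<lambda>k. err True (ks k) w + err False (ks k) w) \<longlonglongrightarrow> 0"
    using AE_tendsto_of_nn_integral[of "\<lambda>n w. err True n w + err False n w" \<mu>] by auto
  define \<zeta> where "\<zeta> s n i = q s ((real i + 1 / 2) / real (Suc n))" for s n i
  have \<zeta>: "Re (\<zeta> s n i) = of_bool s" "\<zeta> s n i \<in> closed_strip" if "i < Suc n" for s n i
    using Re_q[OF midpoint_in_unit_interval[OF that]] by (auto simp: \<zeta>_def)
  define avg where "avg s n w = (\<Sum>i<Suc n. sqrt (norm (F (\<zeta> s n i) w))) / real (Suc n)" for s n w
  have avg_nn: "0 \<le> avg s n w" for s n w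
    unfolding avg_def by (intro divide_nonneg_nonneg sum_nonneg) auto
  have F\<zeta>[measurable]: "F (\<zeta> s n i) \<in> borel_measurable \<mu>" if "i < Suc n" for s n i
    by (rule Fm[OF \<zeta>(2)[OF that]])
  have avg_m[measurable]: "avg s n \<in> borel_measurable \<mu>" for s n
    unfolding avg_def[abs_def] by (intro borel_measurable_divide borel_measurable_sum) auto
  \<comment> \<open>The argument of \<open>\<Phi> s\<close> is a quarter of the squared average of
    the square roots of |F| / M, the expression that \<open>orlicz_sqrt_average\<close>
    treats.\<close>
  define v where "v s n w = \<Phi> s ((avg s n w)\<^sup>2 / (4 * M))" for s n w
  have v_m[measurable]: "v s n \<in> borel_measurable \<mu>" for s n
    unfolding v_def[abs_def] using M by (intro measurable_orlicz[OF \<Phi>]) auto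
  have v_nn: "0 \<le> v s n w" for s n w
    unfolding v_def using M by (intro orlicz_nonneg[OF \<Phi>]) auto
  have v4: "choquet (v s n) \<le> 4" for s n
  \<comment> \<open>\<open>choquet_average\<close> asks for a measurable function at every index.
    Beyond the grid the functions are set to 0, since the sampled points are known to lie in the
    closed strip only for indices below \<open>Suc n\<close>.\<close>
  proof (rule choquet_average[of "Suc n" _ "\<lambda>k w. if k < Suc n then \<Phi> s (norm (F (\<zeta> s n k) w) / M) else 0"])
    show "(\<lambda>w. if k < Suc n then \<Phi> s (norm (F (\<zeta> s n k) w) / M) else 0) \<in> borel_measurable \<mu>" for k
      using measurable_modular[OF \<Phi> F\<zeta>[of k n s] M(2)] by (cases "k < Suc n") simp_all
    show "choquet (\<lambda>w. if k < Suc n then \<Phi> s (norm (F (\<zeta> s n k) w) / M) else 0) \<le> 1" if "k < Suc n" for k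
      using trace1[OF \<zeta>(1)[OF that]] that by (simp add: modular_def)
    fix w t assume t: "0 < t" "t < v s n w"
    have "(\<Sum>k<Suc n. sqrt (norm (F (\<zeta> s n k) w) / M)) / real (Suc n) = avg s n w / sqrt M"
      unfolding avg_def real_sqrt_divide sum_divide_distrib[symmetric] by simp
    then have eq: "((\<Sum>k<Suc n. sqrt (norm (F (\<zeta> s n k) w) / M)) / real (Suc n))\<^sup>2 / 4 = (avg s n w)\<^sup>2 / (4 * M)"
      using M by (simp only: power_divide) simp
    have "t < \<Phi> s (((\<Sum>k<Suc n. sqrt (norm (F (\<zeta> s n k) w) / M)) / real (Suc n))\<^sup>2 / 4)"
      using t(2) by (simp only: eq v_def)
    then have "sqrt t \<le> (\<Sum>k<Suc n. if t < \<Phi> s (norm (F (\<zeta> s n k) w) / M)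
        then sqrt (\<Phi> s (norm (F (\<zeta> s n k) w) / M)) else 0) / real (Suc n)"
      using M by (intro orlicz_sqrt_average[OF \<Phi> _ _ t(1)]) auto
    also have "(\<Sum>k<Suc n. if t < \<Phi> s (norm (F (\<zeta> s n k) w) / M)
        then sqrt (\<Phi> s (norm (F (\<zeta> s n k) w) / M)) else 0)
      = (\<Sum>k<Suc n. if t < (if k < Suc n then \<Phi> s (norm (F (\<zeta> s n k) w) / M) else 0)
        then sqrt (if k < Suc n then \<Phi> s (norm (F (\<zeta> s n k) w) / M) else 0) else 0)"
      by (intro sum.cong refl) simp
    finally show "sqrt t \<le> (\<Sum>k<Suc n. if t < (if k < Suc n then \<Phi> s (norm (F (\<zeta> s n k) w) / M) else 0)
        then sqrt (if k < Suc n then \<Phi> s (norm (F (\<zeta> s n k) w) / M) else 0) else 0) / real (Suc n)" .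
  qed auto
  define V where "V n w = max (v False n w) (v True n w)" for n w
  have [measurable]: "V n \<in> borel_measurable \<mu>" for n unfolding V_def[abs_def] by measurable
  have V8: "choquet (V n) \<le> 8" for n
  proof -
    have "choquet (V n) \<le> choquet (v False n) + choquet (v True n)"
      unfolding V_def[abs_def] by (rule choquet_max) auto
    also have "\<dots> \<le> 4 + 4" by (intro add_mono v4)
    finally show ?thesis by simp
  qed
  \<comment> \<open>A bound on \<open>V\<close> for infinitely many k suffices: for those k both
    averages are at most \<open>\<beta> s\<close>, while the error tends to 0 along all k.\<close>
  have pw: "\<phi> (norm (G (of_real \<theta>) w) / (4 * M)) \<le> t"
    if e0: "(\<lambda>k. err True (ks k) w + err False (ks k) w) \<longlonglongrightarrow> 0" and t: "0 < t"
      and fr: "\<exists>\<^sub>F k in sequentially. V (ks k) w \<le> t" for w t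
  proof (rule norm_le_of_weighted[OF t M(2)])
    fix c :: real
    define \<beta> where "\<beta> s = sqrt (4 * M * inv_into {0..} (\<Phi> s) t)" for s
    have \<beta>: "0 \<le> \<beta> s" for s
      unfolding \<beta>_def using M t inv_orlicz_nonneg[OF \<Phi>, of t s] by simp
    define C where "C = (1 + \<bar>c\<bar>) * exp \<bar>c\<bar>"
    define R where "R = \<theta> * (exp (c * (1 - \<theta>) / 2) * \<beta> True) + (1 - \<theta>) * (exp (c * (0 - \<theta>) / 2) * \<beta> False)"
    have "\<exists>\<^sub>F k in sequentially. ennreal (sqrt (norm (G (of_real \<theta>) w)))
       \<le> ennreal R + ennreal C * (err True (ks k) w + err False (ks k) w)"
      using fr
    proof (rule frequently_mono[rotated], intro allI impI)
      fix k assume Vt: "V (ks k) w \<le> t"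
      have avg_le: "avg s (ks k) w \<le> \<beta> s" for s
      proof -
        have "v s (ks k) w \<le> t" using Vt by (cases s) (auto simp: V_def)
        also have "t = \<Phi> s (inv_into {0..} (\<Phi> s) t)" using t by (simp add: orlicz_inv[OF \<Phi>])
        finally have "(avg s (ks k) w)\<^sup>2 / (4 * M) \<le> inv_into {0..} (\<Phi> s) t"
          unfolding v_def using M t inv_orlicz_nonneg[OF \<Phi>, of t s] by (subst (asm) orlicz_le_iff[OF \<Phi>]) auto
        then have "(avg s (ks k) w)\<^sup>2 \<le> 4 * M * inv_into {0..} (\<Phi> s) t"
          using M by (simp add: field_simps)
        then show ?thesis unfolding \<beta>_def by (rule real_le_rsqrt)
      qed
      define A where "A s = (\<integral>\<^sup>+y\<in>{0<..<1}. ennreal (sqrt (norm (F (q s (midpoint_grid (ks k) y)) w))) \<partial>lborel)" for s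
      have A: "A s \<le> ennreal (\<beta> s)" for s
      proof -
        have "A s = ennreal (avg s (ks k) w)"
          unfolding A_def avg_def \<zeta>_def by (rule nn_integral_midpoint) simp
        then show ?thesis using avg_le by (simp add: ennreal_leI)
      qed
      have "ennreal (sqrt (norm (G (of_real \<theta>) w))) \<le>
        ennreal \<theta> * (ennreal (exp (c * (1 - \<theta>) / 2)) * A True + ennreal C * err True (ks k) w) +
        ennreal (1 - \<theta>) * (ennreal (exp (c * (0 - \<theta>) / 2)) * A False + ennreal C * err False (ks k) w)"
        unfolding A_def C_def err_def
        by (rule sqrt_norm_interior_le[OF \<theta> Ghol, where H = "\<lambda>s y. F (q s y) w"])
      also have "\<dots> \<le> ennreal \<theta> * (ennreal (exp (c * (1 - \<theta>) / 2)) * ennreal (\<beta> True) + ennreal C * err True (ks k) w) +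
        ennreal (1 - \<theta>) * (ennreal (exp (c * (0 - \<theta>) / 2)) * ennreal (\<beta> False) + ennreal C * err False (ks k) w)"
        by (intro add_mono mult_left_mono A order_refl) auto
      also have "\<dots> = (ennreal \<theta> * (ennreal (exp (c * (1 - \<theta>) / 2)) * ennreal (\<beta> True))
          + ennreal (1 - \<theta>) * (ennreal (exp (c * (0 - \<theta>) / 2)) * ennreal (\<beta> False)))
        + (ennreal \<theta> * (ennreal C * err True (ks k) w) + ennreal (1 - \<theta>) * (ennreal C * err False (ks k) w))"
        by (simp only: distrib_left add_ac)
      also have "ennreal \<theta> * (ennreal (exp (c * (1 - \<theta>) / 2)) * ennreal (\<beta> True))
          + ennreal (1 - \<theta>) * (ennreal (exp (c * (0 - \<theta>) / 2)) * ennreal (\<beta> False)) = ennreal R"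
        unfolding R_def using \<theta> \<beta>
        by (simp add: ennreal_mult[symmetric] ennreal_plus[symmetric] del: ennreal_plus)
      also have "ennreal \<theta> * (ennreal C * err True (ks k) w) + ennreal (1 - \<theta>) * (ennreal C * err False (ks k) w)
        \<le> 1 * (ennreal C * err True (ks k) w) + 1 * (ennreal C * err False (ks k) w)"
        using \<theta> by (intro add_mono mult_right_mono) (auto simp: ennreal_le_1)
      also have "\<dots> = ennreal C * (err True (ks k) w + err False (ks k) w)" by (simp add: distrib_left)
      finally show "ennreal (sqrt (norm (G (of_real \<theta>) w)))
        \<le> ennreal R + ennreal C * (err True (ks k) w + err False (ks k) w)" by (simp add: add_left_mono)
    qed
    moreover have "(\<lambda>k. ennreal R + ennreal C * (err True (ks k) w + err False (ks k) w)) \<longlonglongrightarrow> ennreal R + ennreal C * 0"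
      by (intro tendsto_add tendsto_const ennreal_tendsto_cmult e0) simp
    ultimately have "ennreal (sqrt (norm (G (of_real \<theta>) w))) \<le> ennreal R + ennreal C * 0"
      by (rule le_of_frequently_le_tendsto)
    then have "ennreal (sqrt (norm (G (of_real \<theta>) w))) \<le> ennreal R" by simp
    moreover have "0 \<le> R" unfolding R_def using \<theta> \<beta> by (intro add_nonneg_nonneg mult_nonneg_nonneg) auto
    ultimately have "sqrt (norm (G (of_real \<theta>) w)) \<le> R" by simp
    then show "sqrt (norm (G (of_real \<theta>) w)) \<le> \<theta> * (exp (c * (1 - \<theta>) / 2) * sqrt (4 * M * inv_into {0..} \<phi>1 t))
      + (1 - \<theta>) * (exp (c * (0 - \<theta>) / 2) * sqrt (4 * M * inv_into {0..} \<phi>0 t))"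
      by (simp add: R_def \<beta>_def \<Phi>_def)
  qed auto
  have "modular \<phi> f (4 * M) \<le> liminf (\<lambda>k. choquet (V (ks k)))"
    unfolding modular_def
  proof (rule choquet_le_liminf)
    have "of_real \<theta> \<in> unit_strip" using \<theta> by (simp add: unit_strip_def)
    from ks GF[OF this] Ff
    show "AE w in \<mu>. \<forall>t. (\<exists>\<^sub>F k in sequentially. V (ks k) w \<le> t) \<longrightarrow> \<phi> (norm (f w) / (4 * M)) \<le> t"
    proof eventually_elim
      case (elim w)
      show ?case
      proof (intro allI impI)
        fix t assume fr: "\<exists>\<^sub>F k in sequentially. V (ks k) w \<le> t"
        have "0 \<le> V n w" for n using v_nn[of False n w] by (simp add: V_def le_max_iff_disj)
        then have t: "0 \<le> t" using fr by (meson frequently_ex order_trans)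
        show "\<phi> (norm (f w) / (4 * M)) \<le> t"
        \<comment> \<open>\<open>pw\<close> needs a positive level, whereas \<open>t\<close> may be
          0 here.\<close>
        proof (rule field_le_epsilon)
          fix e :: real assume e: "0 < e"
          have "\<exists>\<^sub>F k in sequentially. V (ks k) w \<le> t + e"
            using fr by (rule frequently_elim1) (use e in simp)
          from pw[OF elim(1) _ this] show "\<phi> (norm (f w) / (4 * M)) \<le> t + e"
            using e t elim(2,3) by simp
        qed
      qed
    qed
  qed (use measurable_modular[OF \<phi> f, of "4 * M"] M in auto)
  also have "\<dots> \<le> liminf (\<lambda>k. 8)" by (intro Liminf_mono always_eventually allI V8)
  also have "\<dots> = 8" by (rule lim_imp_Liminf) auto
  finally show ?thesis .
qed

end

lemma interp_functions_norm_nonneg: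
  assumes \<phi>0: "orlicz_function \<phi>0" and F: "F \<in> interp_functions \<mu> (L \<phi>0) (L \<phi>1)"
  shows "0 \<le> interp_functions_norm (L \<phi>0) (L \<phi>1) F"
proof -
  have b: "qn_bounded_on (L \<phi>0) UNIV (\<lambda>t. F (Complex 0 t))"
    using F by (simp add: interp_functions_def)
  then have "F (Complex 0 0) \<in> carrier_of (L \<phi>0)" by (simp add: qn_bounded_on_def)
  then have "0 \<le> qnorm_of (L \<phi>0) (F (Complex 0 0))" by (rule qnorm_nonneg[OF \<phi>0])
  also have "\<dots> \<le> (SUP t. qnorm_of (L \<phi>0) (F (Complex 0 t)))"
    using b by (intro cSUP_upper) (auto simp: qn_bounded_on_def bdd_above_def)
  finally show ?thesis by (simp add: interp_functions_norm_def le_max_iff_disj)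
qed

theorem complex_interp_orlicz:
  assumes \<phi>0: "orlicz_function \<phi>0" and \<phi>1: "orlicz_function \<phi>1" and \<phi>: "orlicz_function \<phi>"
    and D: "Delta2 \<phi>0" "Delta2 \<phi>1" and \<theta>: "0 < \<theta>" "\<theta> < 1"
    and inv: "\<And>s. 0 \<le> s \<Longrightarrow> inv_into {0..} \<phi> s =
      (inv_into {0..} \<phi>0 s) powr (1 - \<theta>) * (inv_into {0..} \<phi>1 s) powr \<theta>"
  shows "same_qnspace (complex_interp \<mu> (L \<phi>0) (L \<phi>1) \<theta>) (L \<phi>)"
proof -
  let ?I = "complex_interp \<mu> (L \<phi>0) (L \<phi>1) \<theta>"
  let ?N = "interp_functions_norm (L \<phi>0) (L \<phi>1)"
  have upper: "f \<in> carrier_of (L \<phi>) \<and> qnorm_of (L \<phi>) f \<le> 32 * ?N F"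
    if f: "f \<in> borel_measurable \<mu>" and F: "F \<in> interp_functions \<mu> (L \<phi>0) (L \<phi>1)"
      and Ff: "AE w in \<mu>. F (complex_of_real \<theta>) w = f w" for f F
  proof -
    have *: "f \<in> carrier_of (L \<phi>) \<and> qnorm_of (L \<phi>) f \<le> 32 * M" if M: "?N F < M" for M
    proof -
      have M0: "0 < M" using M interp_functions_norm_nonneg[OF \<phi>0 F] by simp
      \<comment> \<open>Enlarging the scale by 8 brings the modular bound from 8 down to 1; this is
        the origin of the factor 32.\<close>
      have "modular \<phi> f (8 * (4 * M)) \<le> ennreal (1 / 8) * modular \<phi> f (4 * M)"
        using M0 by (intro modular_scale[OF \<phi> f]) auto
      also have "\<dots> \<le> ennreal (1 / 8) * 8"
        by (intro mult_left_mono modular_of_interp_function[OF \<phi>0 \<phi>1 \<phi> \<theta> inv F M M0 f Ff]) auto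
      also have "\<dots> = ennreal (1 / 8 * 8)" by (subst ennreal_mult) auto
      also have "\<dots> = 1" by simp
      finally have "modular \<phi> f (32 * M) \<le> 1" by simp
      then show ?thesis using qnorm_le[OF \<phi> f, of "32 * M"] M0 by auto
    qed
    have "qnorm_of (L \<phi>) f \<le> 32 * ?N F"
    proof (rule field_le_epsilon)
      fix e :: real assume "0 < e"
      then show "qnorm_of (L \<phi>) f \<le> 32 * ?N F + e" using *[of "?N F + e / 32"] by simp
    qed
    then show ?thesis using *[of "?N F + 1"] by simp
  qed
  have lower: "\<exists>F\<in>interp_functions \<mu> (L \<phi>0) (L \<phi>1). (AE w in \<mu>. F (complex_of_real \<theta>) w = f w) \<and> ?N F \<le> k"
    if f: "f \<in> borel_measurable \<mu>" and k: "0 < k" "modular \<phi> f k \<le> 1" for f k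
  proof -
    have "\<exists>F\<in>interp_functions \<mu> (L \<phi>0) (L \<phi>1). (\<forall>w. F (complex_of_real \<theta>) w = f w) \<and> ?N F \<le> k"
      by (rule interp_function_of_modular[OF \<phi>0 \<phi>1 \<phi> D \<theta> inv f k])
    then obtain F where "F \<in> interp_functions \<mu> (L \<phi>0) (L \<phi>1)" "\<forall>w. F (complex_of_real \<theta>) w = f w" "?N F \<le> k"
      by blast
    then show ?thesis by (intro bexI[of _ F] conjI AE_I2) auto
  qed
  have carrier: "carrier_of ?I = carrier_of (L \<phi>)"
  proof (intro set_eqI iffI)
    fix f assume "f \<in> carrier_of ?I"
    then show "f \<in> carrier_of (L \<phi>)" using upper by (auto simp: complex_interp_def)
  next
    fix f assume f: "f \<in> carrier_of (L \<phi>)"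
    then obtain k where "0 < k" "modular \<phi> f k \<le> 1" using in_L_modular_le_1[OF \<phi>] by blast
    then show "f \<in> carrier_of ?I"
      using lower[OF in_L_measurable[OF \<phi> f]] in_L_measurable[OF \<phi> f] by (auto simp: complex_interp_def)
  qed
  have bounds: "1 / 32 * qnorm_of (L \<phi>) f \<le> qnorm_of ?I f \<and> qnorm_of ?I f \<le> 1 * qnorm_of (L \<phi>) f"
    if f: "f \<in> carrier_of ?I" for f
  proof
    have fm: "f \<in> borel_measurable \<mu>" using f by (simp add: complex_interp_def)
    have fL: "f \<in> carrier_of (L \<phi>)" using f carrier by simp
    let ?S = "{?N F | F. F \<in> interp_functions \<mu> (L \<phi>0) (L \<phi>1) \<and> (AE w in \<mu>. F (complex_of_real \<theta>) w = f w)}"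
    have q: "qnorm_of ?I f = Inf ?S" by (simp add: complex_interp_def)
    have "?S \<noteq> {}" using f by (auto simp: complex_interp_def)
    then show "1 / 32 * qnorm_of (L \<phi>) f \<le> qnorm_of ?I f"
      unfolding q using upper[OF fm] by (intro cInf_greatest) fastforce+
    have bdd: "bdd_below ?S" using interp_functions_norm_nonneg[OF \<phi>0] by (auto intro!: bdd_belowI[of _ 0])
    have "Inf ?S \<le> qnorm_of (L \<phi>) f + e" if e: "0 < e" for e
    proof -
      have k: "0 < qnorm_of (L \<phi>) f + e" "modular \<phi> f (qnorm_of (L \<phi>) f + e) \<le> 1"
        using modular_le_1_of_qnorm_less[OF \<phi> fL, of "qnorm_of (L \<phi>) f + e"] e by auto
      obtain F where F: "F \<in> interp_functions \<mu> (L \<phi>0) (L \<phi>1)"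
        "AE w in \<mu>. F (complex_of_real \<theta>) w = f w" "?N F \<le> qnorm_of (L \<phi>) f + e"
        using lower[OF fm k] by blast
      then have "Inf ?S \<le> ?N F" by (intro cInf_lower bdd) auto
      then show ?thesis using F(3) by simp
    qed
    then have "Inf ?S \<le> qnorm_of (L \<phi>) f" by (rule field_le_epsilon)
    then show "qnorm_of ?I f \<le> 1 * qnorm_of (L \<phi>) f" by (simp add: q)
  qed
  have "0 < (1 / 32 :: real)" "0 < (1 :: real)" by auto
  then show ?thesis unfolding same_qnspace_def using carrier bounds by blast
qed

end

section \<open>The family of scalar variations of a vector measure\<close>

lemma vector_measure_scalar_measure:
  assumes "vector_measure M m"
  shows "vector_measure M (scalar_measure m y')"
  unfolding vector_measure_def scalar_measure_def
proof (intro allI impI)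
  fix A :: "nat \<Rightarrow> 'a set" assume "range A \<subseteq> sets M" "disjoint_family A"
  then have "(\<lambda>n. m (A n)) sums m (\<Union>n. A n)" using assms by (simp add: vector_measure_def)
  then show "(\<lambda>n. blinfun_apply y' (m (A n))) sums blinfun_apply y' (m (\<Union>n. A n))"
    by (rule bounded_linear.sums[OF blinfun.bounded_linear_right])
qed

text \<open>The control measure is the member of the family that belongs to \<open>y0\<close>, and
  its finiteness comes from \<open>variation_finite\<close>.\<close>

lemma rybakov_semivariation_space:
  assumes m: "vector_measure \<mu> m" and R: "rybakov_control_measure \<mu> m"
  shows "semivariation_space \<mu> m ((\<lambda>y'. variation_measure \<mu> (scalar_measure m y')) ` cball 0 1)"
proof -
  note rm = vector_measure_scalar_measure[OF m]
  obtain y0 where y0: "y0 \<in> cball 0 1" "\<And>A. A \<in> sets \<mu> \<Longrightarrow> emeasure \<mu> A = variation \<mu> (scalar_measure m y0) A"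
    using R by (auto simp: rybakov_control_measure_def)
  have fin: "emeasure \<mu> (space \<mu>) < \<infinity>"
    using y0(2) variation_finite[OF rm[of y0], of "space \<mu>"] by simp
  interpret finite_measure \<mu> by (rule finite_measureI) (use fin in simp)
  show ?thesis
  proof unfold_locales
    have "\<mu> = variation_measure \<mu> (scalar_measure m y0)"
      by (rule measure_eqI) (auto simp: emeasure_variation_measure[OF rm] y0(2))
    then show "\<mu> \<in> (\<lambda>y'. variation_measure \<mu> (scalar_measure m y')) ` cball 0 1"
      using y0(1) by (rule image_eqI)
    show "semivariation \<mu> m A = (SUP \<nu>\<in>(\<lambda>y'. variation_measure \<mu> (scalar_measure m y')) ` cball 0 1. emeasure \<nu> A)"
      if "A \<in> sets \<mu>" for A
      unfolding semivariation_def image_comp comp_def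
      using that by (simp add: emeasure_variation_measure[OF rm])
    show "(\<lambda>n. semivariation \<mu> m (A n)) \<longlonglongrightarrow> 0"
      if "range A \<subseteq> sets \<mu>" "(\<lambda>n. emeasure \<mu> (A n)) \<longlonglongrightarrow> 0" for A :: "nat \<Rightarrow> 'a set"
      using R that by (simp add: rybakov_control_measure_def)
  qed auto
qed

text \<open>\<open>inv_into {0..}\<close> is a two-sided inverse for a bijection of the half-line,
  so bijectivity is part of describing \<Phi> through its inverse. The properties of \<Phi> used in
  the proof are then derived by \<open>interpolated_orlicz\<close>.\<close>

theorem corollary6p5:
  fixes m :: "'w::polish_space set \<Rightarrow> 'y::banach"
    and \<mu> :: "'w measure"
    and \<Phi>0 \<Phi>1 \<Phi> :: "real \<Rightarrow> real"
    and \<theta> :: real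
  assumes "vector_measure borel m"
    and "sets \<mu> = sets borel"
    and "rybakov_control_measure \<mu> m"
    and "young_function \<Phi>0" and "young_function \<Phi>1"
    and "Delta2 \<Phi>0" and "Delta2 \<Phi>1"
    and "0 < \<theta>" and "\<theta> < 1"
    and "bij_betw \<Phi> {0..} {0..}"
    and "\<forall>s\<ge>0. inv_into {0..} \<Phi> s =
           (inv_into {0..} \<Phi>0 s) powr (1 - \<theta>) * (inv_into {0..} \<Phi>1 s) powr \<theta>"
  shows "same_qnspace
           (complex_interp \<mu> (orlicz_space \<mu> m \<Phi>0) (orlicz_space \<mu> m \<Phi>1) \<theta>)
           (orlicz_space \<mu> m \<Phi>)"
proof -
  have "vector_measure \<mu> m" using assms(1,2) by (simp add: vector_measure_def)
  then interpret semivariation_space \<mu> m "(\<lambda>y'. variation_measure \<mu> (scalar_measure m y')) ` cball 0 1"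
    using assms(3) by (rule rybakov_semivariation_space)
  have inv: "inv_into {0..} \<Phi> s = (inv_into {0..} \<Phi>0 s) powr (1 - \<theta>) * (inv_into {0..} \<Phi>1 s) powr \<theta>"
    if "0 \<le> s" for s using assms(11) that by blast
  note \<Phi>0 = young_imp_orlicz[OF assms(4)] and \<Phi>1 = young_imp_orlicz[OF assms(5)]
  show ?thesis
    by (rule complex_interp_orlicz[OF \<Phi>0 \<Phi>1 interpolated_orlicz[OF \<Phi>0 \<Phi>1 assms(8,9,10) inv]
          assms(6,7,8,9) inv])
qed

end
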